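(* Let $f=u\chi_\Omega$, where $\Omega\subset B=\{|\mathbf{x}|<1\}\subset\mathbb{R}^2$ is a compact domain with smooth boundary and $u\in C^\infty(\mathbb{R}^2)$. Let $(s_0,\theta_0)$ be such that the line $L(s_0,\theta_0)$ is not tangent to $\partial\Omega$. Let the smoothing kernel satisfy $\varphi\in H^{\lambda,\infty}(\mathbb{R}^2)$ with $\lambda>1/2$. Then the function $s\mapsto\mathcal{R}f(s,\theta_0)$ is in $H^{\beta,2}$ locally near $s_0$ for any $\beta<\lambda$.
   Context: Fourier transform: $\hat f(\xi)=\int e^{-i\mathbf{x}\cdot\xi}f(\mathbf{x})\,d\mathbf{x}$. For $\alpha\in\mathbb{R}$, $1\le p\le\infty$, $H^{\alpha,p}(\mathbb{R}^n)$ is the space of tempered distributions $f$ whose Fourier transform is a measurable function with $\|(1+|\xi|^2)^{\alpha/2}\hat f\|_{L^p(\mathbb{R}^n)}<\infty$. A distribution $g$ is in $H^{\alpha,p}$ locally near a point $y_0$ if there is $\eta\in C_c^\infty$ with $\eta(y_0)\ne0$ and $\eta g\in H^{\alpha,p}$. Fix $a,b>0$ and $2\psi\in(0,\pi)$. The V-line transform is $$\mathcal{V}_{a,b}f(\mathbf{x},\phi)=a\int_0^\infty f(\mathbf{x}+t\Phi)\,dt+b\int_0^\infty f(\mathbf{x}+t\Phi')\,dt,$$ with $\Phi=(\cos(\phi+2\psi-\pi/2),\sin(\phi+2\psi-\pi/2))$, $\Phi'=(\cos(\phi-\pi/2),\sin(\phi-\pi/2))$. Its smoothed version is $\widetilde{\mathcal{V}_{a,b}}f(\cdot,\phi)=\varphi*\mathcal{V}_{a,b}f(\cdot,\phi)$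 (convolution in $\mathbf{x}$), where $\varphi\ge0$ is a smoothing kernel with bounded support and $\int_{\mathbb{R}^2}\varphi=1$. For $s\in\mathbb{R}$, $\theta\in[-\pi,\pi]$ let $\Theta=(\cos\theta,\sin\theta)$ and $L(s,\theta)=\{\mathbf{x}\in\mathbb{R}^2:\mathbf{x}\cdot\Theta=s\}$. The non-linear transform is $$\mathcal{R}f(s,\theta)=c_0\int_{L(s,\theta)}w(\mathbf{x})f(\mathbf{x})e^{-\widetilde{\mathcal{V}_{a,b}}f(\mathbf{x},\theta)}\,dl(\mathbf{x}),$$ where $c_0>0$ is a constant, $w$ is a fixed smooth weight with $w>0$ on $B$, and $dl$ is arc length. *)

theory Defs
  imports "HOL-Analysis.Analysis"
begin

section \<open>Smooth functions\<close>

text \<open>\<open>partials [v\<^sub>1, \<dots>, v\<^sub>k] f\<close> is the iterated directional derivative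
  \<open>\<partial>\<^bsub>v\<^sub>1\<^esub> \<dots> \<partial>\<^bsub>v\<^sub>k\<^esub> f\<close>. It is meaningful where the inner derivatives are differentiable, which
  the notions below always require.\<close>

primrec partials ::
  "'a list \<Rightarrow> ('a::euclidean_space \<Rightarrow> 'b::real_normed_vector) \<Rightarrow> 'a \<Rightarrow> 'b" where
  "partials [] f = f"
| "partials (v # vs) f = (\<lambda>x. frechet_derivative (partials vs f) (at x) v)"

text \<open>Class \<open>C\<^sup>\<infinity>\<close> on an open set \<open>S\<close>: all iterated partial derivatives exist and are Frechet
  differentiable (hence continuous) at every point of \<open>S\<close>.\<close>

definition smooth_on :: "'a set \<Rightarrow> ('a::euclidean_space \<Rightarrow> 'b::real_normed_vector) \<Rightarrow> bool" where
  "smooth_on S f \<longleftrightarrow> (\<forall>vs. set vs \<subseteq> Basis \<longrightarrow> (\<forall>x\<in>S. partials vs f differentiable (at x)))"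

section \<open>Distributions and tempered distributions\<close>

text \<open>Functionals are total functions on all of \<open>'a \<Rightarrow> complex\<close>; only their values on test functions
  (respectively Schwartz functions) matter.\<close>

definition test_functions :: "('a::euclidean_space \<Rightarrow> complex) set" where
  "test_functions = {\<psi>. smooth_on UNIV \<psi> \<and> compact (closure {x. \<psi> x \<noteq> 0})}"

definition schwartz :: "('a::euclidean_space \<Rightarrow> complex) set" where
  "schwartz = {\<psi>. smooth_on UNIV \<psi> \<and>
     (\<forall>N vs. set vs \<subseteq> Basis \<longrightarrow> (\<exists>C. \<forall>x. (1 + norm x) ^ N * norm (partials vs \<psi> x) \<le> C))}"

definition linear_functional_on :: "('a \<Rightarrow> complex) set \<Rightarrow> (('a \<Rightarrow> complex) \<Rightarrow> complex) \<Rightarrow> bool" where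
  "linear_functional_on V T \<longleftrightarrow>
     (\<forall>\<psi>\<in>V. \<forall>\<omega>\<in>V. T (\<lambda>x. \<psi> x + \<omega> x) = T \<psi> + T \<omega>) \<and>
     (\<forall>\<psi>\<in>V. \<forall>c. T (\<lambda>x. c * \<psi> x) = c * T \<psi>)"

text \<open>In the next two definitions \<open>M\<close> ranges over the upper bounds of the relevant seminorm of
  \<open>\<psi>\<close>, so the last condition says that \<open>T\<close> is bounded by a constant times that seminorm.\<close>

definition distribution :: "(('a::euclidean_space \<Rightarrow> complex) \<Rightarrow> complex) \<Rightarrow> bool" where
  "distribution T \<longleftrightarrow> linear_functional_on test_functions T \<and>
     (\<forall>K. compact K \<longrightarrow> (\<exists>C N. \<forall>\<psi>\<in>test_functions. \<forall>M. {x. \<psi> x \<noteq> 0} \<subseteq> K \<longrightarrow>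
        (\<forall>vs x. set vs \<subseteq> Basis \<longrightarrow> length vs \<le> N \<longrightarrow> norm (partials vs \<psi> x) \<le> M) \<longrightarrow>
        norm (T \<psi>) \<le> C * M))"

definition tempered_distribution :: "(('a::euclidean_space \<Rightarrow> complex) \<Rightarrow> complex) \<Rightarrow> bool" where
  "tempered_distribution T \<longleftrightarrow> linear_functional_on schwartz T \<and>
     (\<exists>C N. \<forall>\<psi>\<in>schwartz. \<forall>M.
        (\<forall>vs x. set vs \<subseteq> Basis \<longrightarrow> length vs \<le> N \<longrightarrow>
           (1 + norm x) ^ N * norm (partials vs \<psi> x) \<le> M) \<longrightarrow>
        norm (T \<psi>) \<le> C * M)"

definition locally_integrable :: "('a::euclidean_space \<Rightarrow> complex) \<Rightarrow> bool" where
  "locally_integrable g \<longleftrightarrow> (\<forall>K. compact K \<longrightarrow> set_integrable lebesgue K g)"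

definition distr_of_fun :: "('a::euclidean_space \<Rightarrow> complex) \<Rightarrow> ('a \<Rightarrow> complex) \<Rightarrow> complex" where
  "distr_of_fun g \<psi> = (LINT x|lebesgue. g x * \<psi> x)"

definition fourier :: "('a::euclidean_space \<Rightarrow> complex) \<Rightarrow> 'a \<Rightarrow> complex" where
  "fourier f \<xi> = (LINT x|lebesgue. exp (- (\<i> * complex_of_real (x \<bullet> \<xi>))) * f x)"

definition fourier_distr ::
  "(('a::euclidean_space \<Rightarrow> complex) \<Rightarrow> complex) \<Rightarrow> ('a \<Rightarrow> complex) \<Rightarrow> complex" where
  "fourier_distr T \<psi> = T (fourier \<psi>)"

section \<open>The spaces \<open>H\<^sup>\<alpha>\<^sup>,\<^sup>p\<close>\<close>

text \<open>\<open>finite_Lp p h\<close> states that the \<open>L\<^sup>p\<close> norm of the Lebesgue measurable function \<open>h\<close> is finite,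
  for \<open>1 \<le> p \<le> \<infinity>\<close>.\<close>

definition finite_Lp :: "ennreal \<Rightarrow> ('a::euclidean_space \<Rightarrow> complex) \<Rightarrow> bool" where
  "finite_Lp p h \<longleftrightarrow>
     (if p = \<infinity> then \<exists>C. AE x in lebesgue. norm (h x) \<le> C
      else (\<integral>\<^sup>+x. ennreal (norm (h x) powr enn2real p) \<partial>lebesgue) < \<infinity>)"

text \<open>The function \<open>h\<close> below represents the Fourier transform of \<open>T\<close>.\<close>

definition H_space :: "real \<Rightarrow> ennreal \<Rightarrow> (('a::euclidean_space \<Rightarrow> complex) \<Rightarrow> complex) set" where
  "H_space \<alpha> p = {T. tempered_distribution T \<and>
     (\<exists>h. h \<in> borel_measurable lebesgue \<and>
        (\<forall>\<psi>\<in>schwartz. integrable lebesgue (\<lambda>\<xi>. h \<xi> * \<psi> \<xi>) \<and>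
           fourier_distr T \<psi> = distr_of_fun h \<psi>) \<and>
        finite_Lp p (\<lambda>\<xi>. complex_of_real ((1 + (norm \<xi>)\<^sup>2) powr (\<alpha> / 2)) * h \<xi>))}"

text \<open>The product \<open>\<eta>g\<close> is the functional \<open>\<psi> \<mapsto> g (\<eta>\<psi>)\<close>, which makes sense for Schwartz \<open>\<psi>\<close>
  since \<open>\<eta>\<psi>\<close> is then a test function.\<close>

definition H_locally_near ::
  "real \<Rightarrow> ennreal \<Rightarrow> 'a \<Rightarrow> (('a::euclidean_space \<Rightarrow> complex) \<Rightarrow> complex) \<Rightarrow> bool" where
  "H_locally_near \<alpha> p y\<^sub>0 g \<longleftrightarrow> distribution g \<and>
     (\<exists>\<eta>\<in>test_functions. \<eta> y\<^sub>0 \<noteq> 0 \<and> (\<lambda>\<psi>. g (\<lambda>x. \<eta> x * \<psi> x)) \<in> H_space \<alpha> p)"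

text \<open>The same for a function, identified with the distribution that it induces.\<close>

definition fun_H_locally_near ::
  "real \<Rightarrow> ennreal \<Rightarrow> 'a \<Rightarrow> ('a::euclidean_space \<Rightarrow> complex) \<Rightarrow> bool" where
  "fun_H_locally_near \<alpha> p y\<^sub>0 g \<longleftrightarrow>
     locally_integrable g \<and> H_locally_near \<alpha> p y\<^sub>0 (distr_of_fun g)"

section \<open>V-line transform and the non-linear transform\<close>

definition unit_vec :: "real \<Rightarrow> real^2" where
  "unit_vec \<theta> = vector [cos \<theta>, sin \<theta>]"

definition vline ::
  "real \<Rightarrow> real \<Rightarrow> real \<Rightarrow> (real^2 \<Rightarrow> real) \<Rightarrow> real^2 \<Rightarrow> real \<Rightarrow> real" where
  "vline a b \<psi> f x \<phi> =
     a * (LINT t:{0..}|lebesgue. f (x + t *\<^sub>R unit_vec (\<phi> + 2 * \<psi> - pi / 2))) +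
     b * (LINT t:{0..}|lebesgue. f (x + t *\<^sub>R unit_vec (\<phi> - pi / 2)))"

definition convolution :: "(real^2 \<Rightarrow> real) \<Rightarrow> (real^2 \<Rightarrow> real) \<Rightarrow> real^2 \<Rightarrow> real" where
  "convolution k g x = (LINT y|lebesgue. k y * g (x - y))"

definition smoothed_vline ::
  "(real^2 \<Rightarrow> real) \<Rightarrow> real \<Rightarrow> real \<Rightarrow> real \<Rightarrow> (real^2 \<Rightarrow> real) \<Rightarrow> real^2 \<Rightarrow> real \<Rightarrow> real" where
  "smoothed_vline k a b \<psi> f x \<phi> = convolution k (\<lambda>y. vline a b \<psi> f y \<phi>) x"

definition line :: "real \<Rightarrow> real \<Rightarrow> (real^2) set" where
  "line s \<theta> = {x. x \<bullet> unit_vec \<theta> = s}"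

text \<open>A unit vector spanning the direction of \<open>line s \<theta>\<close>.\<close>

definition line_dir :: "real \<Rightarrow> real^2" where
  "line_dir \<theta> = vector [- sin \<theta>, cos \<theta>]"

text \<open>Integration over \<open>line s \<theta>\<close> with respect to arc length, through the unit speed
  parametrisation of \<open>line_eq_range\<close>.\<close>

definition line_integral :: "real \<Rightarrow> real \<Rightarrow> (real^2 \<Rightarrow> real) \<Rightarrow> real" where
  "line_integral s \<theta> g = (LINT t|lebesgue. g (s *\<^sub>R unit_vec \<theta> + t *\<^sub>R line_dir \<theta>))"

lemma norm_line_dir: "norm (line_dir \<theta>) = 1"
  by (simp add: line_dir_def norm_vec_def L2_set_def sum_2)

lemma line_eq_range: "line s \<theta> = range (\<lambda>t. s *\<^sub>R unit_vec \<theta> + t *\<^sub>R line_dir \<theta>)"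
proof (intro set_eqI iffI)
  fix x assume x: "x \<in> line s \<theta>"
  let ?t = "x \<bullet> line_dir \<theta>"
  have s: "s = x $ 1 * cos \<theta> + x $ 2 * sin \<theta>"
    using x by (simp add: line_def unit_vec_def inner_vec_def sum_2)
  have t: "?t = x $ 2 * cos \<theta> - x $ 1 * sin \<theta>"
    by (simp add: line_dir_def inner_vec_def sum_2)
  have 1: "x $ 1 = s * cos \<theta> - ?t * sin \<theta>"
  proof -
    have "s * cos \<theta> - ?t * sin \<theta> = x $ 1 * ((cos \<theta>)\<^sup>2 + (sin \<theta>)\<^sup>2)"
      unfolding s t by (simp only: algebra_simps power2_eq_square)
    then show ?thesis by (simp only: sin_cos_squared_add2 mult_1_right)
  qed
  have 2: "x $ 2 = s * sin \<theta> + ?t * cos \<theta>"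
  proof -
    have "s * sin \<theta> + ?t * cos \<theta> = x $ 2 * ((cos \<theta>)\<^sup>2 + (sin \<theta>)\<^sup>2)"
      unfolding s t by (simp only: algebra_simps power2_eq_square)
    then show ?thesis by (simp only: sin_cos_squared_add2 mult_1_right)
  qed
  have "x = s *\<^sub>R unit_vec \<theta> + ?t *\<^sub>R line_dir \<theta>"
    using 1 2 by (simp add: vec_eq_iff forall_2 unit_vec_def line_dir_def)
  then show "x \<in> range (\<lambda>t. s *\<^sub>R unit_vec \<theta> + t *\<^sub>R line_dir \<theta>)" by blast
next
  fix x assume "x \<in> range (\<lambda>t. s *\<^sub>R unit_vec \<theta> + t *\<^sub>R line_dir \<theta>)"
  then obtain t where x: "x = s *\<^sub>R unit_vec \<theta> + t *\<^sub>R line_dir \<theta>" by blast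
  have "x \<bullet> unit_vec \<theta> =
      (s * cos \<theta> - t * sin \<theta>) * cos \<theta> + (s * sin \<theta> + t * cos \<theta>) * sin \<theta>"
    unfolding x by (simp add: unit_vec_def line_dir_def inner_vec_def sum_2)
  also have "\<dots> = s * ((cos \<theta>)\<^sup>2 + (sin \<theta>)\<^sup>2)"
    by (simp only: algebra_simps power2_eq_square)
  finally have "x \<bullet> unit_vec \<theta> = s" by (simp only: sin_cos_squared_add2 mult_1_right)
  then show "x \<in> line s \<theta>" by (simp add: line_def)
qed

definition nonlinear_transform ::
  "real \<Rightarrow> (real^2 \<Rightarrow> real) \<Rightarrow> (real^2 \<Rightarrow> real) \<Rightarrow> real \<Rightarrow> real \<Rightarrow> real \<Rightarrow> (real^2 \<Rightarrow> real) \<Rightarrow>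
   real \<Rightarrow> real \<Rightarrow> real" where
  "nonlinear_transform c\<^sub>0 w k a b \<psi> f s \<theta> =
     c\<^sub>0 * line_integral s \<theta> (\<lambda>x. w x * f x * exp (- smoothed_vline k a b \<psi> f x \<theta>))"

section \<open>Domains with smooth boundary\<close>

text \<open>\<open>\<rho>\<close> is a local defining function of \<open>\<Omega>\<close> at \<open>p\<close>: near \<open>p\<close>, \<open>\<Omega> = {\<rho> \<le> 0}\<close> and \<open>d\<rho>(p) \<noteq> 0\<close>.\<close>

definition local_defining_function :: "(real^2) set \<Rightarrow> real^2 \<Rightarrow> (real^2 \<Rightarrow> real) \<Rightarrow> bool" where
  "local_defining_function \<Omega> p \<rho> \<longleftrightarrow>
     (\<exists>U. open U \<and> p \<in> U \<and> smooth_on U \<rho> \<and> \<Omega> \<inter> U = {x \<in> U. \<rho> x \<le> 0}) \<and>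
     (\<exists>v. frechet_derivative \<rho> (at p) v \<noteq> 0)"

definition compact_smooth_domain :: "(real^2) set \<Rightarrow> bool" where
  "compact_smooth_domain \<Omega> \<longleftrightarrow> compact \<Omega> \<and> connected \<Omega> \<and>
     (\<forall>p\<in>frontier \<Omega>. \<exists>\<rho>. local_defining_function \<Omega> p \<rho>)"

text \<open>The tangent line of \<open>\<partial>\<Omega>\<close> at \<open>p\<close> is \<open>p + ker d\<rho>(p)\<close>, for any local defining function \<open>\<rho>\<close>.\<close>

definition line_tangent_to_boundary :: "real \<Rightarrow> real \<Rightarrow> (real^2) set \<Rightarrow> bool" where
  "line_tangent_to_boundary s \<theta> \<Omega> \<longleftrightarrow>
     (\<exists>p \<in> line s \<theta> \<inter> frontier \<Omega>. \<exists>\<rho>. local_defining_function \<Omega> p \<rho> \<and>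
        frechet_derivative \<rho> (at p) (line_dir \<theta>) = 0)"

end

theory Submission
  imports Defs "HOL-Probability.Characteristic_Functions" "HOL-Probability.Sinc_Integral"
begin

text \<open>Inside the unit ball the smoothed V-line transform is \<open>G = k * g\<close>, with \<open>g\<close> the V-line
  transform cut off to a large ball. Since \<open>g\<close> is in \<open>L\<^sup>2\<close> and the Fourier transform of \<open>k\<close> is
  \<open>O(|\<xi>|\<^sup>-\<^sup>\<lambda>)\<close>, \<open>G\<close> is in \<open>H\<^sup>\<lambda>\<^sup>,\<^sup>2 \<inter> L\<^sup>\<infinity>\<close>. This is measured by smooth approximations \<open>G\<^sub>j\<close> at
  scale \<open>2\<^sup>-\<^sup>j\<close>: the derivatives of order \<open>m\<close> of \<open>G\<^sub>j\<close> are \<open>O(2\<^bsup>jm\<^esup>)\<close> and those of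
  \<open>G\<^bsub>j+1\<^esub> - G\<^sub>j\<close> are \<open>O(2\<^bsup>j(m-\<lambda>)\<^esup>)\<close> in \<open>L\<^sup>2\<close>. Both properties pass to
  \<open>exp (- G\<^sub>j)\<close>. The one-dimensional Fourier transform of a localised \<open>R f\<close> is the
  integral over \<open>\<Omega>\<close> of a smooth multiple of \<open>exp (- i\<sigma> x \<bullet> \<Theta> - G)\<close>. As the line is not tangent
  to the boundary, there is locally a vector field tangent to it with \<open>\<Theta>\<close>-component 1, and
  integrating by parts along it trades powers of \<open>\<sigma>\<close> for derivatives of the amplitude without
  boundary terms. A Bessel inequality along the lines bounds the \<open>L\<^sup>2\<close> norm of the \<open>j\<close>-th
  difference with weight \<open>(1 + \<sigma>\<^sup>2)\<^sup>\<beta>\<close> by \<open>2\<^bsup>j(\<beta>-\<lambda>)\<^esup>\<close>, which is summable.\<close>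

section \<open>Calculus of smooth functions\<close>

text \<open>The indicator of \<Omega> jumps, so in general the integrand has regularity below 1/2 in
  the plane and cannot be estimated as a product. The jump only spoils derivatives across the
  boundary. A field that is tangent to it and has unit speed along \<Theta> acts on exp (- i
  \<sigma> x . \<Theta>) as the factor - i \<sigma>, so it never differentiates the indicator and
  never meets a stationary phase.

  Such integrations by parts take whole derivatives, whereas \<lambda> may be fractional, and the
  exponential does not respect frequency bands. Keeping all integer orders of a smooth sequence
  avoids fractional calculus: sup bounds are closed under products and under exp, and a difference
  of exponentials has exactly one L^2 factor in each term. The fractional order survives only in the
  rate 2^(-j\<lambda>). The final geometric ratio is 2^(\<beta>-\<lambda>), which is why \<beta>
  stays strictly below \<lambda>.

  The cutoff of the V-line transform is forced: it need not be square integrable, since it can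
  persist along whole strips. As the kernel has bounded support, only its values in a ball are felt
  on \<Omega>.\<close>

definition dd :: "'a::real_normed_vector \<Rightarrow> ('a \<Rightarrow> 'b::real_normed_vector) \<Rightarrow> 'a \<Rightarrow> 'b" where
  "dd v f x = frechet_derivative f (at x) v"

lemma dd_eq: "(f has_derivative f') (at x) \<Longrightarrow> dd v f x = f' v"
  by (metis dd_def frechet_derivative_at)

lemma has_derivative_dd: "f differentiable at x \<Longrightarrow> (f has_derivative (\<lambda>v. dd v f x)) (at x)"
  unfolding dd_def using frechet_derivative_works by blast

text \<open>No differentiability is assumed: \<open>frechet_derivative\<close> is a choice from the
  set of derivatives, and functions that agree near x have the same set.\<close>

lemma dd_cong:
  assumes "open S" "x \<in> S" "\<And>y. y \<in> S \<Longrightarrow> f y = g y"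
  shows "dd v f x = dd v g x"
proof -
  have "(f has_derivative D) (at x) \<longleftrightarrow> (g has_derivative D) (at x)" for D
    using has_derivative_transform_within_open[OF _ assms(1,2)] assms(3) by metis
  then show ?thesis unfolding dd_def frechet_derivative_def by simp
qed

lemma differentiable_cong_open:
  assumes "open S" "x \<in> S" "\<And>y. y \<in> S \<Longrightarrow> f y = g y" "f differentiable at x"
  shows "g differentiable at x"
  using assms has_derivative_transform_within_open unfolding differentiable_def by metis

lemma dd_const [simp]: "dd v (\<lambda>x. c) x = 0"
  by (rule dd_eq) simp

lemma dd_add:
  "\<lbrakk>f differentiable at x; g differentiable at x\<rbrakk> \<Longrightarrow> dd v (\<lambda>x. f x + g x) x = dd v f x + dd v g x"
  by (rule dd_eq) (intro has_derivative_add has_derivative_dd)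

lemma dd_diff:
  "\<lbrakk>f differentiable at x; g differentiable at x\<rbrakk> \<Longrightarrow> dd v (\<lambda>x. f x - g x) x = dd v f x - dd v g x"
  by (rule dd_eq) (intro has_derivative_diff has_derivative_dd)

lemma dd_mult:
  fixes f g :: "'a::real_normed_vector \<Rightarrow> 'b::real_normed_algebra"
  shows "\<lbrakk>f differentiable at x; g differentiable at x\<rbrakk>
    \<Longrightarrow> dd v (\<lambda>x. f x * g x) x = dd v f x * g x + f x * dd v g x"
  by (subst dd_eq[OF has_derivative_mult[OF has_derivative_dd has_derivative_dd]]) auto

lemma dd_scaleR_left: "f differentiable at x \<Longrightarrow> dd v (\<lambda>x. c *\<^sub>R f x) x = c *\<^sub>R dd v f x"
  by (rule dd_eq) (intro has_derivative_scaleR_right has_derivative_dd)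

lemma dd_zero_outside:
  assumes "closed K" "\<And>y. y \<notin> K \<Longrightarrow> f y = 0" "x \<notin> K"
  shows "dd v f x = 0"
proof -
  have "dd v f x = dd v (\<lambda>_. 0) x"
    by (rule dd_cong[of "- K"]) (use assms in auto)
  then show ?thesis by simp
qed

lemma dd_basis_sum:
  fixes f :: "'a::euclidean_space \<Rightarrow> 'b::real_normed_vector"
  assumes "f differentiable at x"
  shows "dd v f x = (\<Sum>b\<in>Basis. (v \<bullet> b) *\<^sub>R dd b f x)"
proof -
  have l: "linear (\<lambda>v. dd v f x)"
    using has_derivative_dd[OF assms] has_derivative_linear by blast
  have "dd v f x = dd (\<Sum>b\<in>Basis. (v \<bullet> b) *\<^sub>R b) f x" by (simp add: euclidean_representation)
  also have "\<dots> = (\<Sum>b\<in>Basis. (v \<bullet> b) *\<^sub>R dd b f x)"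
    using linear_sum[OF l, of "\<lambda>b. (v \<bullet> b) *\<^sub>R b" Basis] linear_scale[OF l] by simp
  finally show ?thesis .
qed

text \<open>A finite order and derivatives in all directions, in place of lists of basis vectors:
  closure properties become inductions on the order with the function left free.\<close>

primrec Cn :: "nat \<Rightarrow> 'a set \<Rightarrow> ('a::real_normed_vector \<Rightarrow> 'b::real_normed_vector) \<Rightarrow> bool" where
  "Cn 0 S f = True"
| "Cn (Suc n) S f = ((\<forall>x\<in>S. f differentiable at x) \<and> (\<forall>v. Cn n S (dd v f)))"

lemma Cn_cong:
  assumes "open S" "\<And>x. x \<in> S \<Longrightarrow> f x = g x" "Cn n S f"
  shows "Cn n S g"
  using assms(2,3)
proof (induction n arbitrary: f g)
  case (Suc n)
  have "Cn n S (dd v g)" for v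
  proof (rule Suc.IH[of "dd v f"])
    show "dd v f x = dd v g x" if "x \<in> S" for x by (rule dd_cong[OF assms(1) that Suc.prems(1)])
  qed (use Suc.prems in auto)
  moreover have "\<forall>x\<in>S. g differentiable at x"
    using differentiable_cong_open[OF assms(1)] Suc.prems by (metis Cn.simps(2))
  ultimately show ?case by simp
qed simp

lemma Cn_mono: "Cn n S f \<Longrightarrow> m \<le> n \<Longrightarrow> Cn m S f"
proof (induction n arbitrary: m f)
  case (Suc n)
  then show ?case by (cases m) auto
qed simp

lemma Cn_const: "Cn n S (\<lambda>x. c)"
proof (induction n arbitrary: c)
  case (Suc n)
  have "dd v (\<lambda>x::'a. c) = (\<lambda>x. 0)" for v by (simp add: fun_eq_iff)
  then show ?case using Suc by simp
qed simp

lemma Cn_add: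
  assumes "open S" shows "Cn n S f \<Longrightarrow> Cn n S g \<Longrightarrow> Cn n S (\<lambda>x. f x + g x)"
proof (induction n arbitrary: f g)
  case (Suc n)
  have "Cn n S (dd v (\<lambda>x. f x + g x))" for v
    by (rule Cn_cong[OF assms, where f="\<lambda>x. dd v f x + dd v g x"])
      (use Suc in \<open>auto simp: dd_add\<close>)
  then show ?case using Suc.prems by auto
qed simp

lemma Cn_mult:
  fixes f g :: "'a::real_normed_vector \<Rightarrow> 'b::real_normed_algebra"
  assumes "open S" shows "Cn n S f \<Longrightarrow> Cn n S g \<Longrightarrow> Cn n S (\<lambda>x. f x * g x)"
proof (induction n arbitrary: f g)
  case (Suc n)
  have fg: "Cn n S f" "Cn n S g" using Cn_mono[OF Suc.prems(1), of n] Cn_mono[OF Suc.prems(2), of n] by auto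
  have "Cn n S (dd v (\<lambda>x. f x * g x))" for v
    by (rule Cn_cong[OF assms, where f="\<lambda>x. dd v f x * g x + f x * dd v g x"])
      (use Suc fg in \<open>auto simp: dd_mult intro!: Cn_add assms\<close>)
  then show ?case using Suc.prems by auto
qed simp

lemma Cn_scaleR:
  assumes "open S" shows "Cn n S f \<Longrightarrow> Cn n S (\<lambda>x. c *\<^sub>R f x)"
proof (induction n arbitrary: f)
  case (Suc n)
  have "Cn n S (dd v (\<lambda>x. c *\<^sub>R f x))" for v
    by (rule Cn_cong[OF assms, where f="\<lambda>x. c *\<^sub>R dd v f x"])
      (use Suc in \<open>auto simp: dd_scaleR_left\<close>)
  then show ?case using Suc.prems by auto
qed simp

lemma Cn_sum:
  assumes "open S" shows "(\<And>i. i \<in> I \<Longrightarrow> Cn n S (f i)) \<Longrightarrow> Cn n S (\<lambda>x. \<Sum>i\<in>I. f i x)"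
  by (induction I rule: infinite_finite_induct) (auto intro: Cn_const Cn_add[OF assms])

lemma Cn_of_real:
  fixes f :: "'a::real_normed_vector \<Rightarrow> real"
  assumes "open S"
  shows "Cn n S f \<Longrightarrow> Cn n S (\<lambda>x. of_real (f x) :: 'b::real_normed_algebra_1)"
proof (induction n arbitrary: f)
  case (Suc n)
  have d: "((\<lambda>x. of_real (f x) :: 'b) has_derivative (\<lambda>v. of_real (dd v f x))) (at x)" if "x \<in> S" for x
    using Suc.prems that by (auto intro!: has_derivative_of_real has_derivative_dd)
  have "Cn n S (dd v (\<lambda>x. of_real (f x) :: 'b))" for v
    by (rule Cn_cong[OF assms, where f="\<lambda>x. of_real (dd v f x)"])
      (use Suc d in \<open>auto simp: dd_eq[OF d]\<close>)
  then show ?case using Suc.prems d by (auto simp: differentiable_def)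
qed simp

section \<open>Equivalence with smoothness through iterated partial derivatives\<close>

lemma partials_append: "partials (us @ vs) f = partials us (partials vs f)"
  by (induction us) auto

lemma smooth_on_dd_Basis:
  assumes "smooth_on S f" "b \<in> Basis" shows "smooth_on S (dd b f)"
proof -
  have e: "dd b f = partials [b] f" by (simp add: dd_def fun_eq_iff)
  have "set (vs @ [b]) \<subseteq> Basis" if "set vs \<subseteq> Basis" for vs using that assms(2) by auto
  then show ?thesis
    using assms(1) unfolding e smooth_on_def by (metis partials_append)
qed

text \<open>A derivative in an arbitrary direction is a combination, with constant coefficients, of
  those in basis directions, and these are again smooth.\<close>

lemma smooth_on_imp_Cn:
  fixes f :: "'a::euclidean_space \<Rightarrow> 'b::real_normed_vector"
  assumes "open S" shows "smooth_on S f \<Longrightarrow> Cn n S f"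
proof (induction n arbitrary: f)
  case (Suc n)
  have d: "f differentiable at x" if "x \<in> S" for x
    using Suc.prems that unfolding smooth_on_def by (metis empty_subsetI list.set(1) partials.simps(1))
  have "Cn n S (dd v f)" for v
  proof (rule Cn_cong[OF assms, where f="\<lambda>x. \<Sum>b\<in>Basis. (v \<bullet> b) *\<^sub>R dd b f x"])
    show "Cn n S (\<lambda>x. \<Sum>b\<in>Basis. (v \<bullet> b) *\<^sub>R dd b f x)"
      by (intro Cn_sum Cn_scaleR assms Suc.IH smooth_on_dd_Basis Suc.prems)
  qed (simp add: dd_basis_sum d)
  then show ?case using d by simp
qed simp

lemma Cn_imp_smooth_on:
  fixes f :: "'a::euclidean_space \<Rightarrow> 'b::real_normed_vector"
  assumes "\<And>n. Cn n S f" shows "smooth_on S f"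
proof -
  have "Cn n S (partials vs f)" for n vs
  proof (induction vs arbitrary: n)
    case (Cons v vs)
    have "Cn (Suc n) S (partials vs f)" by (rule Cons)
    then show ?case by (simp add: dd_def[abs_def])
  qed (simp add: assms)
  then have "Cn (Suc 0) S (partials vs f)" for vs by blast
  then show ?thesis unfolding smooth_on_def by simp
qed

lemma smooth_on_iff_Cn: "open S \<Longrightarrow> smooth_on S f \<longleftrightarrow> (\<forall>n. Cn n S f)"
  using smooth_on_imp_Cn Cn_imp_smooth_on by blast

lemma smooth_on_differentiable: "open S \<Longrightarrow> smooth_on S f \<Longrightarrow> x \<in> S \<Longrightarrow> f differentiable at x"
  using smooth_on_imp_Cn[of S f "Suc 0"] by simp

lemma smooth_on_dd: "open S \<Longrightarrow> smooth_on S f \<Longrightarrow> smooth_on S (dd v f)"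
  unfolding smooth_on_iff_Cn using Cn.simps(2)[of _ S f] by blast

lemma smooth_on_cong: "open S \<Longrightarrow> smooth_on S f \<Longrightarrow> (\<And>x. x \<in> S \<Longrightarrow> f x = g x) \<Longrightarrow> smooth_on S g"
  unfolding smooth_on_iff_Cn using Cn_cong by blast

lemma smooth_on_const: "open S \<Longrightarrow> smooth_on S (\<lambda>x. c)"
  by (simp add: smooth_on_iff_Cn Cn_const)

lemma smooth_on_add: "open S \<Longrightarrow> smooth_on S f \<Longrightarrow> smooth_on S g \<Longrightarrow> smooth_on S (\<lambda>x. f x + g x)"
  by (simp add: smooth_on_iff_Cn Cn_add)

lemma smooth_on_mult:
  fixes f g :: "'a::euclidean_space \<Rightarrow> 'b::real_normed_algebra"
  shows "open S \<Longrightarrow> smooth_on S f \<Longrightarrow> smooth_on S g \<Longrightarrow> smooth_on S (\<lambda>x. f x * g x)"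
  by (simp add: smooth_on_iff_Cn Cn_mult)

lemma smooth_on_cmult:
  fixes f :: "'a::euclidean_space \<Rightarrow> 'b::real_normed_algebra"
  shows "open S \<Longrightarrow> smooth_on S f \<Longrightarrow> smooth_on S (\<lambda>x. c * f x)"
  by (intro smooth_on_mult smooth_on_const)

lemma smooth_on_minus_const:
  fixes f :: "'a::euclidean_space \<Rightarrow> real"
  assumes "open S" "smooth_on S f" shows "smooth_on S (\<lambda>x. c - f x)"
proof -
  have "smooth_on S (\<lambda>x. c + (-1) * f x)" by (intro smooth_on_add smooth_on_const smooth_on_cmult assms)
  then show ?thesis by simp
qed

lemma smooth_on_of_real:
  fixes f :: "'a::euclidean_space \<Rightarrow> real"
  shows "open S \<Longrightarrow> smooth_on S f \<Longrightarrow> smooth_on S (\<lambda>x. of_real (f x) :: 'b::real_normed_algebra_1)"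
  by (simp add: smooth_on_iff_Cn Cn_of_real)

lemma smooth_on_subset: "smooth_on S f \<Longrightarrow> T \<subseteq> S \<Longrightarrow> smooth_on T f"
  unfolding smooth_on_def by blast

lemma smooth_on_Un: "smooth_on S f \<Longrightarrow> smooth_on T f \<Longrightarrow> smooth_on (S \<union> T) f"
  unfolding smooth_on_def by blast

text \<open>\<open>U\<close> and the complement of \<open>K\<close> are open and cover the space,
  and smoothness is a pointwise matter. This turns local data near a boundary point, once multiplied
  by a cutoff, into global functions.\<close>

lemma smooth_on_extend:
  assumes "open U" "smooth_on U f" "closed K" "K \<subseteq> U" "\<And>x. x \<notin> K \<Longrightarrow> f x = 0"
  shows "smooth_on UNIV f"
proof -
  have "smooth_on (- K) f"
    by (rule smooth_on_cong[where f="\<lambda>x. 0"]) (use assms in \<open>auto intro: smooth_on_const\<close>)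
  then have "smooth_on (U \<union> - K) f" by (intro smooth_on_Un assms)
  moreover have "U \<union> - K = UNIV" using assms(4) by blast
  ultimately show ?thesis by simp
qed

lemma smooth_on_inner: "smooth_on UNIV (\<lambda>x::'a::euclidean_space. x \<bullet> v)"
proof -
  have d: "((\<lambda>x::'a. x \<bullet> v) has_derivative (\<lambda>h. h \<bullet> v)) (at x)" for x
    by (intro derivative_eq_intros) auto
  have "Cn n UNIV (\<lambda>x::'a. x \<bullet> v)" for n
  proof (cases n)
    case (Suc m)
    have "dd u (\<lambda>x::'a. x \<bullet> v) = (\<lambda>x. u \<bullet> v)" for u by (simp add: dd_eq[OF d] fun_eq_iff)
    then show ?thesis using Suc d by (auto simp: Cn_const differentiable_def)
  qed simp
  then show ?thesis by (simp add: smooth_on_iff_Cn)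
qed

lemma smooth_on_inner_self: "smooth_on UNIV (\<lambda>x::'a::euclidean_space. (x - p) \<bullet> (x - p))"
proof -
  have "(\<lambda>x. (x - p) \<bullet> (x - p)) = (\<lambda>x. \<Sum>b\<in>Basis. (x \<bullet> b - p \<bullet> b) * (x \<bullet> b - p \<bullet> b))"
    by (subst euclidean_inner) (simp add: inner_diff_left)
  moreover have "smooth_on UNIV (\<lambda>x. (x \<bullet> b - p \<bullet> b) * (x \<bullet> b - p \<bullet> b))" for b :: 'a
  proof -
    have "smooth_on UNIV (\<lambda>x. x \<bullet> b + (- (p \<bullet> b)))"
      by (intro smooth_on_add smooth_on_inner smooth_on_const) auto
    then show ?thesis by (intro smooth_on_mult) auto
  qed
  ultimately show ?thesis
    by (simp add: smooth_on_iff_Cn Cn_sum)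
qed

text \<open>The derivative of 1/f is -(1/f)^2 times that of f, so order n of 1/f gives its order n +
  1.\<close>

lemma smooth_on_inverse:
  fixes f :: "'a::euclidean_space \<Rightarrow> real"
  assumes "open S" "smooth_on S f" "\<And>x. x \<in> S \<Longrightarrow> f x \<noteq> 0" shows "smooth_on S (\<lambda>x. inverse (f x))"
proof -
  have d: "((\<lambda>x. inverse (f x)) has_derivative (\<lambda>v. inverse (f x) * inverse (f x) * ((-1) * dd v f x))) (at x)" if "x \<in> S" for x
    using has_derivative_dd[OF smooth_on_differentiable[OF assms(1,2) that]] assms(3)[OF that]
    by (auto intro!: derivative_eq_intros)
  have "Cn n S (\<lambda>x. inverse (f x))" for n
  proof (induction n)
    case (Suc n)
    have "Cn n S (\<lambda>x. inverse (f x) * inverse (f x) * ((-1) * dd v f x))" for v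
      by (intro Cn_mult Cn_const assms(1) Suc smooth_on_imp_Cn smooth_on_dd assms(2))
    from Cn_cong[OF assms(1) _ this] have "Cn n S (dd v (\<lambda>x. inverse (f x)))" for v
      by (metis (no_types, lifting) dd_eq[OF d])
    then show ?case using d by (auto simp: differentiable_def)
  qed simp
  then show ?thesis using assms by (simp add: smooth_on_iff_Cn)
qed

section \<open>Smooth steps and cutoff functions\<close>

definition flat :: "nat \<Rightarrow> real \<Rightarrow> real" where
  "flat i x = (if x \<le> 0 then 0 else (1 / x) ^ i * exp (- (1 / x)))"

text \<open>The powers of 1/x are included so that the family is closed under differentiation;
  smoothness of exp (-1/x) is then an induction over all i at once.\<close>

lemma flat_deriv: "(flat i has_real_derivative (flat (i + 2) x - real i * flat (i + 1) x)) (at x)"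
proof -
  consider "x < 0" | "x > 0" | "x = 0" by linarith
  then show ?thesis
  proof cases
    case 1
    have "((\<lambda>x. 0) has_real_derivative 0) (at x)" by simp
    then have "(flat i has_real_derivative 0) (at x)"
      by (rule DERIV_cong_ev[THEN iffD1, rotated 3, of _ _ x])
        (use 1 in \<open>auto simp: flat_def eventually_nhds intro!: exI[of _ "{..<0}"]\<close>)
    then show ?thesis using 1 by (simp add: flat_def)
  next
    case 2
    have "((\<lambda>x. (1 / x) ^ i * exp (- (1 / x))) has_real_derivative
      ((1/x)^(i+2) * exp (-(1/x)) - real i * ((1/x)^(i+1) * exp (-(1/x))))) (at x)"
    proof (cases i)
      case 0
      then show ?thesis using 2 by (auto intro!: derivative_eq_intros simp: power2_eq_square)
    next
      case (Suc m)
      show ?thesis unfolding Suc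
        using 2 by (auto intro!: derivative_eq_intros) (cases m; simp add: field_simps power2_eq_square)
    qed
    then have "(flat i has_real_derivative ((1/x)^(i+2) * exp (-(1/x)) - real i * ((1/x)^(i+1) * exp (-(1/x))))) (at x)"
      by (rule DERIV_cong_ev[THEN iffD1, rotated 3, of _ _ x])
        (use 2 in \<open>auto simp: flat_def eventually_nhds intro!: exI[of _ "{0<..}"]\<close>)
    then show ?thesis using 2 by (simp add: flat_def)
  next
    case 3
    have "((\<lambda>y. (flat i y - flat i 0) / (y - 0)) \<longlongrightarrow> 0) (at 0)"
    proof (rule filterlim_split_at)
      show "((\<lambda>y. (flat i y - flat i 0) / (y - 0)) \<longlongrightarrow> 0) (at_left 0)"
        by (rule tendsto_eventually) (simp add: flat_def eventually_at_filter)
      \<comment> \<open>With t = 1/y the right difference quotient at 0 becomes t^(i+1) exp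
        (-t).\<close>
      have "((\<lambda>t. t ^ (i + 1) / exp t) \<longlongrightarrow> 0) (at_top :: real filter)" by (rule tendsto_power_div_exp_0)
      then have "((\<lambda>y::real. (inverse y) ^ (i + 1) / exp (inverse y)) \<longlongrightarrow> 0) (at_right 0)"
        by (rule filterlim_compose[OF _ filterlim_inverse_at_top_right])
      then show "((\<lambda>y. (flat i y - flat i 0) / (y - 0)) \<longlongrightarrow> 0) (at_right 0)"
      proof (rule Lim_transform_eventually)
        have "inverse y ^ (i + 1) / exp (inverse y) = (flat i y - flat i 0) / (y - 0)" if "y > 0" for y :: real
          using that by (simp add: flat_def exp_minus divide_inverse)
        then show "\<forall>\<^sub>F y in at_right 0. inverse y ^ (i + 1) / exp (inverse y) = (flat i y - flat i 0) / (y - 0)"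
          unfolding eventually_at_filter by simp
      qed
    qed
    then show ?thesis using 3 by (simp add: has_field_derivative_iff flat_def)
  qed
qed

lemma smooth_on_flat:
  fixes f :: "'a::euclidean_space \<Rightarrow> real"
  assumes "open S" "smooth_on S f" shows "smooth_on S (\<lambda>x. flat i (f x))"
proof -
  have d: "((\<lambda>x. flat i (f x)) has_derivative
    (\<lambda>v. (flat (i + 2) (f x) + (- real i) * flat (i + 1) (f x)) * dd v f x)) (at x)" if "x \<in> S" for x i
    using has_derivative_compose[OF has_derivative_dd[OF smooth_on_differentiable[OF assms that]]
        flat_deriv[of i, unfolded has_field_derivative_def]] by simp
  have "Cn n S (\<lambda>x. flat i (f x))" for n i
  proof (induction n arbitrary: i)
    case (Suc n)
    have "Cn n S (\<lambda>x. (flat (i + 2) (f x) + (- real i) * flat (i + 1) (f x)) * dd v f x)" for v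
      by (intro Cn_mult Cn_add Cn_const assms(1) Suc smooth_on_imp_Cn smooth_on_dd assms(2))
    from Cn_cong[OF assms(1) _ this] have "Cn n S (dd v (\<lambda>x. flat i (f x)))" for v
      by (metis (no_types, lifting) dd_eq[OF d])
    then show ?case using d by (auto simp: differentiable_def)
  qed simp
  then show ?thesis using assms by (simp add: smooth_on_iff_Cn)
qed

lemma flat_pos: "x > 0 \<Longrightarrow> flat i x > 0"
  by (simp add: flat_def)

lemma flat_nonneg: "flat i x \<ge> 0"
  by (simp add: flat_def)

text \<open>The denominator never vanishes, because x and 1 - x are not both nonpositive; for x
  \<ge> 1 its second summand is zero and the quotient is exactly 1.\<close>

definition step :: "real \<Rightarrow> real" where
  "step x = flat 0 x * inverse (flat 0 x + flat 0 (1 - x))"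

lemma step_denom_pos: "flat 0 x + flat 0 (1 - x) > 0"
  using flat_pos[of x 0] flat_pos[of "1 - x" 0] flat_nonneg[of 0 x] flat_nonneg[of 0 "1-x"]
  by (cases "x > 0") linarith+

lemma step_0: "x \<le> 0 \<Longrightarrow> step x = 0" by (simp add: step_def flat_def)

lemma step_1: "x \<ge> 1 \<Longrightarrow> step x = 1"
  using flat_pos[of x 0] by (simp add: step_def flat_def[of 0 "1 - x"])

lemma step_bounds: "0 \<le> step x" "step x \<le> 1"
  using step_denom_pos[of x] flat_nonneg[of 0 x] flat_nonneg[of 0 "1-x"]
  by (auto simp: step_def field_simps)

lemma smooth_on_step:
  fixes f :: "'a::euclidean_space \<Rightarrow> real"
  assumes "open S" "smooth_on S f" shows "smooth_on S (\<lambda>x. step (f x))"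
  unfolding step_def
  by (intro smooth_on_mult smooth_on_inverse smooth_on_add smooth_on_flat smooth_on_minus_const assms)
    (metis less_irrefl step_denom_pos)

text \<open>The squared distance is used because it is smooth at \<open>p\<close> too. The factor
  4/(3r^2) sends r^2 - (r/2)^2 to 1, so the function is 1 on the ball of half the radius and 0
  outside the full one.\<close>

definition plateau :: "'a::euclidean_space \<Rightarrow> real \<Rightarrow> 'a \<Rightarrow> real" where
  "plateau p r x = step (4 / (3 * r\<^sup>2) * (r\<^sup>2 - (x - p) \<bullet> (x - p)))"

lemma smooth_on_plateau: "smooth_on UNIV (plateau p r)"
  unfolding plateau_def
  by (intro smooth_on_step smooth_on_cmult smooth_on_minus_const smooth_on_inner_self open_UNIV)

lemma plateau_1: assumes "r > 0" "dist p x \<le> r / 2" shows "plateau p r x = 1"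
proof -
  have "norm (x - p) \<le> r / 2" using assms by (simp add: dist_norm norm_minus_commute)
  then have "(norm (x - p))\<^sup>2 \<le> (r/2)\<^sup>2" by (intro power_mono) auto
  then have "r\<^sup>2 - (x - p) \<bullet> (x - p) \<ge> 3 * r\<^sup>2 / 4"
    by (simp add: dot_square_norm power_divide)
  then have "4 / (3 * r\<^sup>2) * (r\<^sup>2 - (x - p) \<bullet> (x - p)) \<ge> 1" using assms by (simp add: field_simps)
  then show ?thesis unfolding plateau_def by (rule step_1)
qed

lemma plateau_0: assumes "r > 0" "dist p x \<ge> r" shows "plateau p r x = 0"
proof -
  have "norm (x - p) \<ge> r" using assms by (simp add: dist_norm norm_minus_commute)
  then have "(norm (x - p))\<^sup>2 \<ge> r\<^sup>2" using assms by (intro power_mono) auto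
  then have "4 / (3 * r\<^sup>2) * (r\<^sup>2 - (x - p) \<bullet> (x - p)) \<le> 0"
    using assms by (intro mult_nonneg_nonpos) (auto simp: dot_square_norm)
  then show ?thesis unfolding plateau_def by (rule step_0)
qed

lemma plateau_bounds: "0 \<le> plateau p r x" "plateau p r x \<le> 1"
  by (simp_all add: plateau_def step_bounds)

section \<open>Smooth functions with bounded support\<close>

lemma smooth_on_continuous: "smooth_on UNIV f \<Longrightarrow> continuous_on UNIV f"
  by (intro continuous_at_imp_continuous_on ballI differentiable_imp_continuous_within)
    (auto intro: smooth_on_differentiable)

lemma smooth_on_partials: "smooth_on UNIV f \<Longrightarrow> set vs \<subseteq> Basis \<Longrightarrow> smooth_on UNIV (partials vs f)"
  unfolding smooth_on_def by (metis Un_subset_iff partials_append set_append)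

lemma partials_zero_outside:
  assumes "closed K" "\<And>y. y \<notin> K \<Longrightarrow> f y = 0"
  shows "x \<notin> K \<Longrightarrow> partials vs f x = 0"
proof (induction vs arbitrary: x)
  case (Cons v vs)
  then show ?case using dd_zero_outside[OF assms(1), of "partials vs f"] by (simp add: dd_def)
qed (use assms in auto)

lemma compact_supp_bounded:
  fixes f :: "'a::euclidean_space \<Rightarrow> 'b::real_normed_vector"
  assumes "continuous_on UNIV f" "\<And>y. norm y > R \<Longrightarrow> f y = 0"
  shows "\<exists>C\<ge>0. \<forall>x. norm (f x) \<le> C"
proof -
  have "compact (f ` cball 0 R)"
    by (intro compact_continuous_image continuous_on_subset[OF assms(1)]) auto
  then obtain C where C: "\<And>x. x \<in> cball 0 R \<Longrightarrow> norm (f x) \<le> C"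
    using compact_imp_bounded bounded_iff by (metis image_eqI)
  have "norm (f x) \<le> max C 0" for x
    using C[of x] assms(2)[of x] by (cases "norm x \<le> R") (auto simp: not_le)
  then show ?thesis by (intro exI[of _ "max C 0"]) auto
qed

lemma schwartz_compact_supp:
  fixes f :: "'a::euclidean_space \<Rightarrow> complex"
  assumes "smooth_on UNIV f" "\<And>y. norm y > R \<Longrightarrow> f y = 0"
  shows "f \<in> schwartz"
  unfolding schwartz_def
proof (intro CollectI conjI allI impI)
  fix N and vs :: "'a list" assume vs: "set vs \<subseteq> Basis"
  have "continuous_on UNIV (partials vs f)"
    by (intro smooth_on_continuous smooth_on_partials assms vs)
  then have "continuous_on UNIV (\<lambda>x. of_real ((1 + norm x) ^ N) * partials vs f x)"
    by (intro continuous_intros)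
  moreover have "of_real ((1 + norm x) ^ N) * partials vs f x = 0" if "norm x > R" for x
    using partials_zero_outside[of "cball 0 R" f x vs] assms that by auto
  ultimately obtain C where "\<And>x. norm (of_real ((1 + norm x) ^ N) * partials vs f x) \<le> C"
    using compact_supp_bounded[of "\<lambda>x. of_real ((1 + norm x) ^ N) * partials vs f x" R] by auto
  then have "(1 + norm x) ^ N * norm (partials vs f x) \<le> C" for x
    unfolding norm_mult norm_of_real by (metis abs_of_nonneg add_nonneg_nonneg norm_ge_zero zero_le_one zero_le_power)
  then show "\<exists>C. \<forall>x. (1 + norm x) ^ N * norm (partials vs f x) \<le> C" by blast
qed (rule assms)

section \<open>Integration on Euclidean space\<close>

lemma lborel_integral_affine:
  fixes f :: "'a::euclidean_space \<Rightarrow> 'b::{banach,second_countable_topology}"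
  assumes c: "c \<noteq> 0" and [measurable]: "f \<in> borel_measurable borel"
  shows "(LINT x|lborel. f x) = \<bar>c\<bar> ^ DIM('a) *\<^sub>R (LINT x|lborel. f (t + c *\<^sub>R x))"
  by (subst lborel_affine[OF c, of t], subst integral_density)
    (simp_all add: integral_distr)

lemma nn_integral_lborel_affine:
  fixes f :: "'a::euclidean_space \<Rightarrow> ennreal"
  assumes c: "c \<noteq> 0" and [measurable]: "f \<in> borel_measurable borel"
  shows "(\<integral>\<^sup>+x. f x \<partial>lborel) = \<bar>c\<bar> ^ DIM('a) * (\<integral>\<^sup>+x. f (t + c *\<^sub>R x) \<partial>lborel)"
  by (subst lborel_affine[OF c, of t], subst nn_integral_density)
    (simp_all add: nn_integral_distr nn_integral_cmult ennreal_power)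

lemma lborel_integrable_affine:
  fixes f :: "'a::euclidean_space \<Rightarrow> 'b::{banach,second_countable_topology}"
  assumes c: "c \<noteq> 0" and f: "integrable lborel f"
  shows "integrable lborel (\<lambda>x. f (t + c *\<^sub>R x))"
proof -
  have [measurable]: "f \<in> borel_measurable borel" using f by auto
  have "(\<integral>\<^sup>+x. norm (f x) \<partial>lborel) < \<infinity>" using f by (simp add: integrable_iff_bounded)
  then have "(\<integral>\<^sup>+x. norm (f (t + c *\<^sub>R x)) \<partial>lborel) < \<infinity>"
    using nn_integral_lborel_affine[OF c, of "\<lambda>x. norm (f x)" t] c
    by (auto simp: ennreal_mult_less_top)
  then show ?thesis by (simp add: integrable_iff_bounded)
qed

lemma lborel_integral_shift:
  fixes f :: "'a::euclidean_space \<Rightarrow> 'b::{banach,second_countable_topology}"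
  assumes "f \<in> borel_measurable borel"
  shows "(LINT x|lborel. f (x + t)) = (LINT x|lborel. f x)"
    "(LINT x|lborel. f (x - t)) = (LINT x|lborel. f x)"
    "(LINT x|lborel. f (t - x)) = (LINT x|lborel. f x)"
  using lborel_integral_affine[of 1 f t] lborel_integral_affine[of 1 f "-t"]
    lborel_integral_affine[of "-1" f t] assms by (simp_all add: add.commute)

lemma lborel_integrable_shift:
  fixes f :: "'a::euclidean_space \<Rightarrow> 'b::{banach,second_countable_topology}"
  assumes "integrable lborel f"
  shows "integrable lborel (\<lambda>x. f (x + t))" "integrable lborel (\<lambda>x. f (x - t))"
    "integrable lborel (\<lambda>x. f (t - x))"
  using lborel_integrable_affine[of 1 f t] lborel_integrable_affine[of 1 f "-t"]
    lborel_integrable_affine[of "-1" f t] assms by (simp_all add: add.commute)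

text \<open>The working class of amplitudes: it lies in L^1 and L^2 and is stable under sums,
  products, affine substitutions, indicators and mollification. Borel instead of Lebesgue
  measurability keeps compositions and Fubini unproblematic.\<close>

definition bbs :: "('a::euclidean_space \<Rightarrow> real) \<Rightarrow> bool" where
  "bbs f \<longleftrightarrow> f \<in> borel_measurable borel \<and> (\<exists>C. \<forall>x. \<bar>f x\<bar> \<le> C) \<and> (\<exists>R. \<forall>x. norm x > R \<longrightarrow> f x = 0)"

lemma bbs_measurable: "bbs f \<Longrightarrow> f \<in> borel_measurable borel"
  by (simp add: bbs_def)

lemma bbsI:
  assumes "f \<in> borel_measurable borel" "\<And>x. \<bar>f x\<bar> \<le> C" "\<And>x. norm x > R \<Longrightarrow> f x = 0"
  shows "bbs f"
  using assms unfolding bbs_def by blast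

lemma bbsD:
  assumes "bbs f"
  shows "\<exists>C R. C \<ge> 0 \<and> R > 0 \<and> (\<forall>x. \<bar>f x\<bar> \<le> C) \<and> (\<forall>x. norm x > R \<longrightarrow> f x = 0)"
proof -
  obtain C R where C: "\<forall>x. \<bar>f x\<bar> \<le> C" and R: "\<forall>x. norm x > R \<longrightarrow> f x = 0"
    using assms unfolding bbs_def by blast
  have "C \<ge> 0" using C[rule_format, of 0] by linarith
  then show ?thesis using C R by (intro exI[of _ C] exI[of _ "max R 1"]) auto
qed

lemma integrable_indicator_cball: "integrable lborel (\<lambda>x. c * indicator (cball a R) x :: real)"
  by (intro integrable_mult_right integrable_real_indicator emeasure_bounded_finite) auto

lemma integrable_bounded_support:
  fixes f :: "'a::euclidean_space \<Rightarrow> 'b::{banach,second_countable_topology}"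
  assumes "f \<in> borel_measurable borel" "\<And>x. norm (f x) \<le> C" "\<And>x. norm x > R \<Longrightarrow> f x = 0"
  shows "integrable lborel f"
proof (rule Bochner_Integration.integrable_bound)
  show "integrable lborel (\<lambda>x. C * indicator (cball 0 R :: 'a set) x :: real)"
    by (rule integrable_indicator_cball)
  show "AE x in lborel. norm (f x) \<le> norm (C * indicator (cball 0 R) x :: real)"
  proof (intro AE_I2)
    fix x
    show "norm (f x) \<le> norm (C * indicator (cball 0 R) x :: real)"
      using assms(2)[of x] assms(3)[of x] order_trans[OF norm_ge_zero assms(2)[of x]]
      by (cases "norm x > R") (auto simp: indicator_def)
  qed
qed (use assms(1) in simp)

lemma bbs_integrable: assumes f: "bbs f" shows "integrable lborel f"
proof -
  obtain C R where "C \<ge> 0 \<and> R > 0 \<and> (\<forall>x. \<bar>f x\<bar> \<le> C) \<and> (\<forall>x. norm x > R \<longrightarrow> f x = 0)"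
    using bbsD[OF f] by blast
  then have CE: "C \<ge> 0" "R > 0" "\<And>x. \<bar>f x\<bar> \<le> C" "\<And>x. norm x > R \<Longrightarrow> f x = 0" by auto
  note C = CE(3)  CE(4)
  show ?thesis by (rule integrable_bounded_support[of f C R]) (use C bbs_measurable[OF f] in auto)
qed

lemma bbs_mult_bounded:
  assumes f: "bbs f" and g: "g \<in> borel_measurable borel" "\<And>x. \<bar>g x\<bar> \<le> D"
  shows "bbs (\<lambda>x. g x * f x)"
proof -
  obtain C R where "C \<ge> 0 \<and> R > 0 \<and> (\<forall>x. \<bar>f x\<bar> \<le> C) \<and> (\<forall>x. norm x > R \<longrightarrow> f x = 0)"
    using bbsD[OF f] by blast
  then have CE: "C \<ge> 0" "R > 0" "\<And>x. \<bar>f x\<bar> \<le> C" "\<And>x. norm x > R \<Longrightarrow> f x = 0" by auto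
  note C = CE(1)  CE(3)  CE(4)
  have "\<bar>g x * f x\<bar> \<le> D * C" for x
    unfolding abs_mult using g(2)[of x] C(2)[of x] by (intro mult_mono) auto
  then show ?thesis using C(3) g(1) bbs_measurable[OF f] unfolding bbs_def by (auto intro!: borel_measurable_times)
qed

lemma bbs_mult: "bbs f \<Longrightarrow> bbs g \<Longrightarrow> bbs (\<lambda>x. f x * g x)"
  using bbs_mult_bounded[of g f] by (auto simp: bbs_def)

lemma bbs_power2: "bbs f \<Longrightarrow> bbs (\<lambda>x. (f x)\<^sup>2)"
  using bbs_mult[of f f] by (simp add: power2_eq_square)

lemma bbs_add: assumes "bbs f" "bbs g" shows "bbs (\<lambda>x. f x + g x)"
proof -
  obtain C R where "C \<ge> 0 \<and> R > 0 \<and> (\<forall>x. \<bar>f x\<bar> \<le> C) \<and> (\<forall>x. norm x > R \<longrightarrow> f x = 0)"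
    using bbsD[OF assms(1)] by blast
  then have CE: "C \<ge> 0" "R > 0" "\<And>x. \<bar>f x\<bar> \<le> C" "\<And>x. norm x > R \<Longrightarrow> f x = 0" by auto
  note C = CE(3)  CE(4)
  obtain D T where "D \<ge> 0 \<and> T > 0 \<and> (\<forall>x. \<bar>g x\<bar> \<le> D) \<and> (\<forall>x. norm x > T \<longrightarrow> g x = 0)"
    using bbsD[OF assms(2)] by blast
  then have DE: "D \<ge> 0" "T > 0" "\<And>x. \<bar>g x\<bar> \<le> D" "\<And>x. norm x > T \<Longrightarrow> g x = 0" by auto
  note D = DE(3)  DE(4)
  have "\<bar>f x + g x\<bar> \<le> C + D" for x using C(1)[of x] D(1)[of x] by linarith
  moreover have "f x + g x = 0" if "norm x > max R T" for x using C(2)[of x] D(2)[of x] that by auto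
  ultimately show ?thesis using assms[THEN bbs_measurable] by (intro bbsI[of _ "C + D" "max R T"] borel_measurable_add) auto
qed

lemma bbs_cmult: "bbs f \<Longrightarrow> bbs (\<lambda>x. c * f x)"
  by (rule bbs_mult_bounded[of f "\<lambda>_. c" "\<bar>c\<bar>"]) auto

lemma bbs_diff: "bbs f \<Longrightarrow> bbs g \<Longrightarrow> bbs (\<lambda>x. f x - g x)"
  using bbs_add[of f "\<lambda>x. (-1) * g x"] bbs_cmult[of g "-1"] by simp

lemma bbs_sum: "(\<And>i. i \<in> I \<Longrightarrow> bbs (f i)) \<Longrightarrow> bbs (\<lambda>x. \<Sum>i\<in>I. f i x)"
proof (induction I rule: infinite_finite_induct)
  case (insert i I)
  then show ?case using bbs_add[of "f i"] by simp
qed (auto simp: bbs_def)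

lemma bbs_affine: assumes f: "bbs f" and c: "c \<noteq> 0" shows "bbs (\<lambda>x. f (t + c *\<^sub>R x))"
proof -
  obtain C R where "C \<ge> 0 \<and> R > 0 \<and> (\<forall>x. \<bar>f x\<bar> \<le> C) \<and> (\<forall>x. norm x > R \<longrightarrow> f x = 0)"
    using bbsD[OF f] by blast
  then have CE: "C \<ge> 0" "R > 0" "\<And>x. \<bar>f x\<bar> \<le> C" "\<And>x. norm x > R \<Longrightarrow> f x = 0" by auto
  note C = CE(3)  CE(4)
  have "f (t + c *\<^sub>R x) = 0" if "norm x > (R + norm t) / \<bar>c\<bar>" for x
  proof (rule C(2))
    have "R + norm t < norm (c *\<^sub>R x)" using that c by (simp add: field_simps)
    then show "norm (t + c *\<^sub>R x) > R" using norm_diff_ineq[of "c *\<^sub>R x" t] by (simp add: add.commute)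
  qed
  moreover have "(\<lambda>x. f (t + c *\<^sub>R x)) \<in> borel_measurable borel" using bbs_measurable[OF f] by measurable
  ultimately show ?thesis using C(1) unfolding bbs_def by blast
qed

lemma bbs_continuous:
  assumes "continuous_on UNIV f" "\<And>y. norm y > R \<Longrightarrow> f y = 0" shows "bbs f"
proof -
  obtain C where "\<And>x. \<bar>f x\<bar> \<le> C" using compact_supp_bounded[OF assms] by auto
  then show ?thesis using assms(2) borel_measurable_continuous_onI[OF assms(1)] unfolding bbs_def by blast
qed

text \<open>A measurable function is almost everywhere a limit of continuous ones; these are
  modified so that dominated convergence applies.\<close>

lemma bbs_approx_continuous:
  fixes f :: "'a::euclidean_space \<Rightarrow> real"
  assumes f: "bbs f" and e: "e > 0"
  shows "\<exists>g. continuous_on UNIV g \<and> bbs g \<and> (LINT x|lborel. \<bar>g x - f x\<bar>) < e"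
proof -
  obtain C R where "C \<ge> 0 \<and> R > 0 \<and> (\<forall>x. \<bar>f x\<bar> \<le> C) \<and> (\<forall>x. norm x > R \<longrightarrow> f x = 0)"
    using bbsD[OF f] by blast
  then have CE: "C \<ge> 0" "R > 0" "\<And>x. \<bar>f x\<bar> \<le> C" "\<And>x. norm x > R \<Longrightarrow> f x = 0" by auto
  note C = CE(1)  CE(2)  CE(3)  CE(4)
  have [measurable]: "f \<in> borel_measurable borel" by (rule bbs_measurable[OF f])
  have "f measurable_on UNIV"
    by (rule lebesgue_measurable_imp_measurable_on) (auto intro: measurable_completion)
  then obtain N g where N: "negligible N" and g: "\<And>n::nat. continuous_on UNIV (g n)"
      and lim: "\<And>x. x \<notin> N \<Longrightarrow> (\<lambda>n. g n x) \<longlonglongrightarrow> f x"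
    unfolding measurable_on_def by auto
  \<comment> \<open>Clipping at the bound of \<open>f\<close> and cutting off at twice its support
    radius does not change the limit, and it provides one integrable majorant for all n.\<close>
  define h where "h n x = max (- C) (min C (g n x)) * plateau 0 (2 * R) x" for n x
  have hc: "continuous_on UNIV (h n)" for n
    unfolding h_def by (intro continuous_intros g smooth_on_continuous smooth_on_plateau)
  have h0: "h n x = 0" if "norm x > 2 * R" for n x
    unfolding h_def using plateau_0[of "2 * R" 0 x] that C by simp
  have hb: "bbs (h n)" for n using bbs_continuous[OF hc h0] .
  have [measurable]: "h n \<in> borel_measurable borel" for n by (rule bbs_measurable[OF hb])
  have hC: "\<bar>h n x\<bar> \<le> C" for n x
  proof -
    have "\<bar>max (- C) (min C (g n x))\<bar> * \<bar>plateau 0 (2 * R) x\<bar> \<le> C * 1"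
      using C plateau_bounds[of 0 "2*R" x] by (intro mult_mono) auto
    then show ?thesis by (simp add: h_def abs_mult)
  qed
  have "(\<lambda>n. LINT x|lborel. \<bar>h n x - f x\<bar>) \<longlonglongrightarrow> (LINT x|lborel. (0::real) * indicator (cball 0 (2*R) :: 'a set) x)"
  proof (rule integral_dominated_convergence)
    show "integrable lborel (\<lambda>x. 2 * C * indicator (cball 0 (2*R) :: 'a set) x)"
      by (rule integrable_indicator_cball)
    show "AE x in lborel. norm \<bar>h n x - f x\<bar> \<le> 2 * C * indicator (cball 0 (2*R)) x" for n
    proof (intro AE_I2)
      fix x show "norm \<bar>h n x - f x\<bar> \<le> 2 * C * indicator (cball 0 (2*R)) x"
        using hC[of n x] C(3)[of x] h0[of x n] C(4)[of x] C(2) by (cases "norm x > 2 * R") auto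
    qed
    have "AE x in lebesgue. x \<notin> N"
      using N unfolding negligible_iff_null_sets by (rule AE_not_in)
    moreover have "(\<lambda>n. \<bar>h n x - f x\<bar>) \<longlonglongrightarrow> 0 * indicator (cball 0 (2*R)) x" if x: "x \<notin> N" for x
    proof -
      have "(\<lambda>n. \<bar>h n x - f x\<bar>) \<longlonglongrightarrow> \<bar>max (- C) (min C (f x)) * plateau 0 (2 * R) x - f x\<bar>"
        unfolding h_def by (intro tendsto_intros lim x)
      moreover have "max (- C) (min C (f x)) * plateau 0 (2 * R) x - f x = 0"
        using C(3)[of x] C(4)[of x] C(2) plateau_1[of "2*R" 0 x] by (cases "norm x > R") auto
      ultimately show ?thesis by simp
    qed
    ultimately have "AE x in lebesgue. (\<lambda>n. \<bar>h n x - f x\<bar>) \<longlonglongrightarrow> 0 * indicator (cball 0 (2*R)) x"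
      by auto
    then show "AE x in lborel. (\<lambda>n. \<bar>h n x - f x\<bar>) \<longlonglongrightarrow> 0 * indicator (cball 0 (2*R)) x"
      by (simp add: AE_completion_iff)
  qed auto
  then have "(\<lambda>n. LINT x|lborel. \<bar>h n x - f x\<bar>) \<longlonglongrightarrow> 0" by simp
  then have "\<forall>\<^sub>F n in sequentially. (LINT x|lborel. \<bar>h n x - f x\<bar>) < e" using e by (rule order_tendstoD(2))
  then obtain n where "(LINT x|lborel. \<bar>h n x - f x\<bar>) < e"
    unfolding eventually_sequentially by blast
  then show ?thesis using hc hb by blast
qed

lemma L1_translation_continuous_on:
  fixes g :: "'a::euclidean_space \<Rightarrow> real"
  assumes g: "continuous_on UNIV g" "bbs g" and h: "h \<longlonglongrightarrow> 0"
  shows "(\<lambda>n. LINT x|lborel. \<bar>g (x - h n) - g x\<bar>) \<longlonglongrightarrow> 0"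
proof -
  obtain C R where "C \<ge> 0 \<and> R > 0 \<and> (\<forall>x. \<bar>g x\<bar> \<le> C) \<and> (\<forall>x. norm x > R \<longrightarrow> g x = 0)"
    using bbsD[OF g(2)] by blast
  then have CE: "C \<ge> 0" "R > 0" "\<And>x. \<bar>g x\<bar> \<le> C" "\<And>x. norm x > R \<Longrightarrow> g x = 0" by auto
  note C = CE(1)  CE(2)  CE(3)  CE(4)
  have [measurable]: "g \<in> borel_measurable borel" by (rule bbs_measurable[OF g(2)])
  obtain B where B: "B > 0" "\<And>n. norm (h n) \<le> B"
    using h convergent_imp_Bseq[of h] unfolding convergent_def Bseq_def by blast
  have "(\<lambda>n. LINT x|lborel. \<bar>g (x - h n) - g x\<bar>) \<longlonglongrightarrow> (LINT x|lborel. (0::real) * indicator (cball 0 (R+B) :: 'a set) x)"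
  proof (rule integral_dominated_convergence)
    show "integrable lborel (\<lambda>x. 2 * C * indicator (cball 0 (R+B) :: 'a set) x)"
      by (rule integrable_indicator_cball)
    show "AE x in lborel. norm \<bar>g (x - h n) - g x\<bar> \<le> 2 * C * indicator (cball 0 (R+B)) x" for n
    proof (intro AE_I2)
      fix x :: 'a
      have "norm (x - h n) > R" if "norm x > R + B"
        using norm_triangle_ineq2[of x "h n"] B(2)[of n] that by linarith
      then show "norm \<bar>g (x - h n) - g x\<bar> \<le> 2 * C * indicator (cball 0 (R+B)) x"
        using C(3)[of x] C(3)[of "x - h n"] C(4)[of x] C(4)[of "x - h n"] B(1)
        by (cases "norm x > R + B") (auto simp: abs_le_iff)
    qed
    show "AE x in lborel. (\<lambda>n. \<bar>g (x - h n) - g x\<bar>) \<longlonglongrightarrow> 0 * indicator (cball 0 (R+B)) x"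
    proof (intro AE_I2)
      fix x
      have "(\<lambda>n. x - h n) \<longlonglongrightarrow> x - 0" by (intro tendsto_intros h)
      moreover have "isCont g x" using g(1) by (simp add: continuous_on_eq_continuous_at)
      ultimately have "(\<lambda>n. g (x - h n)) \<longlonglongrightarrow> g x" using isCont_tendsto_compose by fastforce
      then have "(\<lambda>n. \<bar>g (x - h n) - g x\<bar>) \<longlonglongrightarrow> \<bar>g x - g x\<bar>" by (intro tendsto_intros)
      then show "(\<lambda>n. \<bar>g (x - h n) - g x\<bar>) \<longlonglongrightarrow> 0 * indicator (cball 0 (R+B)) x" by simp
    qed
  qed auto
  then show ?thesis by simp
qed

lemma bbs_shift: "bbs f \<Longrightarrow> bbs (\<lambda>x. f (x - t))"
  using bbs_affine[of f 1 "-t"] by simp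

text \<open>Density of continuous functions; by translation invariance the approximation error is
  the same at both positions. It yields the continuity at 0 of the autocorrelation in
  \<open>plancherel\<close>.\<close>

lemma L1_translation_continuous:
  fixes f :: "'a::euclidean_space \<Rightarrow> real"
  assumes f: "bbs f" and h: "h \<longlonglongrightarrow> 0"
  shows "(\<lambda>n. LINT x|lborel. \<bar>f (x - h n) - f x\<bar>) \<longlonglongrightarrow> 0"
proof (rule LIMSEQ_I)
  fix e :: real assume e: "e > 0"
  obtain g where g: "continuous_on UNIV g" "bbs g" "(LINT x|lborel. \<bar>g x - f x\<bar>) < e / 3"
    using bbs_approx_continuous[OF f, of "e/3"] e by auto
  have [measurable]: "f \<in> borel_measurable borel" "g \<in> borel_measurable borel"
    using f g(2) by (auto simp: bbs_measurable)
  obtain N where N: "\<And>n. n \<ge> N \<Longrightarrow> (LINT x|lborel. \<bar>g (x - h n) - g x\<bar>) < e / 3"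
    using LIMSEQ_D[OF L1_translation_continuous_on[OF g(1,2) h], of "e/3"] e by auto
  have "(LINT x|lborel. \<bar>f (x - h n) - f x\<bar>) < e" if "n \<ge> N" for n
  proof -
    have i: "integrable lborel (\<lambda>x. \<bar>f (x - h n) - f x\<bar>)" "integrable lborel (\<lambda>x. \<bar>g (x - h n) - f (x - h n)\<bar>)"
      "integrable lborel (\<lambda>x. \<bar>g (x - h n) - g x\<bar>)" "integrable lborel (\<lambda>x. \<bar>g x - f x\<bar>)"
      by (intro integrable_abs bbs_integrable bbs_diff bbs_shift f g)+
    have "(LINT x|lborel. \<bar>f (x - h n) - f x\<bar>) \<le>
      (LINT x|lborel. (\<bar>g (x - h n) - f (x - h n)\<bar> + \<bar>g (x - h n) - g x\<bar>) + \<bar>g x - f x\<bar>)"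
      by (intro integral_mono Bochner_Integration.integrable_add i) linarith
    also have "\<dots> = ((LINT x|lborel. \<bar>g (x - h n) - f (x - h n)\<bar>) + (LINT x|lborel. \<bar>g (x - h n) - g x\<bar>)) + (LINT x|lborel. \<bar>g x - f x\<bar>)"
      by (subst Bochner_Integration.integral_add, intro Bochner_Integration.integrable_add i, rule i,
          subst Bochner_Integration.integral_add, rule i, rule i, rule refl)
    also have "(LINT x|lborel. \<bar>g (x - h n) - f (x - h n)\<bar>) = (LINT x|lborel. \<bar>g x - f x\<bar>)"
      by (rule lborel_integral_shift(2)[of "\<lambda>x. \<bar>g x - f x\<bar>"]) measurable
    finally show ?thesis using N[OF that] g(3) by linarith
  qed
  then show "\<exists>N. \<forall>n\<ge>N. norm ((LINT x|lborel. \<bar>f (x - h n) - f x\<bar>) - 0) < e"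
    by (intro exI[of _ N]) auto
qed

section \<open>Fourier transform and Plancherel's theorem\<close>

text \<open>A version of \<open>fourier\<close> for real functions, over \<open>lborel\<close>,
  where Fubini and affine substitutions are at hand; \<open>fourier_eq_ft\<close> relates the
  two.\<close>

definition ft :: "('a::euclidean_space \<Rightarrow> real) \<Rightarrow> 'a \<Rightarrow> complex" where
  "ft f \<xi> = (LINT x|lborel. cis (- (x \<bullet> \<xi>)) * complex_of_real (f x))"

lemma measurable_cis [measurable]: "cis \<in> borel_measurable borel"
  by (intro borel_measurable_continuous_onI continuous_intros)

lemma integrable_cis_mult:
  fixes f :: "'a::euclidean_space \<Rightarrow> complex"
  assumes "integrable lborel f" and [measurable]: "g \<in> borel_measurable borel"
  shows "integrable lborel (\<lambda>x. cis (g x) * f x)"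
proof -
  have [measurable]: "f \<in> borel_measurable borel" using assms by auto
  show ?thesis
    by (rule Bochner_Integration.integrable_bound[OF assms(1)]) (auto simp: norm_mult)
qed

lemma ft_integrable:
  "integrable lborel f \<Longrightarrow> integrable lborel (\<lambda>x. cis (- (x \<bullet> \<xi>)) * complex_of_real (f x))"
  by (rule integrable_cis_mult) auto

lemma ft_bound:
  assumes "integrable lborel f" shows "norm (ft f \<xi>) \<le> (LINT x|lborel. \<bar>f x\<bar>)"
  using integral_norm_bound[of lborel "\<lambda>x. cis (- (x \<bullet> \<xi>)) * complex_of_real (f x)"]
  by (simp add: ft_def norm_mult)

lemma continuous_on_ft:
  assumes f: "integrable lborel f" shows "continuous_on UNIV (ft f)"
proof -
  have [measurable]: "f \<in> borel_measurable borel" using f by auto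
  have "(\<lambda>n. ft f (u n)) \<longlonglongrightarrow> ft f \<xi>" if u: "u \<longlonglongrightarrow> \<xi>" for u \<xi>
    unfolding ft_def
  proof (rule integral_dominated_convergence[where w="\<lambda>x. \<bar>f x\<bar>"])
    show "AE x in lborel. (\<lambda>n. cis (- (x \<bullet> u n)) * complex_of_real (f x)) \<longlonglongrightarrow> cis (- (x \<bullet> \<xi>)) * complex_of_real (f x)"
      by (intro AE_I2 tendsto_mult tendsto_const tendsto_cis tendsto_minus tendsto_inner u)
  qed (use f in \<open>auto simp: norm_mult\<close>)
  then show ?thesis
    by (intro continuous_at_imp_continuous_on ballI) (auto simp: continuous_at_sequentially o_def)
qed

lemma ft_measurable: "integrable lborel f \<Longrightarrow> ft f \<in> borel_measurable borel"
  by (intro borel_measurable_continuous_onI continuous_on_ft)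

lemma ft_line_measurable:
  assumes "integrable lborel f" shows "(\<lambda>\<sigma>. ft f (\<sigma> *\<^sub>R v)) \<in> borel_measurable borel"
proof -
  have "continuous_on UNIV (\<lambda>\<sigma>. ft f (\<sigma> *\<^sub>R v))"
    by (rule continuous_on_compose2[OF continuous_on_ft[OF assms]]) (auto intro!: continuous_intros)
  then show ?thesis by (rule borel_measurable_continuous_onI)
qed

lemma ft_add: "integrable lborel f \<Longrightarrow> integrable lborel g \<Longrightarrow> ft (\<lambda>x. f x + g x) \<xi> = ft f \<xi> + ft g \<xi>"
  using ft_integrable[of f \<xi>] ft_integrable[of g \<xi>] by (simp add: ft_def distrib_left)

lemma ft_cmult: "ft (\<lambda>x. c * f x) \<xi> = of_real c * ft f \<xi>"
proof -
  have "ft (\<lambda>x. c * f x) \<xi> = (LINT x|lborel. complex_of_real c * (cis (- (x \<bullet> \<xi>)) * complex_of_real (f x)))"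
    by (simp add: ft_def mult_ac)
  also have "\<dots> = of_real c * ft f \<xi>" unfolding ft_def by simp
  finally show ?thesis .
qed

lemma ft_diff: "integrable lborel f \<Longrightarrow> integrable lborel g \<Longrightarrow> ft (\<lambda>x. f x - g x) \<xi> = ft f \<xi> - ft g \<xi>"
  using ft_add[of f "\<lambda>x. (-1) * g x"] ft_cmult[of "-1" g] by simp

lemma ft_dilate:
  fixes f :: "'a::euclidean_space \<Rightarrow> real"
  assumes c: "c > 0" and [measurable]: "f \<in> borel_measurable borel"
  shows "ft (\<lambda>x. c ^ DIM('a) * f (c *\<^sub>R x)) \<xi> = ft f ((1 / c) *\<^sub>R \<xi>)"
proof -
  have "ft f ((1 / c) *\<^sub>R \<xi>) = \<bar>c\<bar> ^ DIM('a) *\<^sub>R (LINT x|lborel. cis (- ((0 + c *\<^sub>R x) \<bullet> ((1 / c) *\<^sub>R \<xi>))) * complex_of_real (f (0 + c *\<^sub>R x)))"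
    unfolding ft_def by (rule lborel_integral_affine) (use c in auto)
  also have "\<dots> = of_real (c ^ DIM('a)) * ft (\<lambda>x. f (c *\<^sub>R x)) \<xi>"
    using c by (simp add: ft_def scaleR_conv_of_real)
  finally show ?thesis by (subst ft_cmult) simp
qed

section \<open>Convolution\<close>

definition conv :: "('a::euclidean_space \<Rightarrow> real) \<Rightarrow> ('a \<Rightarrow> real) \<Rightarrow> 'a \<Rightarrow> real" where
  "conv f g x = (LINT y|lborel. f y * g (x - y))"

lemma conv_measurable [measurable]:
  assumes [measurable]: "f \<in> borel_measurable borel" "g \<in> borel_measurable borel"
  shows "conv f g \<in> borel_measurable borel"
  unfolding conv_def by measurable

lemma conv_commute:
  assumes [measurable]: "f \<in> borel_measurable borel" "g \<in> borel_measurable borel"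
  shows "conv f g x = conv g f x"
  unfolding conv_def using lborel_integral_shift(3)[of "\<lambda>y. f y * g (x - y)" x]
  by (simp add: mult.commute)

lemma conv_integrand:
  assumes f: "integrable lborel f" and g: "bbs g"
  shows "integrable lborel (\<lambda>y. f y * g (x - y))"
proof -
  obtain C R where "C \<ge> 0 \<and> R > 0 \<and> (\<forall>x. \<bar>g x\<bar> \<le> C) \<and> (\<forall>x. norm x > R \<longrightarrow> g x = 0)"
    using bbsD[OF g] by blast
  then have CE: "C \<ge> 0" "R > 0" "\<And>x. \<bar>g x\<bar> \<le> C" "\<And>x. norm x > R \<Longrightarrow> g x = 0" by auto
  note C = CE(1)  CE(3)
  have [measurable]: "g \<in> borel_measurable borel" "f \<in> borel_measurable borel" using f g by (auto simp: bbs_measurable)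
  show ?thesis
    by (rule Bochner_Integration.integrable_bound[of _ "\<lambda>y. C * f y"])
      (use f C mult_left_mono[OF C(2) abs_ge_zero[of "f _"]] in \<open>auto intro!: AE_I2 simp: abs_mult mult.commute[of C]\<close>)
qed

lemma conv_bound:
  assumes f: "integrable lborel f" and g: "bbs g" "\<And>x. \<bar>g x\<bar> \<le> C"
  shows "\<bar>conv f g x\<bar> \<le> (LINT x|lborel. \<bar>f x\<bar>) * C"
proof -
  have "\<bar>conv f g x\<bar> \<le> (LINT y|lborel. \<bar>f y * g (x - y)\<bar>)"
    unfolding conv_def by (rule integral_abs_bound)
  also have "\<dots> \<le> (LINT y|lborel. \<bar>f y\<bar> * C)"
    by (intro integral_mono integrable_abs conv_integrand f g integrable_mult_left)
      (auto simp: abs_mult intro!: mult_left_mono g)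
  finally show ?thesis using f by simp
qed

lemma conv_support:
  fixes f g :: "'a::euclidean_space \<Rightarrow> real"
  assumes "\<And>x. norm x > R \<Longrightarrow> f x = 0" "\<And>x. norm x > T \<Longrightarrow> g x = 0" "norm x > R + T"
  shows "conv f g x = 0"
proof -
  have "f y * g (x - y) = 0" for y
  proof (cases "norm y > R")
    case False
    then have "norm (x - y) > T" using norm_triangle_ineq2[of x y] assms(3) by linarith
    then show ?thesis using assms(2) by simp
  qed (simp add: assms(1))
  then have "(\<lambda>y. f y * g (x - y)) = (\<lambda>y. 0)" by blast
  then show ?thesis unfolding conv_def by simp
qed

text \<open>The two factors are treated asymmetrically on purpose: the smoothing kernel is
  integrable with bounded support but may be unbounded.\<close>

lemma bbs_conv:
  assumes f: "integrable lborel f" "\<And>x. norm x > R \<Longrightarrow> f x = 0" and g: "bbs g"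
  shows "bbs (conv f g)"
proof -
  obtain C T where "C \<ge> 0 \<and> T > 0 \<and> (\<forall>x. \<bar>g x\<bar> \<le> C) \<and> (\<forall>x. norm x > T \<longrightarrow> g x = 0)"
    using bbsD[OF g] by blast
  then have CE: "C \<ge> 0" "T > 0" "\<And>x. \<bar>g x\<bar> \<le> C" "\<And>x. norm x > T \<Longrightarrow> g x = 0" by auto
  note C = CE(3)  CE(4)
  have "conv f g x = 0" if "norm x > R + T" for x
    using conv_support[of R f T g x] f(2) C(2) that by blast
  moreover have "conv f g \<in> borel_measurable borel"
    by (rule conv_measurable) (use f g in \<open>auto simp: bbs_measurable\<close>)
  ultimately show ?thesis using conv_bound[OF f(1) g C(1)] unfolding bbs_def by blast
qed

lemma integral_conv:
  fixes f g :: "'a::euclidean_space \<Rightarrow> complex"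
  assumes f: "integrable lborel f" and g: "integrable lborel g"
  shows "(LINT x|lborel. LINT y|lborel. f y * g (x - y)) = (LINT x|lborel. f x) * (LINT x|lborel. g x)"
proof -
  have [measurable]: "g \<in> borel_measurable borel" "f \<in> borel_measurable borel" using f g by auto
  have i: "integrable (lborel \<Otimes>\<^sub>M lborel) (\<lambda>(y, x). f y * g (x - y))"
  proof (rule lborel_pair.Fubini_integrable)
    have "(LINT x|lborel. norm (f y * g (x - y))) = norm (f y) * (LINT x|lborel. norm (g x))" for y
      using lborel_integral_shift(2)[of "\<lambda>x. norm (g x)" y] by (simp add: norm_mult)
    then show "integrable lborel (\<lambda>y. LINT x|lborel. norm (case (y, x) of (y, x) \<Rightarrow> f y * g (x - y)))"
      using f by (simp add: integrable_norm)
    show "AE y in lborel. integrable lborel (\<lambda>x. case (y, x) of (y, x) \<Rightarrow> f y * g (x - y))"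
      using lborel_integrable_shift(2)[OF g] by auto
  qed measurable
  have "(LINT x|lborel. LINT y|lborel. f y * g (x - y)) = (LINT y|lborel. LINT x|lborel. f y * g (x - y))"
    by (rule lborel_pair.Fubini_integral[of "\<lambda>y x. f y * g (x - y)"]) (use i in simp)
  also have "\<dots> = (LINT y|lborel. f y * (LINT x|lborel. g x))"
    using lborel_integral_shift(2)[of g] by simp
  finally show "(LINT x|lborel. LINT y|lborel. f y * g (x - y)) = (LINT x|lborel. f x) * (LINT x|lborel. g x)"
    by simp
qed

lemma ft_conv:
  fixes f g :: "'a::euclidean_space \<Rightarrow> real"
  assumes f: "integrable lborel f" and g: "bbs g"
  shows "ft (conv f g) \<xi> = ft f \<xi> * ft g \<xi>"
proof -
  have "ft (conv f g) \<xi> = (LINT x|lborel. LINT y|lborel. (cis (- (y \<bullet> \<xi>)) * complex_of_real (f y)) *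
      (cis (- ((x - y) \<bullet> \<xi>)) * complex_of_real (g (x - y))))"
    unfolding ft_def conv_def
  proof (intro Bochner_Integration.integral_cong refl)
    fix x
    have "cis (- (x \<bullet> \<xi>)) * complex_of_real (LINT y|lborel. f y * g (x - y)) =
      (LINT y|lborel. cis (- (x \<bullet> \<xi>)) * complex_of_real (f y * g (x - y)))"
      by (simp only: integral_complex_of_real integral_mult_right_zero)
    also have "\<dots> = (LINT y|lborel. (cis (- (y \<bullet> \<xi>)) * complex_of_real (f y)) *
      (cis (- ((x - y) \<bullet> \<xi>)) * complex_of_real (g (x - y))))"
    proof (intro Bochner_Integration.integral_cong refl)
      fix y
      have "cis (- (x \<bullet> \<xi>)) = cis (- (y \<bullet> \<xi>)) * cis (- ((x - y) \<bullet> \<xi>))"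
        by (simp add: cis_mult inner_diff_left)
      then show "cis (- (x \<bullet> \<xi>)) * complex_of_real (f y * g (x - y)) = (cis (- (y \<bullet> \<xi>)) * complex_of_real (f y)) *
      (cis (- ((x - y) \<bullet> \<xi>)) * complex_of_real (g (x - y)))" by simp
    qed
    finally show "cis (- (x \<bullet> \<xi>)) * complex_of_real (LINT y|lborel. f y * g (x - y)) = \<dots>" .
  qed
  also have "\<dots> = ft f \<xi> * ft g \<xi>"
    unfolding ft_def by (rule integral_conv) (use f bbs_integrable[OF g] in \<open>auto intro: ft_integrable\<close>)
  finally show ?thesis .
qed

section \<open>Derivatives on the Fourier side\<close>

lemma norm_diff_dd_bound:
  fixes f :: "'a::euclidean_space \<Rightarrow> 'b::real_normed_vector"
  assumes d: "\<And>x. f differentiable at x" and B: "\<And>x. norm (dd v f x) \<le> B"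
  shows "norm (f (x + t *\<^sub>R v) - f x) \<le> B * \<bar>t\<bar>"
proof -
  have der: "((\<lambda>s. f (x + s *\<^sub>R v)) has_derivative (\<lambda>h. h *\<^sub>R dd v f (x + s *\<^sub>R v))) (at s)" for s
  proof -
    have "((\<lambda>s. f (x + s *\<^sub>R v)) has_derivative (\<lambda>h. dd (h *\<^sub>R v) f (x + s *\<^sub>R v))) (at s)"
      by (rule has_derivative_compose[OF _ has_derivative_dd[OF d]]) (auto intro!: derivative_eq_intros)
    moreover have "dd (h *\<^sub>R v) f y = h *\<^sub>R dd v f y" for h y
      using linear_scale[OF has_derivative_linear[OF has_derivative_dd[OF d]]] .
    ultimately show ?thesis by simp
  qed
  have "norm (f (x + t *\<^sub>R v) - f (x + 0 *\<^sub>R v)) \<le> B * norm (t - 0)"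
  proof (rule differentiable_bound[of UNIV "\<lambda>s. f (x + s *\<^sub>R v)" "\<lambda>s h. h *\<^sub>R dd v f (x + s *\<^sub>R v)"])
    fix s show "onorm (\<lambda>h. h *\<^sub>R dd v f (x + s *\<^sub>R v)) \<le> B"
      by (rule onorm_le) (use B[of "x + s *\<^sub>R v"] in \<open>auto simp: mult.commute[of B] intro!: mult_left_mono\<close>)
  qed (use der in auto)
  then show ?thesis by simp
qed

text \<open>Difference quotients have integral zero by translation invariance, and the mean value
  inequality dominates them by \<open>B\<close> on a fixed ball. This works in any direction without
  splitting off a coordinate.\<close>

lemma integral_dd_zero:
  fixes f :: "'a::euclidean_space \<Rightarrow> complex"
  assumes d: "\<And>x. f differentiable at x" and B: "\<And>x. norm (dd v f x) \<le> B"
    and R: "\<And>x. norm x > R \<Longrightarrow> f x = 0"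
  shows "(LINT x|lborel. dd v f x) = 0"
proof -
  have fc: "continuous_on UNIV f"
    using d by (intro continuous_at_imp_continuous_on ballI differentiable_imp_continuous_within)
  have [measurable]: "f \<in> borel_measurable borel" by (rule borel_measurable_continuous_onI[OF fc])
  obtain M where M: "\<And>x. norm (f x) \<le> M" using compact_supp_bounded[OF fc R] by auto
  have fi: "integrable lborel f" by (rule integrable_bounded_support[OF _ M R]) auto
  define q where "q n x = real (Suc n) *\<^sub>R (f (x + (1 / real (Suc n)) *\<^sub>R v) - f x)" for n x
  have lim: "(\<lambda>n. q n x) \<longlonglongrightarrow> dd v f x" for x
  proof -
    have "((\<lambda>s. f (x + s *\<^sub>R v)) has_derivative (\<lambda>h. dd (h *\<^sub>R v) f (x + 0 *\<^sub>R v))) (at 0)"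
      by (rule has_derivative_compose[OF _ has_derivative_dd[OF d]]) (auto intro!: derivative_eq_intros)
    moreover have "dd (h *\<^sub>R v) f y = h *\<^sub>R dd v f y" for h y
      using linear_scale[OF has_derivative_linear[OF has_derivative_dd[OF d]]] .
    ultimately have "((\<lambda>s. f (x + s *\<^sub>R v)) has_vector_derivative dd v f x) (at 0)"
      by (simp add: has_vector_derivative_def)
    then have H: "((\<lambda>h. norm (f (x + h *\<^sub>R v) - (f x + h *\<^sub>R dd v f x)) / \<bar>h\<bar>) \<longlongrightarrow> 0) (at 0)"
      by (simp add: has_vector_derivative_def has_derivative_at diff_diff_eq)
    have "((\<lambda>h. norm ((f (x + h *\<^sub>R v) - f x) /\<^sub>R h - dd v f x)) \<longlongrightarrow> 0) (at 0)"
    proof (rule Lim_transform_eventually[OF H])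
      have "norm (f (x + h *\<^sub>R v) - (f x + h *\<^sub>R dd v f x)) / \<bar>h\<bar> = norm ((f (x + h *\<^sub>R v) - f x) /\<^sub>R h - dd v f x)"
        if "h \<noteq> 0" for h
      proof -
        have "(f (x + h *\<^sub>R v) - f x) /\<^sub>R h - dd v f x = (f (x + h *\<^sub>R v) - (f x + h *\<^sub>R dd v f x)) /\<^sub>R h"
          using that by (simp add: scaleR_diff_right scaleR_add_right)
        then show ?thesis by (simp add: divide_inverse mult.commute)
      qed
      then show "\<forall>\<^sub>F h in at 0. norm (f (x + h *\<^sub>R v) - (f x + h *\<^sub>R dd v f x)) / \<bar>h\<bar> =
          norm ((f (x + h *\<^sub>R v) - f x) /\<^sub>R h - dd v f x)"
        unfolding eventually_at_filter by simp
    qed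
    then have "((\<lambda>h. (f (x + h *\<^sub>R v) - f x) /\<^sub>R h) \<longlongrightarrow> dd v f x) (at 0)"
      by (rule LIM_zero_cancel[OF tendsto_norm_zero_cancel])
    moreover have "filterlim (\<lambda>n. 1 / real (Suc n)) (at 0) sequentially"
      unfolding filterlim_at using LIMSEQ_Suc[OF lim_1_over_n] by auto
    ultimately have "(\<lambda>n. (f (x + (1 / real (Suc n)) *\<^sub>R v) - f x) /\<^sub>R (1 / real (Suc n))) \<longlonglongrightarrow> dd v f x"
      by (rule filterlim_compose)
    then show ?thesis unfolding q_def by simp
  qed
  have qm: "q n \<in> borel_measurable borel" for n unfolding q_def by measurable
  have "(\<lambda>n. LINT x|lborel. q n x) \<longlonglongrightarrow> (LINT x|lborel. dd v f x)"
  proof (rule integral_dominated_convergence)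
    show "integrable lborel (\<lambda>x. B * indicator (cball 0 (R + norm v) :: 'a set) x)"
      by (rule integrable_indicator_cball)
    show "AE x in lborel. norm (q n x) \<le> B * indicator (cball 0 (R + norm v)) x" for n
    proof (intro AE_I2)
      fix x :: 'a
      have n: "norm (q n x) \<le> B"
        using norm_diff_dd_bound[OF d B, of x "1 / real (Suc n)"]
        by (simp add: q_def pos_le_divide_eq mult.commute del: of_nat_Suc)
      have "q n x = 0" if "norm x > R + norm v"
      proof -
        have "(1 / real (Suc n)) * norm v \<le> 1 * norm v" by (intro mult_right_mono) auto
        then have "norm (x + (1 / real (Suc n)) *\<^sub>R v) > R"
          using norm_diff_ineq[of x "(1 / real (Suc n)) *\<^sub>R v"] that by simp
        moreover have "norm x > R" using that norm_ge_zero[of v] by linarith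
        ultimately show ?thesis unfolding q_def using R by simp
      qed
      then show "norm (q n x) \<le> B * indicator (cball 0 (R + norm v)) x"
        using n by (cases "norm x > R + norm v") auto
    qed
    show "q n \<in> borel_measurable lborel" for n using qm by simp
    show "dd v f \<in> borel_measurable lborel"
      by (rule borel_measurable_LIMSEQ_metric[of q]) (use lim qm in auto)
  qed (use lim in auto)
  moreover have "(LINT x|lborel. q n x) = 0" for n
    unfolding q_def using fi lborel_integrable_shift(1)[OF fi] lborel_integral_shift(1)[of f]
    by (simp add: Bochner_Integration.integral_diff)
  ultimately show ?thesis by (simp add: LIMSEQ_const_iff)
qed

lemma has_derivative_cis_inner:
  "((\<lambda>x. cis (- (x \<bullet> \<xi>))) has_derivative (\<lambda>v. - (\<i> * of_real (v \<bullet> \<xi>)) * cis (- (x \<bullet> \<xi>)))) (at x)"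
  by (auto intro!: derivative_eq_intros simp: scaleR_conv_of_real)

text \<open>The product of f with the oscillating factor has bounded support, so its derivative
  along v integrates to zero; the two terms of the product rule are the two sides.\<close>

lemma ft_dd:
  fixes f :: "'a::euclidean_space \<Rightarrow> real"
  assumes d: "\<And>x. f differentiable at x" and c: "continuous_on UNIV (dd v f)"
    and R: "\<And>x. norm x > R \<Longrightarrow> f x = 0"
  shows "ft (dd v f) \<xi> = \<i> * of_real (v \<bullet> \<xi>) * ft f \<xi>"
proof -
  define F where "F x = cis (- (x \<bullet> \<xi>)) * complex_of_real (f x)" for x
  have der: "(F has_derivative (\<lambda>v. cis (- (x \<bullet> \<xi>)) * of_real (dd v f x) +
      (- (\<i> * of_real (v \<bullet> \<xi>)) * cis (- (x \<bullet> \<xi>))) * of_real (f x))) (at x)" for x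
    unfolding F_def by (intro has_derivative_mult has_derivative_cis_inner has_derivative_of_real has_derivative_dd d)
  have ddF: "dd v F x = cis (- (x \<bullet> \<xi>)) * of_real (dd v f x) - \<i> * of_real (v \<bullet> \<xi>) * F x" for x
    by (subst dd_eq[OF der]) (simp add: F_def)
  have fc: "continuous_on UNIV f"
    using d by (intro continuous_at_imp_continuous_on ballI differentiable_imp_continuous_within)
  have ddR: "dd v f x = 0" if "norm x > R" for x
    by (rule dd_zero_outside[of "cball 0 R"]) (use R that in auto)
  have "continuous_on UNIV (\<lambda>x. cis (- (x \<bullet> \<xi>)) * of_real (dd v f x) - \<i> * of_real (v \<bullet> \<xi>) * F x)"
    unfolding F_def by (intro continuous_intros c fc)
  then obtain B where "\<And>x. norm (cis (- (x \<bullet> \<xi>)) * of_real (dd v f x) - \<i> * of_real (v \<bullet> \<xi>) * F x) \<le> B"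
    using compact_supp_bounded[of "\<lambda>x. cis (- (x \<bullet> \<xi>)) * of_real (dd v f x) - \<i> * of_real (v \<bullet> \<xi>) * F x" R]
      ddR R unfolding F_def by auto
  then have "(LINT x|lborel. dd v F x) = 0"
    using der R by (intro integral_dd_zero[of F v B R]) (auto simp: ddF differentiable_def F_def)
  moreover have "(LINT x|lborel. dd v F x) = ft (dd v f) \<xi> - \<i> * of_real (v \<bullet> \<xi>) * ft f \<xi>"
  proof -
    have i: "integrable lborel (dd v f)" "integrable lborel f"
      using bbs_continuous[OF c ddR] bbs_continuous[OF fc R] by (auto intro: bbs_integrable)
    have "(LINT x|lborel. dd v F x) = (LINT x|lborel. cis (- (x \<bullet> \<xi>)) * of_real (dd v f x)) -
        (LINT x|lborel. \<i> * of_real (v \<bullet> \<xi>) * (cis (- (x \<bullet> \<xi>)) * of_real (f x)))"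
      unfolding ddF F_def
      by (intro Bochner_Integration.integral_diff integrable_mult_right ft_integrable i)
    also have "\<dots> = ft (dd v f) \<xi> - \<i> * of_real (v \<bullet> \<xi>) * ft f \<xi>"
      unfolding ft_def by (simp only: integral_mult_right_zero)
    finally show ?thesis .
  qed
  ultimately show ?thesis by simp
qed

text \<open>Each power of |\<xi>| is paid for by one derivative, after |\<xi>| is bounded by the sum
  of its coordinates in absolute value.\<close>

lemma ft_rapid_decay:
  fixes f :: "'a::euclidean_space \<Rightarrow> real"
  assumes "smooth_on UNIV f" "\<And>x. norm x > R \<Longrightarrow> f x = 0"
  shows "\<exists>C\<ge>0. \<forall>\<xi>. norm (ft f \<xi>) * norm \<xi> ^ n \<le> C"
  using assms
proof (induction n arbitrary: f)
  case 0
  have "integrable lborel f"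
    using bbs_continuous[OF smooth_on_continuous[OF 0(1)] 0(2)] by (rule bbs_integrable)
  then have "norm (ft f \<xi>) \<le> (LINT x|lborel. \<bar>f x\<bar>)" for \<xi> by (rule ft_bound)
  then show ?case by (intro exI[of _ "LINT x|lborel. \<bar>f x\<bar>"]) auto
next
  case (Suc n)
  have s: "smooth_on UNIV (dd b f)" for b using smooth_on_dd[OF open_UNIV Suc.prems(1)] .
  have R: "dd b f x = 0" if "norm x > R" for x b
    by (rule dd_zero_outside[of "cball 0 R"]) (use Suc.prems(2) that in auto)
  obtain C :: "'a \<Rightarrow> real" where C: "\<And>b. C b \<ge> 0" "\<And>b \<xi>. norm (ft (dd b f) \<xi>) * norm \<xi> ^ n \<le> C b"
    using Suc.IH[OF s R] by metis
  define S where "S = (\<Sum>b\<in>(Basis :: 'a set). C b)"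
  have "norm (ft f \<xi>) * norm \<xi> ^ Suc n \<le> S" for \<xi>
  proof -
    have e: "norm (ft (dd b f) \<xi>) = \<bar>\<xi> \<bullet> b\<bar> * norm (ft f \<xi>)" for b
      using ft_dd[OF smooth_on_differentiable[OF open_UNIV Suc.prems(1) UNIV_I] smooth_on_continuous[OF s] Suc.prems(2), where v=b and \<xi>=\<xi>]
      by (simp add: norm_mult inner_commute)
    have "norm (ft f \<xi>) * norm \<xi> ^ Suc n = norm \<xi> * (norm (ft f \<xi>) * norm \<xi> ^ n)" by simp
    also have "\<dots> \<le> (\<Sum>b\<in>Basis. \<bar>\<xi> \<bullet> b\<bar>) * (norm (ft f \<xi>) * norm \<xi> ^ n)"
      by (intro mult_right_mono norm_le_l1) auto
    also have "\<dots> = (\<Sum>b\<in>Basis. norm (ft (dd b f) \<xi>) * norm \<xi> ^ n)"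
      by (simp add: e sum_distrib_right mult.assoc)
    also have "\<dots> \<le> S" unfolding S_def by (intro sum_mono C)
    finally show ?thesis .
  qed
  moreover have "S \<ge> 0" unfolding S_def by (intro sum_nonneg C)
  ultimately show ?case by blast
qed

section \<open>Gaussians and their transforms\<close>

lemma integral_lborel_prod:
  fixes h :: "'a::euclidean_space \<Rightarrow> real \<Rightarrow> complex"
  assumes h: "\<And>b. b \<in> Basis \<Longrightarrow> integrable lborel (h b)"
  shows "(LINT x|lborel. (\<Prod>b\<in>Basis. h b (x \<bullet> b))) = (\<Prod>b\<in>Basis. (LINT t|lborel. h b t))"
    and "integrable lborel (\<lambda>x::'a. \<Prod>b\<in>Basis. h b (x \<bullet> b))"
proof -
  interpret product_sigma_finite "\<lambda>b::'a. lborel :: real measure"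
    by standard
  have m: "(\<lambda>x::'a. \<Prod>b\<in>Basis. h b (x \<bullet> b)) \<in> borel_measurable borel"
  proof (rule borel_measurable_prod)
    fix b :: 'a assume "b \<in> Basis"
    then have "h b \<in> borel_measurable borel" using h by auto
    then show "(\<lambda>x. h b (x \<bullet> b)) \<in> borel_measurable borel" by measurable
  qed
  have i: "(\<Sum>b\<in>Basis. f b *\<^sub>R b) \<bullet> c = f c" if "c \<in> Basis" for f :: "'a \<Rightarrow> real" and c
    using that by simp
  have T: "(\<lambda>f. \<Sum>b\<in>Basis. f b *\<^sub>R b) \<in> measurable (\<Pi>\<^sub>M b\<in>Basis. lborel) (borel :: 'a measure)"
    by measurable
  have eq: "(\<Prod>b\<in>Basis. h b ((\<Sum>b\<in>Basis. f b *\<^sub>R b) \<bullet> b)) = (\<Prod>b\<in>Basis. h b (f b))" for f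
    by (rule prod.cong) (auto simp: i)
  show "(LINT x|lborel. (\<Prod>b\<in>Basis. h b (x \<bullet> b))) = (\<Prod>b\<in>Basis. (LINT t|lborel. h b t))"
    by (subst lborel_eq, subst integral_distr[OF T m], simp only: eq, rule product_integral_prod)
      (use h in auto)
  show "integrable lborel (\<lambda>x::'a. \<Prod>b\<in>Basis. h b (x \<bullet> b))"
    by (subst lborel_eq, subst integrable_distr_eq[OF T m], simp only: eq, rule product_integrable_prod)
      (use h in auto)
qed

definition gs :: "'a::euclidean_space \<Rightarrow> real" where
  "gs x = exp (- (x \<bullet> x) / 2)"

text \<open>The total integral of \<open>gs\<close>; it depends on the dimension alone, hence the
  type argument.\<close>

definition gs_mass :: "'a::euclidean_space itself \<Rightarrow> real" where
  "gs_mass _ = sqrt (2 * pi) ^ DIM('a)"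

text \<open>This is the characteristic function of the standard normal distribution, freed from the
  normalising factor.\<close>

lemma gs_fourier_real:
  "(LINT t|lborel. cis (- (t * s)) * complex_of_real (exp (- t\<^sup>2 / 2))) = of_real (sqrt (2 * pi) * exp (- s\<^sup>2 / 2))"
  "integrable lborel (\<lambda>t. cis (- (t * s)) * complex_of_real (exp (- t\<^sup>2 / 2)))"
proof -
  have e: "exp (- t\<^sup>2 / 2) = sqrt (2 * pi) * std_normal_density t" for t :: real
    by (simp add: std_normal_density_def)
  have i0: "integrable lborel std_normal_density"
    using integrable_std_normal_moment[of 0] by simp
  have i1: "integrable lborel (\<lambda>t. cis (- (t * s)) * complex_of_real (std_normal_density t))"
    by (rule integrable_cis_mult) (use i0 in auto)
  have "(LINT t|lborel. cis (- (t * s)) * complex_of_real (std_normal_density t)) = char std_normal_distribution (- s)"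
    unfolding char_def
    by (subst integral_density) (auto simp: normal_density_nonneg cis_conv_exp scaleR_conv_of_real mult_ac)
  also have "\<dots> = of_real (exp (- s\<^sup>2 / 2))" by (simp add: char_std_normal_distribution)
  finally have c: "(LINT t|lborel. cis (- (t * s)) * complex_of_real (std_normal_density t)) = of_real (exp (- s\<^sup>2 / 2))" .
  have eq: "cis (- (t * s)) * complex_of_real (exp (- t\<^sup>2 / 2)) =
    complex_of_real (sqrt (2 * pi)) * (cis (- (t * s)) * complex_of_real (std_normal_density t))" for t
    unfolding e by simp
  show "(LINT t|lborel. cis (- (t * s)) * complex_of_real (exp (- t\<^sup>2 / 2))) = of_real (sqrt (2 * pi) * exp (- s\<^sup>2 / 2))"
    unfolding eq by (subst integral_mult_right_zero) (simp add: c)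
  show "integrable lborel (\<lambda>t. cis (- (t * s)) * complex_of_real (exp (- t\<^sup>2 / 2)))"
    unfolding eq by (intro integrable_mult_right i1)
qed

lemma cis_sum: "finite I \<Longrightarrow> cis (\<Sum>i\<in>I. f i) = (\<Prod>i\<in>I. cis (f i))"
  by (induction I rule: finite_induct) (auto simp: cis_mult[symmetric])

lemma gs_fourier:
  fixes x :: "'a::euclidean_space"
  shows "(LINT \<xi>|lborel. cis (- (\<xi> \<bullet> x)) * complex_of_real (gs \<xi>)) = of_real (gs_mass TYPE('a) * gs x)"
    and "integrable lborel (\<lambda>\<xi>. cis (- (\<xi> \<bullet> x)) * complex_of_real (gs \<xi>))"
proof -
  have g: "gs y = (\<Prod>b\<in>Basis. exp (- (y \<bullet> b)\<^sup>2 / 2))" for y :: 'a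
    by (simp add: gs_def euclidean_inner[of y y] power2_eq_square exp_sum[symmetric] sum_negf sum_divide_distrib)
  have c: "cis (- (\<xi> \<bullet> x)) = (\<Prod>b\<in>Basis. cis (- ((\<xi> \<bullet> b) * (x \<bullet> b))))" for \<xi>
    by (simp add: euclidean_inner[of \<xi> x] cis_sum[symmetric] sum_negf)
  have eq: "cis (- (\<xi> \<bullet> x)) * complex_of_real (gs \<xi>) =
      (\<Prod>b\<in>Basis. cis (- ((\<xi> \<bullet> b) * (x \<bullet> b))) * complex_of_real (exp (- (\<xi> \<bullet> b)\<^sup>2 / 2)))" for \<xi>
    unfolding g c by (simp add: prod.distrib)
  have i: "integrable lborel (\<lambda>t. cis (- (t * (x \<bullet> b))) * complex_of_real (exp (- t\<^sup>2 / 2)))" for b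
    by (rule gs_fourier_real)
  have "(LINT \<xi>|lborel. cis (- (\<xi> \<bullet> x)) * complex_of_real (gs \<xi>)) =
      (\<Prod>b\<in>(Basis::'a set). of_real (sqrt (2 * pi) * exp (- (x \<bullet> b)\<^sup>2 / 2)))"
    unfolding eq
    using integral_lborel_prod(1)[where h="\<lambda>b t. cis (- (t * (x \<bullet> b))) * complex_of_real (exp (- t\<^sup>2 / 2))", OF i]
    by (simp only: gs_fourier_real)
  also have "\<dots> = of_real (gs_mass TYPE('a) * gs x)"
    unfolding gs_mass_def g by (simp add: prod.distrib)
  finally show "(LINT \<xi>|lborel. cis (- (\<xi> \<bullet> x)) * complex_of_real (gs \<xi>)) = of_real (gs_mass TYPE('a) * gs x)" .
  show "integrable lborel (\<lambda>\<xi>. cis (- (\<xi> \<bullet> x)) * complex_of_real (gs \<xi>))"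
    unfolding eq
    using integral_lborel_prod(2)[where h="\<lambda>b t. cis (- (t * (x \<bullet> b))) * complex_of_real (exp (- t\<^sup>2 / 2))", OF i] .
qed

lemma gs_integrable: "integrable lborel (gs :: 'a::euclidean_space \<Rightarrow> real)"
  using gs_fourier(2)[of "0::'a"] by (simp add: cis_zero complex_of_real_integrable_eq)

lemma gs_integral: "(LINT x|lborel. gs (x::'a::euclidean_space)) = gs_mass TYPE('a)"
proof -
  have "complex_of_real (LINT x|lborel. gs (x::'a)) = of_real (gs_mass TYPE('a))"
    using gs_fourier(1)[of "0::'a"] by (simp add: cis_zero gs_def[of 0] integral_complex_of_real)
  then show ?thesis using of_real_eq_iff by blast
qed

lemma gs_measurable [measurable]: "gs \<in> borel_measurable borel"
  unfolding gs_def[abs_def] by measurable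

lemma gs_nonneg: "0 \<le> gs x" and abs_gs [simp]: "\<bar>gs x\<bar> = gs x"
  by (simp_all add: gs_def)

lemma gs_mass_square: "(gs_mass TYPE('a::euclidean_space))\<^sup>2 = (2 * pi) ^ DIM('a)"
proof -
  have "(sqrt (2 * pi) ^ n)\<^sup>2 = (sqrt (2 * pi) * sqrt (2 * pi)) ^ n" for n
    unfolding power2_eq_square power_mult_distrib ..
  then show ?thesis by (simp add: gs_mass_def)
qed

text \<open>The multiplication formula, by Fubini. It inverts the transform against Gaussians in
  \<open>plancherel\<close>, and it links \<open>ft\<close> with the distributional
  transform.\<close>

lemma fourier_swap:
  fixes f g :: "'a::euclidean_space \<Rightarrow> complex"
  assumes f: "integrable lborel f" and g: "integrable lborel g"
  shows "(LINT x|lborel. f x * (LINT y|lborel. cis (- (y \<bullet> x)) * g y)) =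
    (LINT y|lborel. (LINT x|lborel. cis (- (x \<bullet> y)) * f x) * g y)"
proof -
  have [measurable]: "g \<in> borel_measurable borel" "f \<in> borel_measurable borel" using f g by auto
  have i: "integrable (lborel \<Otimes>\<^sub>M lborel) (\<lambda>(x, y). f x * (cis (- (y \<bullet> x)) * g y))"
  proof (rule lborel_pair.Fubini_integrable)
    have "(LINT y|lborel. norm (f x * (cis (- (y \<bullet> x)) * g y))) = norm (f x) * (LINT y|lborel. norm (g y))" for x
      by (simp add: norm_mult)
    then show "integrable lborel (\<lambda>x. LINT y|lborel. norm (case (x, y) of (x, y) \<Rightarrow> f x * (cis (- (y \<bullet> x)) * g y)))"
      using f by (simp add: integrable_norm)
    show "AE x in lborel. integrable lborel (\<lambda>y. case (x, y) of (x, y) \<Rightarrow> f x * (cis (- (y \<bullet> x)) * g y))"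
      by (intro AE_I2) (auto intro!: integrable_cis_mult g)
  qed measurable
  have "(LINT x|lborel. f x * (LINT y|lborel. cis (- (y \<bullet> x)) * g y)) =
      (LINT x|lborel. LINT y|lborel. f x * (cis (- (y \<bullet> x)) * g y))" by simp
  also have "\<dots> = (LINT y|lborel. LINT x|lborel. f x * (cis (- (y \<bullet> x)) * g y))"
    by (rule lborel_pair.Fubini_integral[of "\<lambda>x y. f x * (cis (- (y \<bullet> x)) * g y)", symmetric]) (use i in simp)
  also have "\<dots> = (LINT y|lborel. LINT x|lborel. (cis (- (x \<bullet> y)) * f x) * g y)"
    by (simp add: mult_ac inner_commute)
  also have "\<dots> = (LINT y|lborel. (LINT x|lborel. cis (- (x \<bullet> y)) * f x) * g y)" by simp
  finally show ?thesis .
qed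

text \<open>The autocorrelation of f has transform |f^|^2 and its value at 0 is the integral of f^2.
  Inversion at the single point 0, with Gaussian summation, therefore gives the formula.\<close>

theorem plancherel:
  fixes f :: "'a::euclidean_space \<Rightarrow> real"
  assumes f: "bbs f"
  shows "(\<integral>\<^sup>+\<xi>. ennreal ((norm (ft f \<xi>))\<^sup>2) \<partial>lborel) = ennreal ((2 * pi) ^ DIM('a) * (LINT x|lborel. (f x)\<^sup>2))"
proof -
  obtain C R where "C \<ge> 0 \<and> R > 0 \<and> (\<forall>x. \<bar>f x\<bar> \<le> C) \<and> (\<forall>x. norm x > R \<longrightarrow> f x = 0)"
    using bbsD[OF f] by blast
  then have C: "C \<ge> 0" "R > 0" "\<And>x. \<bar>f x\<bar> \<le> C" "\<And>x. norm x > R \<Longrightarrow> f x = 0" by auto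
  have fi: "integrable lborel f" by (rule bbs_integrable[OF f])
  have [measurable]: "f \<in> borel_measurable borel" by (rule bbs_measurable[OF f])
  \<comment> \<open>Reflecting a real function conjugates its transform, so convolving with the
    reflection produces the square of the modulus.\<close>
  let ?f' = "\<lambda>x. f (- x)"
  have f': "bbs ?f'" using bbs_affine[OF f, of "-1" 0] by simp
  define A where "A = conv f ?f'"
  have A: "bbs A" unfolding A_def by (rule bbs_conv[OF fi C(4) f'])
  have [measurable]: "A \<in> borel_measurable borel" by (rule bbs_measurable[OF A])
  have Aeq: "A h = (LINT x|lborel. f x * f (x - h))" for h
    unfolding A_def conv_def by simp
  have A0: "A 0 = (LINT x|lborel. (f x)\<^sup>2)" unfolding Aeq by (simp add: power2_eq_square)
  have ftA: "ft A \<xi> = of_real ((norm (ft f \<xi>))\<^sup>2)" for \<xi>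
  proof -
    have "ft ?f' \<xi> = (LINT x|lborel. cis (- ((0 - x) \<bullet> \<xi>)) * complex_of_real (f (- (0 - x))))"
      unfolding ft_def by (rule lborel_integral_shift(3)[symmetric]) measurable
    also have "\<dots> = (LINT x|lborel. cnj (cis (- (x \<bullet> \<xi>)) * complex_of_real (f x)))"
      by (simp add: cis_cnj)
    also have "\<dots> = cnj (ft f \<xi>)" unfolding ft_def by (rule Bochner_Integration.integral_cnj)
    finally show ?thesis
      unfolding A_def ft_conv[OF fi f'] complex_norm_square by simp
  qed
  have Acont: "(\<lambda>n. A (h n)) \<longlonglongrightarrow> A 0" if h: "h \<longlonglongrightarrow> 0" for h
  proof (rule LIM_zero_cancel, rule Lim_null_comparison)
    show "(\<lambda>n. C * (LINT x|lborel. \<bar>f (x - h n) - f x\<bar>)) \<longlonglongrightarrow> 0"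
      using tendsto_mult_right_zero[OF L1_translation_continuous[OF f h]] by simp
    have "\<bar>A (h n) - A 0\<bar> \<le> C * (LINT x|lborel. \<bar>f (x - h n) - f x\<bar>)" for n
    proof -
      have i: "integrable lborel (\<lambda>x. f x * f (x - h n))" "integrable lborel (\<lambda>x. f x * f x)"
        by (intro bbs_integrable bbs_mult f bbs_shift)+
      have "A (h n) - A 0 = (LINT x|lborel. f x * (f (x - h n) - f x))"
        unfolding Aeq right_diff_distrib by (subst Bochner_Integration.integral_diff[OF i]) simp
      also have "\<bar>\<dots>\<bar> \<le> (LINT x|lborel. \<bar>f x * (f (x - h n) - f x)\<bar>)" by (rule integral_abs_bound)
      also have "\<dots> \<le> (LINT x|lborel. C * \<bar>f (x - h n) - f x\<bar>)"
        by (intro integral_mono integrable_abs integrable_mult_right bbs_integrable bbs_mult bbs_diff bbs_shift f)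
          (auto simp: abs_mult intro!: mult_right_mono C)
      finally show ?thesis by simp
    qed
    then show "\<forall>\<^sub>F n in sequentially. norm (A (h n) - A 0) \<le> C * (LINT x|lborel. \<bar>f (x - h n) - f x\<bar>)" by simp
  qed
  define c where "c n = 1 / real (Suc n)" for n
  have c: "c n > 0" "c n \<le> 1" for n by (auto simp: c_def)
  have clim: "c \<longlonglongrightarrow> 0" unfolding c_def using LIMSEQ_Suc[OF lim_1_over_n] by simp
  have gi: "integrable lborel (\<lambda>\<xi>::'a. gs (c n *\<^sub>R \<xi>))" for n
    using lborel_integrable_affine[OF _ gs_integrable, of "c n" 0] c(1)[of n] by simp
  \<comment> \<open>Multiplication formula for a Gaussian of width 1/c n and the autocorrelation:
    the transformed Gaussian is an approximate identity of width c n.\<close>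
  have key: "(LINT \<xi>|lborel. gs (c n *\<^sub>R \<xi>) * (norm (ft f \<xi>))\<^sup>2) = gs_mass TYPE('a) * (LINT z|lborel. gs z * A (c n *\<^sub>R z))" for n
  proof -
    have inner: "(LINT \<xi>|lborel. cis (- (\<xi> \<bullet> x)) * complex_of_real (gs (c n *\<^sub>R \<xi>))) =
        of_real (gs_mass TYPE('a) * ((1 / c n) ^ DIM('a) * gs ((1 / c n) *\<^sub>R x)))" for x :: 'a
    proof -
      have "ft gs ((1 / c n) *\<^sub>R x) = ft (\<lambda>x::'a. c n ^ DIM('a) * gs (c n *\<^sub>R x)) x"
        by (rule ft_dilate[symmetric]) (use c in auto)
      also have "\<dots> = of_real (c n ^ DIM('a)) * (LINT \<xi>|lborel. cis (- (\<xi> \<bullet> x)) * complex_of_real (gs (c n *\<^sub>R \<xi>)))"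
        by (subst ft_cmult) (simp add: ft_def)
      finally have "of_real (c n ^ DIM('a)) * (LINT \<xi>|lborel. cis (- (\<xi> \<bullet> x)) * complex_of_real (gs (c n *\<^sub>R \<xi>))) =
         of_real (gs_mass TYPE('a) * gs ((1 / c n) *\<^sub>R x))"
        by (simp only: ft_def gs_fourier(1))
      moreover have "c n ^ DIM('a) \<noteq> 0" using c(1)[of n] by simp
      ultimately show ?thesis by (simp add: field_simps power_divide)
    qed
    have "complex_of_real (LINT \<xi>|lborel. gs (c n *\<^sub>R \<xi>) * (norm (ft f \<xi>))\<^sup>2) =
        (LINT \<xi>|lborel. complex_of_real (gs (c n *\<^sub>R \<xi>)) * (LINT y|lborel. cis (- (y \<bullet> \<xi>)) * complex_of_real (A y)))"
      unfolding ft_def[of A, symmetric] ftA by (subst integral_complex_of_real[symmetric]) simp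
    also have "\<dots> = (LINT y|lborel. (LINT x|lborel. cis (- (x \<bullet> y)) * complex_of_real (gs (c n *\<^sub>R x))) * complex_of_real (A y))"
      by (rule fourier_swap) (use gi bbs_integrable[OF A] in auto)
    also have "\<dots> = of_real (LINT y|lborel. gs_mass TYPE('a) * ((1 / c n) ^ DIM('a) * gs ((1 / c n) *\<^sub>R y)) * A y)"
      unfolding inner by (subst integral_complex_of_real[symmetric]) simp
    finally have "(LINT \<xi>|lborel. gs (c n *\<^sub>R \<xi>) * (norm (ft f \<xi>))\<^sup>2) =
        (LINT y|lborel. gs_mass TYPE('a) * ((1 / c n) ^ DIM('a) * gs ((1 / c n) *\<^sub>R y)) * A y)"
      using of_real_eq_iff by blast
    also have "\<dots> = \<bar>c n\<bar> ^ DIM('a) *\<^sub>R (LINT z|lborel. gs_mass TYPE('a) * ((1 / c n) ^ DIM('a) * gs ((1 / c n) *\<^sub>R (0 + c n *\<^sub>R z))) * A (0 + c n *\<^sub>R z))"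
      by (rule lborel_integral_affine) (use c(1)[of n] in auto)
    also have "\<dots> = (LINT z|lborel. gs_mass TYPE('a) * (gs z * A (c n *\<^sub>R z)))"
    proof -
      have "gs_mass TYPE('a) * ((1 / c n) ^ DIM('a) * gs ((1 / c n) *\<^sub>R (0 + c n *\<^sub>R z))) * A (0 + c n *\<^sub>R z) =
          (1 / c n) ^ DIM('a) * (gs_mass TYPE('a) * (gs z * A (c n *\<^sub>R z)))" for z
        using c(1)[of n] by simp
      note eq = this
      have "\<bar>c n\<bar> ^ DIM('a) *\<^sub>R (LINT z|lborel. gs_mass TYPE('a) * ((1 / c n) ^ DIM('a) * gs ((1 / c n) *\<^sub>R (0 + c n *\<^sub>R z))) * A (0 + c n *\<^sub>R z)) =
          (c n ^ DIM('a) * (1 / c n) ^ DIM('a)) * (LINT z|lborel. gs_mass TYPE('a) * (gs z * A (c n *\<^sub>R z)))"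
        unfolding eq by (simp only: integral_mult_right_zero real_scaleR_def abs_of_pos[OF c(1)] mult.assoc)
      also have "c n ^ DIM('a) * (1 / c n) ^ DIM('a) = 1"
        using c(1)[of n] by (simp flip: power_mult_distrib)
      finally show ?thesis by simp
    qed
    finally show ?thesis by simp
  qed
  obtain D where D: "\<And>x. \<bar>A x\<bar> \<le> D" using A unfolding bbs_def by blast
  have "(\<lambda>n. LINT z|lborel. gs z * A (c n *\<^sub>R z)) \<longlonglongrightarrow> (LINT z|lborel. gs (z::'a) * A 0)"
  proof (rule integral_dominated_convergence)
    show "integrable lborel (\<lambda>z::'a. D * gs z)" by (intro integrable_mult_right gs_integrable)
    show "AE z in lborel. norm (gs z * A (c n *\<^sub>R z)) \<le> D * gs z" for n
      using D by (intro AE_I2) (auto simp: abs_mult mult.commute[of D] intro!: mult_left_mono gs_nonneg)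
    show "AE z in lborel. (\<lambda>n. gs z * A (c n *\<^sub>R z)) \<longlonglongrightarrow> gs z * A 0"
    proof (intro AE_I2 tendsto_mult tendsto_const Acont)
      fix z :: 'a show "(\<lambda>n. c n *\<^sub>R z) \<longlonglongrightarrow> 0" using tendsto_scaleR[OF clim tendsto_const[of z]] by simp
    qed
  qed auto
  then have "(\<lambda>n. LINT \<xi>|lborel. gs (c n *\<^sub>R \<xi>) * (norm (ft f \<xi>))\<^sup>2) \<longlonglongrightarrow> gs_mass TYPE('a) * (LINT z|lborel. gs (z::'a) * A 0)"
    unfolding key by (rule tendsto_mult_left)
  also have "gs_mass TYPE('a) * (LINT z|lborel. gs (z::'a) * A 0) = (2 * pi) ^ DIM('a) * (LINT x|lborel. (f x)\<^sup>2)"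
    unfolding gs_mass_square[symmetric] using gs_integral[where 'a='a] by (simp add: A0 power2_eq_square)
  finally have L1: "(\<lambda>n. ennreal (LINT \<xi>|lborel. gs (c n *\<^sub>R \<xi>) * (norm (ft f \<xi>))\<^sup>2)) \<longlonglongrightarrow>
      ennreal ((2 * pi) ^ DIM('a) * (LINT x|lborel. (f x)\<^sup>2))"
    by (rule tendsto_ennrealI)
  have [measurable]: "ft f \<in> borel_measurable borel" by (rule ft_measurable[OF fi])
  have fb: "norm (ft f \<xi>) \<le> (LINT x|lborel. \<bar>f x\<bar>)" for \<xi> by (rule ft_bound[OF fi])
  have e: "ennreal (LINT \<xi>|lborel. gs (c n *\<^sub>R \<xi>) * (norm (ft f \<xi>))\<^sup>2) = (\<integral>\<^sup>+\<xi>. ennreal (gs (c n *\<^sub>R \<xi>) * (norm (ft f \<xi>))\<^sup>2) \<partial>lborel)" for n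
  proof (rule nn_integral_eq_integral[symmetric])
    show "integrable lborel (\<lambda>\<xi>. gs (c n *\<^sub>R \<xi>) * (norm (ft f \<xi>))\<^sup>2)"
    proof (rule Bochner_Integration.integrable_bound[of _ "\<lambda>\<xi>. gs (c n *\<^sub>R \<xi>) * (LINT x|lborel. \<bar>f x\<bar>)\<^sup>2"])
      show "AE \<xi> in lborel. norm (gs (c n *\<^sub>R \<xi>) * (norm (ft f \<xi>))\<^sup>2) \<le> norm (gs (c n *\<^sub>R \<xi>) * (LINT x|lborel. \<bar>f x\<bar>)\<^sup>2)"
        using fb by (intro AE_I2) (auto simp: abs_mult intro!: mult_left_mono power_mono gs_nonneg)
    qed (use gi in auto)
    show "AE \<xi> in lborel. 0 \<le> gs (c n *\<^sub>R \<xi>) * (norm (ft f \<xi>))\<^sup>2"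
      by (intro AE_I2) (auto intro!: mult_nonneg_nonneg gs_nonneg)
  qed
  \<comment> \<open>The Gaussians increase to 1 as c n decreases to 0. Monotone convergence is used
    because integrability of |f^|^2 is not known beforehand.\<close>
  have "(\<lambda>n. \<integral>\<^sup>+\<xi>. ennreal (gs (c n *\<^sub>R \<xi>) * (norm (ft f \<xi>))\<^sup>2) \<partial>lborel) \<longlonglongrightarrow> (\<integral>\<^sup>+\<xi>. ennreal ((norm (ft f \<xi>))\<^sup>2) \<partial>lborel)"
  proof (rule nn_integral_LIMSEQ)
    have "gs (c n *\<^sub>R \<xi>) \<le> gs (c (Suc n) *\<^sub>R \<xi>)" for n \<xi>
    proof -
      have "c (Suc n) * c (Suc n) \<le> c n * c n" unfolding c_def by (intro mult_mono) (auto simp: field_simps)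
      then have "c (Suc n) * (c (Suc n) * (\<xi> \<bullet> \<xi>)) \<le> c n * (c n * (\<xi> \<bullet> \<xi>))"
        by (simp only: mult.assoc[symmetric]) (intro mult_right_mono, auto)
      then show ?thesis by (simp add: gs_def)
    qed
    then show "incseq (\<lambda>n \<xi>. ennreal (gs (c n *\<^sub>R \<xi>) * (norm (ft f \<xi>))\<^sup>2))"
      by (intro incseq_SucI le_funI ennreal_leI mult_right_mono) auto
    fix \<xi> :: 'a
    have "(\<lambda>n. gs (c n *\<^sub>R \<xi>)) \<longlonglongrightarrow> exp (- ((0 *\<^sub>R \<xi>) \<bullet> (0 *\<^sub>R \<xi>)) / 2)"
      unfolding gs_def by (intro tendsto_intros clim) auto
    then have "(\<lambda>n. gs (c n *\<^sub>R \<xi>) * (norm (ft f \<xi>))\<^sup>2) \<longlonglongrightarrow> 1 * (norm (ft f \<xi>))\<^sup>2"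
      by (intro tendsto_mult tendsto_const) simp
    then show "(\<lambda>n. ennreal (gs (c n *\<^sub>R \<xi>) * (norm (ft f \<xi>))\<^sup>2)) \<longlonglongrightarrow> ennreal ((norm (ft f \<xi>))\<^sup>2)"
      using tendsto_ennrealI by fastforce
  qed auto
  then show ?thesis by (rule LIMSEQ_unique[OF _ L1[unfolded e]])
qed

section \<open>Dyadic smooth approximation\<close>

text \<open>\<open>symb P n r F\<close>: the derivatives of order \<open>m \<le> n\<close> of the sequence \<open>F\<close> have size
  \<open>O(2\<^bsup>j(r+m)\<^esup>)\<close>, where \<open>P\<close> says how size is measured.\<close>

primrec symb :: "(real \<Rightarrow> (nat \<Rightarrow> 'a::euclidean_space \<Rightarrow> real) \<Rightarrow> bool) \<Rightarrow> nat \<Rightarrow> real \<Rightarrow>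
    (nat \<Rightarrow> 'a \<Rightarrow> real) \<Rightarrow> bool" where
  "symb P 0 r F = P r F"
| "symb P (Suc n) r F = (P r F \<and> (\<forall>j x. F j differentiable at x) \<and> (\<forall>v. symb P n (r + 1) (\<lambda>j. dd v (F j))))"

definition sup_size :: "real \<Rightarrow> (nat \<Rightarrow> 'a::euclidean_space \<Rightarrow> real) \<Rightarrow> bool" where
  "sup_size r F \<longleftrightarrow> (\<forall>j. F j \<in> borel_measurable borel) \<and> (\<exists>C\<ge>0. \<forall>j x. \<bar>F j x\<bar> \<le> C * 2 powr (r * real j))"

text \<open>The bound is on the square of the L^2 norm, hence the squared power. Only the constant
  \<open>C\<close> is uniform in j; pointwise bounds and supports may depend on j.\<close>

definition L2_size :: "real \<Rightarrow> (nat \<Rightarrow> 'a::euclidean_space \<Rightarrow> real) \<Rightarrow> bool" where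
  "L2_size r F \<longleftrightarrow> (\<forall>j. bbs (F j)) \<and> (\<exists>C\<ge>0. \<forall>j. (LINT x|lborel. (F j x)\<^sup>2) \<le> C * (2 powr (r * real j))\<^sup>2)"

lemma symb_base: "symb P n r F \<Longrightarrow> P r F"
  by (cases n) auto

lemma symb_mono: "symb P n r F \<Longrightarrow> m \<le> n \<Longrightarrow> symb P m r F"
proof (induction n arbitrary: m r F)
  case (Suc n)
  then show ?case by (cases m) auto
qed simp

lemma symb_Cn: "symb P n r F \<Longrightarrow> Cn n UNIV (F j)"
proof (induction n arbitrary: r F)
  case (Suc n)
  have "Cn n UNIV (dd v (F j))" for v
    by (rule Suc.IH[of "r + 1" "\<lambda>j. dd v (F j)"]) (use Suc.prems in simp)
  then show ?case using Suc.prems by simp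
qed simp

lemma symb_smooth: "(\<And>n. symb P n r F) \<Longrightarrow> smooth_on UNIV (F j)"
  by (intro Cn_imp_smooth_on symb_Cn) auto

lemma symb_add:
  assumes P: "\<And>r F G. P r F \<Longrightarrow> P r G \<Longrightarrow> P r (\<lambda>j x. F j x + G j x)"
  shows "symb P n r F \<Longrightarrow> symb P n r G \<Longrightarrow> symb P n r (\<lambda>j x. F j x + G j x)"
proof (induction n arbitrary: r F G)
  case (Suc n)
  have d: "F j differentiable at x" "G j differentiable at x" for j x using Suc.prems by auto
  have e: "(\<lambda>j. dd v (\<lambda>x. F j x + G j x)) = (\<lambda>j x. dd v (F j) x + dd v (G j) x)" for v
    by (intro ext dd_add d)
  show ?case unfolding symb.simps e
    using Suc P[of r F G] by (auto intro!: differentiable_add)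
qed (simp add: P)

text \<open>The Leibniz rule. Three separate notions of size let one induction cover sup times sup
  as well as sup times L^2.\<close>

lemma symb_mult:
  assumes add: "\<And>r F G. Pc r F \<Longrightarrow> Pc r G \<Longrightarrow> Pc r (\<lambda>j x. F j x + G j x)"
    and P: "\<And>r s F G. Pa r F \<Longrightarrow> Pb s G \<Longrightarrow> Pc (r + s) (\<lambda>j x. F j x * G j x)"
  shows "symb Pa n r F \<Longrightarrow> symb Pb n s G \<Longrightarrow> symb Pc n (r + s) (\<lambda>j x. F j x * G j x)"
proof (induction n arbitrary: r s F G)
  case (Suc n)
  have d: "F j differentiable at x" "G j differentiable at x" for j x using Suc.prems by auto
  have e: "(\<lambda>j. dd v (\<lambda>x. F j x * G j x)) = (\<lambda>j x. dd v (F j) x * G j x + F j x * dd v (G j) x)" for v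
    by (intro ext dd_mult d)
  have m: "symb Pa n r F" "symb Pb n s G" using symb_mono[OF Suc.prems(1), of n] symb_mono[OF Suc.prems(2), of n] by auto
  have "symb Pc n (r + s + 1) (\<lambda>j x. dd v (F j) x * G j x + F j x * dd v (G j) x)" for v
  proof (rule symb_add[where P=Pc], erule (1) add)
    have "symb Pc n ((r + 1) + s) (\<lambda>j x. dd v (F j) x * G j x)" using Suc m by simp
    then show "symb Pc n (r + s + 1) (\<lambda>j x. dd v (F j) x * G j x)" by (simp add: add_ac)
    have "symb Pc n (r + (s + 1)) (\<lambda>j x. F j x * dd v (G j) x)" using Suc m by simp
    then show "symb Pc n (r + s + 1) (\<lambda>j x. F j x * dd v (G j) x)" by (simp add: add_ac)
  qed
  then show ?case unfolding symb.simps e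
    using Suc.prems P[of r F s G] by (auto intro!: differentiable_mult)
qed (simp add: P)

lemma sup_sizeI:
  "\<lbrakk>\<And>j. F j \<in> borel_measurable borel; C \<ge> 0; \<And>j x. \<bar>F j x\<bar> \<le> C * 2 powr (r * real j)\<rbrakk> \<Longrightarrow> sup_size r F"
  unfolding sup_size_def by blast

lemma sup_size_add: "sup_size r F \<Longrightarrow> sup_size r G \<Longrightarrow> sup_size r (\<lambda>j x. F j x + G j x)"
proof -
  assume F: "sup_size r F" and G: "sup_size r G"
  obtain C where C: "C \<ge> 0" "\<forall>j x. \<bar>F j x\<bar> \<le> C * 2 powr (r * real j)" using F unfolding sup_size_def by blast
  obtain D where D: "D \<ge> 0" "\<forall>j x. \<bar>G j x\<bar> \<le> D * 2 powr (r * real j)" using G unfolding sup_size_def by blast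
  show ?thesis
  proof (rule sup_sizeI[of _ "C + D"])
    fix j x
    show "\<bar>F j x + G j x\<bar> \<le> (C + D) * 2 powr (r * real j)"
      using C(2)[rule_format, of j x] D(2)[rule_format, of j x] abs_triangle_ineq[of "F j x" "G j x"]
      unfolding distrib_right by linarith
  qed (use C D F G in \<open>auto simp: sup_size_def intro!: borel_measurable_add\<close>)
qed

lemma sup_size_mult: "sup_size r F \<Longrightarrow> sup_size s G \<Longrightarrow> sup_size (r + s) (\<lambda>j x. F j x * G j x)"
proof -
  assume F: "sup_size r F" and G: "sup_size s G"
  obtain C where C: "C \<ge> 0" "\<forall>j x. \<bar>F j x\<bar> \<le> C * 2 powr (r * real j)" using F unfolding sup_size_def by blast
  obtain D where D: "D \<ge> 0" "\<forall>j x. \<bar>G j x\<bar> \<le> D * 2 powr (s * real j)" using G unfolding sup_size_def by blast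
  show ?thesis
  proof (rule sup_sizeI[of _ "C * D"])
    fix j x
    have "\<bar>F j x * G j x\<bar> \<le> (C * 2 powr (r * real j)) * (D * 2 powr (s * real j))"
      unfolding abs_mult using C D by (intro mult_mono) auto
    also have "\<dots> = C * D * 2 powr ((r + s) * real j)" by (simp add: distrib_right powr_add)
    finally show "\<bar>F j x * G j x\<bar> \<le> C * D * 2 powr ((r + s) * real j)" .
  qed (use C D F G in \<open>auto simp: sup_size_def intro!: borel_measurable_times\<close>)
qed

text \<open>Boundedness, support and integrability of \<open>H\<close> all come from the pointwise
  domination. Products and differences of exponentials are both of this kind.\<close>

lemma L2_size_dominated:
  assumes G: "L2_size s G" and H: "\<And>j. H j \<in> borel_measurable borel" and C: "C \<ge> 0"
    and le: "\<And>j x. \<bar>H j x\<bar> \<le> C * 2 powr (r * real j) * \<bar>G j x\<bar>"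
  shows "L2_size (r + s) H"
proof -
  obtain D where D: "D \<ge> 0" "\<forall>j. (LINT x|lborel. (G j x)\<^sup>2) \<le> D * (2 powr (s * real j))\<^sup>2"
    using G unfolding L2_size_def by blast
  have bG: "bbs (G j)" for j using G unfolding L2_size_def by blast
  have bH: "bbs (H j)" for j
  proof -
    obtain M R where M: "\<forall>x. \<bar>G j x\<bar> \<le> M" "\<forall>x. norm x > R \<longrightarrow> G j x = 0" using bbsD[OF bG[of j]] by blast
    show ?thesis
    proof (rule bbsI[OF H])
      fix x
      have "C * 2 powr (r * real j) * \<bar>G j x\<bar> \<le> C * 2 powr (r * real j) * M"
        using C M by (intro mult_left_mono) auto
      then show "\<bar>H j x\<bar> \<le> C * 2 powr (r * real j) * M" using le[of j x] by linarith
    next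
      fix x :: 'a assume "norm x > R"
      then show "H j x = 0" using le[of j x] M by simp
    qed
  qed
  have "(LINT x|lborel. (H j x)\<^sup>2) \<le> (C\<^sup>2 * D) * (2 powr ((r + s) * real j))\<^sup>2" for j
  proof -
    have "(H j x)\<^sup>2 \<le> (C * 2 powr (r * real j))\<^sup>2 * (G j x)\<^sup>2" for x
      using power_mono[OF le[of j x] abs_ge_zero, of 2] by (simp add: power_mult_distrib)
    then have "(LINT x|lborel. (H j x)\<^sup>2) \<le> (LINT x|lborel. (C * 2 powr (r * real j))\<^sup>2 * (G j x)\<^sup>2)"
      by (intro integral_mono integrable_mult_right bbs_integrable bbs_power2 bG bH)
    also have "\<dots> = (C * 2 powr (r * real j))\<^sup>2 * (LINT x|lborel. (G j x)\<^sup>2)" by simp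
    also have "\<dots> \<le> (C * 2 powr (r * real j))\<^sup>2 * (D * (2 powr (s * real j))\<^sup>2)"
      using D by (intro mult_left_mono) auto
    also have "\<dots> = (C\<^sup>2 * D) * (2 powr ((r + s) * real j))\<^sup>2"
      by (simp add: power_mult_distrib distrib_right powr_add)
    finally show ?thesis .
  qed
  then show ?thesis unfolding L2_size_def using bH D(1) by (intro conjI allI exI[of _ "C\<^sup>2 * D"]) auto
qed

lemma sup_L2_mult: "sup_size r F \<Longrightarrow> L2_size s G \<Longrightarrow> L2_size (r + s) (\<lambda>j x. F j x * G j x)"
proof -
  assume F: "sup_size r F" and G: "L2_size s G"
  obtain C where C: "C \<ge> 0" "\<forall>j x. \<bar>F j x\<bar> \<le> C * 2 powr (r * real j)" using F unfolding sup_size_def by blast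
  show ?thesis
  proof (rule L2_size_dominated[OF G _ C(1)])
    fix j x show "\<bar>F j x * G j x\<bar> \<le> C * 2 powr (r * real j) * \<bar>G j x\<bar>"
      unfolding abs_mult using C by (intro mult_right_mono) auto
  next
    fix j show "(\<lambda>x. F j x * G j x) \<in> borel_measurable borel"
      using F G bbs_measurable unfolding sup_size_def L2_size_def by (intro borel_measurable_times) auto
  qed
qed

lemma L2_size_add: "L2_size r F \<Longrightarrow> L2_size r G \<Longrightarrow> L2_size r (\<lambda>j x. F j x + G j x)"
proof -
  assume F: "L2_size r F" and G: "L2_size r G"
  obtain C where C: "C \<ge> 0" "\<forall>j. (LINT x|lborel. (F j x)\<^sup>2) \<le> C * (2 powr (r * real j))\<^sup>2"
    using F unfolding L2_size_def by blast
  obtain D where D: "D \<ge> 0" "\<forall>j. (LINT x|lborel. (G j x)\<^sup>2) \<le> D * (2 powr (r * real j))\<^sup>2"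
    using G unfolding L2_size_def by blast
  have b: "bbs (F j)" "bbs (G j)" for j using F G unfolding L2_size_def by auto
  have "(LINT x|lborel. (F j x + G j x)\<^sup>2) \<le> (2 * C + 2 * D) * (2 powr (r * real j))\<^sup>2" for j
  proof -
    have "(LINT x|lborel. (F j x + G j x)\<^sup>2) \<le> (LINT x|lborel. 2 * (F j x)\<^sup>2 + 2 * (G j x)\<^sup>2)"
    proof (intro integral_mono bbs_integrable bbs_power2 bbs_add bbs_cmult b)
      fix x
      have "0 \<le> (F j x - G j x)\<^sup>2" by simp
      then show "(F j x + G j x)\<^sup>2 \<le> 2 * (F j x)\<^sup>2 + 2 * (G j x)\<^sup>2"
        unfolding power2_eq_square by (simp add: algebra_simps)
    qed
    also have "\<dots> = 2 * (LINT x|lborel. (F j x)\<^sup>2) + 2 * (LINT x|lborel. (G j x)\<^sup>2)"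
    proof -
      have i: "integrable lborel (\<lambda>x. 2 * (F j x)\<^sup>2)" "integrable lborel (\<lambda>x. 2 * (G j x)\<^sup>2)"
        by (intro integrable_mult_right bbs_integrable bbs_power2 b)+
      show ?thesis unfolding Bochner_Integration.integral_add[OF i] by (simp only: integral_mult_right_zero)
    qed
    also have "\<dots> \<le> 2 * (C * (2 powr (r * real j))\<^sup>2) + 2 * (D * (2 powr (r * real j))\<^sup>2)"
      using C(2) D(2) by (intro add_mono mult_left_mono) auto
    finally show ?thesis by (simp add: algebra_simps)
  qed
  then show ?thesis unfolding L2_size_def using b C D
    by (intro conjI allI exI[of _ "2 * C + 2 * D"]) (auto intro: bbs_add)
qed

lemma symb_sup_mult:
  "symb sup_size n r F \<Longrightarrow> symb sup_size n s G \<Longrightarrow> symb sup_size n (r + s) (\<lambda>j x. F j x * G j x)"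
  by (rule symb_mult[where Pa=sup_size and Pb=sup_size and Pc=sup_size]) (auto intro: sup_size_add sup_size_mult)

lemma symb_L2_mult:
  "symb sup_size n r F \<Longrightarrow> symb L2_size n s G \<Longrightarrow> symb L2_size n (r + s) (\<lambda>j x. F j x * G j x)"
  by (rule symb_mult[where Pa=sup_size and Pb=L2_size and Pc=L2_size]) (auto intro: L2_size_add sup_L2_mult)

lemma symb_sup_add:
  "symb sup_size n r F \<Longrightarrow> symb sup_size n r G \<Longrightarrow> symb sup_size n r (\<lambda>j x. F j x + G j x)"
  by (rule symb_add[where P=sup_size]) (auto intro: sup_size_add)

lemma symb_L2_add:
  "symb L2_size n r F \<Longrightarrow> symb L2_size n r G \<Longrightarrow> symb L2_size n r (\<lambda>j x. F j x + G j x)"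
  by (rule symb_add[where P=L2_size]) (auto intro: L2_size_add)

lemma symb_sup_const:
  assumes "C \<ge> 0" "\<And>j. \<bar>c j\<bar> \<le> C * 2 powr (r * real j)" shows "symb sup_size n r (\<lambda>j x. c j)"
  using assms
proof (induction n arbitrary: r c C)
  case 0
  then show ?case by (auto intro!: sup_sizeI[of _ C])
next
  case (Suc n)
  have "dd v (\<lambda>x::'a. c j) = (\<lambda>x. 0)" for v j by (simp add: fun_eq_iff)
  then show ?case using Suc.prems Suc.IH[of 0 "\<lambda>_. 0" "r + 1"] by (auto intro!: sup_sizeI[of _ C])
qed

lemma symb_sup_cmult:
  assumes "symb sup_size n r F" shows "symb sup_size n r (\<lambda>j x. c * F j x)"
  using symb_sup_mult[OF symb_sup_const[of "\<bar>c\<bar>" "\<lambda>_. c" 0] assms] by simp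

lemma symb_L2_cmult:
  assumes "symb L2_size n r F" shows "symb L2_size n r (\<lambda>j x. c * F j x)"
  using symb_L2_mult[OF symb_sup_const[of "\<bar>c\<bar>" "\<lambda>_. c" 0] assms] by simp

text \<open>The exponential reappears in its own derivative, multiplied by a first derivative of F,
  so the induction hypothesis and the product rule suffice. Order 0 is what keeps the exponent
  uniformly bounded.\<close>

lemma symb_sup_exp:
  assumes "symb sup_size n 0 F" shows "symb sup_size n 0 (\<lambda>j x. exp (- F j x))"
  using assms
proof (induction n)
  case 0
  then have F: "sup_size 0 F" by simp
  obtain C where C: "C \<ge> 0" "\<forall>j x. \<bar>F j x\<bar> \<le> C * 2 powr (0 * real j)" using F unfolding sup_size_def by blast
  have [measurable]: "F j \<in> borel_measurable borel" for j using F unfolding sup_size_def by blast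
  have "- F j x \<le> C" for j x using C(2)[rule_format, of j x] by simp
  then show ?case by (auto intro!: sup_sizeI[of _ "exp C"])
next
  case (Suc n)
  have d: "F j differentiable at x" for j x using Suc.prems by auto
  have der: "((\<lambda>x. exp (- F j x)) has_derivative (\<lambda>v. (-1) * (dd v (F j) x * exp (- F j x)))) (at x)" for j x
    using has_derivative_dd[OF d] by (auto intro!: derivative_eq_intros)
  have e: "(\<lambda>j. dd v (\<lambda>x. exp (- F j x))) = (\<lambda>j x. (-1) * (dd v (F j) x * exp (- F j x)))" for v
    by (intro ext dd_eq[OF der])
  have IH: "symb sup_size n 0 (\<lambda>j x. exp (- F j x))"
    using Suc.IH symb_mono[OF Suc.prems, of n] by simp
  have s1: "symb sup_size n (1 + 0) (\<lambda>j x. dd v (F j) x * exp (- F j x))" for v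
    by (rule symb_sup_mult[OF _ IH]) (use Suc.prems in simp)
  have "symb sup_size n (0 + 1) (\<lambda>j x. (-1) * (dd v (F j) x * exp (- F j x)))" for v
    using symb_sup_cmult[OF s1[of v], of "-1"] by (simp only: add_0_left add_0_right)
  moreover have "sup_size 0 (\<lambda>j x. exp (- F j x))" by (rule symb_base[OF IH])
  ultimately show ?case unfolding symb.simps e using der by (auto simp: differentiable_def)
qed

lemma exp_minus_diff_le:
  fixes a b :: real
  assumes "\<bar>a\<bar> \<le> M" "\<bar>b\<bar> \<le> M" shows "\<bar>exp (- a) - exp (- b)\<bar> \<le> exp M * \<bar>a - b\<bar>"
proof -
  have *: "exp (- a) - exp (- b) \<le> exp M * (b - a) \<and> exp (- a) - exp (- b) \<ge> 0" if "a \<le> b" "\<bar>a\<bar> \<le> M" for a b :: real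
  proof -
    have "exp (- a) - exp (- b) = exp (- a) * (1 - exp (a - b))"
      by (simp add: right_diff_distrib exp_add[symmetric])
    also have "\<dots> \<le> exp (- a) * (b - a)"
    proof (rule mult_left_mono)
      show "1 - exp (a - b) \<le> b - a" using exp_ge_add_one_self[of "a - b"] by linarith
    qed simp
    also have "\<dots> \<le> exp M * (b - a)" using that by (intro mult_right_mono) auto
    finally show ?thesis using that by simp
  qed
  show ?thesis using *[of a b] *[of b a] assms by (cases "a \<le> b") auto
qed

text \<open>In the derivative each term has exactly one difference, either of the first derivatives
  or of the exponentials themselves. That factor is small in L^2; the other factor is bounded, at
  the price 2^j for each derivative.\<close>

lemma symb_L2_exp_diff:
  assumes "symb sup_size n 0 F" "symb sup_size n 0 G" "symb L2_size n r (\<lambda>j x. F j x - G j x)"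
  shows "symb L2_size n r (\<lambda>j x. exp (- F j x) - exp (- G j x))"
  using assms
proof (induction n arbitrary: r)
  case 0
  obtain C where C: "C \<ge> 0" "\<forall>j x. \<bar>F j x\<bar> \<le> C * 2 powr (0 * real j)" using 0(1) unfolding symb.simps sup_size_def by blast
  obtain D where D: "D \<ge> 0" "\<forall>j x. \<bar>G j x\<bar> \<le> D * 2 powr (0 * real j)" using 0(2) unfolding symb.simps sup_size_def by blast
  have [measurable]: "F j \<in> borel_measurable borel" "G j \<in> borel_measurable borel" for j
    using 0 unfolding symb.simps sup_size_def by blast+
  have "L2_size (0 + r) (\<lambda>j x. exp (- F j x) - exp (- G j x))"
  proof (rule L2_size_dominated[OF 0(3)[unfolded symb.simps], of _ "exp (C + D)"])
    fix j x
    have "\<bar>F j x\<bar> \<le> C + D" "\<bar>G j x\<bar> \<le> C + D"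
      using C(2)[rule_format, of j x] D(2)[rule_format, of j x] C(1) D(1) by simp_all
    then show "\<bar>exp (- F j x) - exp (- G j x)\<bar> \<le> exp (C + D) * 2 powr (0 * real j) * \<bar>F j x - G j x\<bar>"
      using exp_minus_diff_le by simp
  qed auto
  then show ?case by simp
next
  case (Suc n)
  let ?E = "\<lambda>j x. exp (- F j x) - exp (- G j x)"
  have d: "F j differentiable at x" "G j differentiable at x" for j x using Suc.prems by auto
  have m: "symb sup_size n 0 F" "symb sup_size n 0 G" "symb L2_size n r (\<lambda>j x. F j x - G j x)"
    using symb_mono[OF Suc.prems(1), of n] symb_mono[OF Suc.prems(2), of n] symb_mono[OF Suc.prems(3), of n] by auto
  have IH: "symb L2_size n r ?E" by (rule Suc.IH[OF m])
  have der: "(?E j has_derivative (\<lambda>v. (-1) * (exp (- F j x) * (dd v (F j) x - dd v (G j) x) + dd v (G j) x * ?E j x))) (at x)" for j x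
    using has_derivative_dd[OF d(1)] has_derivative_dd[OF d(2)]
    by (auto intro!: derivative_eq_intros simp: algebra_simps)
  have e: "(\<lambda>j. dd v (?E j)) = (\<lambda>j x. (-1) * (exp (- F j x) * (dd v (F j) x - dd v (G j) x) + dd v (G j) x * ?E j x))" for v
    by (intro ext dd_eq[OF der])
  have FG: "symb L2_size n (r + 1) (\<lambda>j x. dd v (F j) x - dd v (G j) x)" for v
  proof -
    have "(\<lambda>j. dd v (\<lambda>x. F j x - G j x)) = (\<lambda>j x. dd v (F j) x - dd v (G j) x)" by (intro ext dd_diff d)
    then show ?thesis using Suc.prems(3) unfolding symb.simps by metis
  qed
  have "symb L2_size n (r + 1) (\<lambda>j x. (-1) * (exp (- F j x) * (dd v (F j) x - dd v (G j) x) + dd v (G j) x * ?E j x))" for v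
  proof (intro symb_L2_cmult symb_L2_add)
    show "symb L2_size n (r + 1) (\<lambda>j x. exp (- F j x) * (dd v (F j) x - dd v (G j) x))"
      using symb_L2_mult[OF symb_sup_exp[OF m(1)] FG] by simp
    have "symb sup_size n 1 (\<lambda>j. dd v (G j))" using Suc.prems(2) by simp
    then show "symb L2_size n (r + 1) (\<lambda>j x. dd v (G j) x * ?E j x)"
      using symb_L2_mult[OF _ IH, of 1 "\<lambda>j. dd v (G j)"] by (simp add: add.commute)
  qed
  moreover have "L2_size r ?E" by (rule symb_base[OF IH])
  ultimately show ?case unfolding symb.simps e using der unfolding differentiable_def by blast
qed

section \<open>Sizes of fixed smooth functions and of mollifications\<close>

lemma sup_size_smooth:
  assumes "smooth_on UNIV f" "\<And>x. norm x > R \<Longrightarrow> f x = 0" "r \<ge> 0"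
  shows "sup_size r (\<lambda>j. f)"
proof -
  obtain C where C: "C \<ge> 0" "\<And>x. \<bar>f x\<bar> \<le> C"
    using compact_supp_bounded[OF smooth_on_continuous[OF assms(1)] assms(2)] by auto
  have "C * 1 \<le> C * 2 powr (r * real j)" for j
    using C assms(3) ge_one_powr_ge_zero[of 2 "r * real j"] by (intro mult_left_mono) auto
  then have "\<bar>f x\<bar> \<le> C * 2 powr (r * real j)" for j x
    using C(2)[of x] by (metis mult.right_neutral order_trans)
  then show ?thesis
    by (intro sup_sizeI[of _ C] C(1) borel_measurable_continuous_onI smooth_on_continuous assms(1))
qed

lemma symb_sup_smooth:
  assumes "smooth_on UNIV f" "\<And>x. norm x > R \<Longrightarrow> f x = 0" "r \<ge> 0"
  shows "symb sup_size n r (\<lambda>j. f)"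
  using assms
proof (induction n arbitrary: f r)
  case 0
  then show ?case using sup_size_smooth[of f R r] by simp
next
  case (Suc n)
  have "symb sup_size n (r + 1) (\<lambda>j. dd v f)" for v
  proof (rule Suc.IH)
    show "dd v f x = 0" if "norm x > R" for x
      by (rule dd_zero_outside[of "cball 0 R"]) (use Suc.prems(2) that in auto)
  qed (use Suc.prems smooth_on_dd[OF open_UNIV] in auto)
  then show ?case
    using sup_size_smooth[of f R r] smooth_on_differentiable[OF open_UNIV Suc.prems(1)] Suc.prems by auto
qed

lemma dd_lipschitz:
  fixes f :: "'a::euclidean_space \<Rightarrow> real"
  assumes s: "smooth_on UNIV f" and R: "\<And>x. norm x > R \<Longrightarrow> f x = 0"
  shows "\<exists>L\<ge>0. \<forall>h x. \<bar>dd h f x\<bar> \<le> L * norm h \<and> \<bar>f (x + h) - f x\<bar> \<le> L * norm h"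
proof -
  have d: "f differentiable at x" for x by (rule smooth_on_differentiable[OF open_UNIV s UNIV_I])
  have "\<exists>C\<ge>0. \<forall>x. norm (dd b f x) \<le> C" for b
  proof (rule compact_supp_bounded)
    show "dd b f x = 0" if "norm x > R" for x
      by (rule dd_zero_outside[of "cball 0 R"]) (use R that in auto)
  qed (intro smooth_on_continuous smooth_on_dd s open_UNIV)
  then obtain C :: "'a \<Rightarrow> real" where C: "\<And>b. C b \<ge> 0" "\<And>b x. \<bar>dd b f x\<bar> \<le> C b" by (metis real_norm_def)
  define L where "L = (\<Sum>b\<in>(Basis::'a set). C b)"
  have L0: "L \<ge> 0" unfolding L_def by (intro sum_nonneg C)
  have 1: "\<bar>dd h f x\<bar> \<le> L * norm h" for h x
  proof -
    have "\<bar>dd h f x\<bar> = \<bar>\<Sum>b\<in>Basis. (h \<bullet> b) * dd b f x\<bar>" using dd_basis_sum[OF d, of h x] by simp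
    also have "\<dots> \<le> (\<Sum>b\<in>Basis. \<bar>(h \<bullet> b) * dd b f x\<bar>)" by (rule sum_abs)
    also have "\<dots> \<le> (\<Sum>b\<in>Basis. norm h * C b)"
      unfolding abs_mult by (intro sum_mono mult_mono C Basis_le_norm) auto
    also have "\<dots> = L * norm h" by (simp only: L_def sum_distrib_right mult.commute[of "norm h"])
    finally show ?thesis .
  qed
  have "\<bar>f (x + h) - f x\<bar> \<le> L * norm h" for h x
    using norm_diff_dd_bound[of f h "L * norm h" x 1] d 1 by simp
  then show ?thesis using 1 L0 by blast
qed

text \<open>Differentiation under the integral: the Lipschitz bound dominates the remainder divided
  by norm h by 2L|f|, for all h at once, so the full derivative results and not only directional
  ones.\<close>

lemma conv_has_derivative:
  fixes \<kappa> f :: "'a::euclidean_space \<Rightarrow> real"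
  assumes s: "smooth_on UNIV \<kappa>" and R: "\<And>x. norm x > R \<Longrightarrow> \<kappa> x = 0" and f: "bbs f"
  shows "(conv \<kappa> f has_derivative (\<lambda>v. conv (dd v \<kappa>) f x)) (at x)"
proof -
  have d: "\<kappa> differentiable at x" for x by (rule smooth_on_differentiable[OF open_UNIV s UNIV_I])
  have sd: "smooth_on UNIV (dd v \<kappa>)" for v using smooth_on_dd[OF open_UNIV s] .
  have Rd: "dd v \<kappa> x = 0" if "norm x > R" for x v
    by (rule dd_zero_outside[of "cball 0 R"]) (use R that in auto)
  have bk: "bbs \<kappa>" "bbs (dd v \<kappa>)" for v
    using bbs_continuous[OF smooth_on_continuous[OF s] R] bbs_continuous[OF smooth_on_continuous[OF sd] Rd] by auto
  have [measurable]: "\<kappa> \<in> borel_measurable borel" "dd v \<kappa> \<in> borel_measurable borel" "f \<in> borel_measurable borel" for v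
    using bk f by (auto intro: bbs_measurable)
  have fi: "integrable lborel f" by (rule bbs_integrable[OF f])
  have e: "conv \<kappa> f x = (LINT y|lborel. f y * \<kappa> (x - y))" "conv (dd v \<kappa>) f x = (LINT y|lborel. f y * dd v \<kappa> (x - y))" for x v
    by (subst conv_commute; simp add: conv_def)+
  have i: "integrable lborel (\<lambda>y. f y * \<kappa> (x - y))" "integrable lborel (\<lambda>y. f y * dd v \<kappa> (x - y))" for x v
    by (intro conv_integrand fi bk)+
  obtain L where L: "L \<ge> 0" "\<And>h x. \<bar>dd h \<kappa> x\<bar> \<le> L * norm h" "\<And>h x. \<bar>\<kappa> (x + h) - \<kappa> x\<bar> \<le> L * norm h"
    using dd_lipschitz[where R=R, OF s R] by auto
  have lin: "linear (\<lambda>v. dd v \<kappa> z)" for z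
    using has_derivative_dd[OF d] has_derivative_linear by blast
  have "linear (\<lambda>v. conv (dd v \<kappa>) f x)"
  proof (rule linearI)
    fix u v
    show "conv (dd (u + v) \<kappa>) f x = conv (dd u \<kappa>) f x + conv (dd v \<kappa>) f x"
      unfolding e linear_add[OF lin] distrib_left by (intro Bochner_Integration.integral_add i)
  next
    fix c v
    show "conv (dd (c *\<^sub>R v) \<kappa>) f x = c *\<^sub>R conv (dd v \<kappa>) f x"
      unfolding e linear_scale[OF lin] by (simp add: mult.left_commute)
  qed
  moreover have "((\<lambda>h. norm (conv \<kappa> f (x + h) - conv \<kappa> f x - conv (dd h \<kappa>) f x) / norm h) \<longlongrightarrow> 0) (at 0)"
    unfolding tendsto_at_iff_sequentially
  proof (intro allI impI)
    fix h :: "nat \<Rightarrow> 'a" assume "\<forall>n. h n \<in> UNIV - {0}" and h0: "h \<longlonglongrightarrow> 0"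
    then have hn: "h n \<noteq> 0" for n by auto
    define q where "q n y = f y * (\<kappa> (x - y + h n) - \<kappa> (x - y) - dd (h n) \<kappa> (x - y)) / norm (h n)" for n y
    have "(\<lambda>n. LINT y|lborel. q n y) \<longlonglongrightarrow> (LINT y|lborel. f y * 0)"
    proof (rule integral_dominated_convergence)
      show "integrable lborel (\<lambda>y. 2 * L * \<bar>f y\<bar>)" using fi by (intro integrable_mult_right integrable_abs)
      show "AE y in lborel. norm (q n y) \<le> 2 * L * \<bar>f y\<bar>" for n
      proof (intro AE_I2)
        fix y
        have "\<bar>\<kappa> (x - y + h n) - \<kappa> (x - y) - dd (h n) \<kappa> (x - y)\<bar> \<le> 2 * L * norm (h n)"
          using L(2)[of "h n" "x - y"] L(3)[of "x - y" "h n"] by linarith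
        then have "\<bar>f y\<bar> * \<bar>\<kappa> (x - y + h n) - \<kappa> (x - y) - dd (h n) \<kappa> (x - y)\<bar> \<le> \<bar>f y\<bar> * (2 * L * norm (h n))"
          by (intro mult_left_mono) auto
        then show "norm (q n y) \<le> 2 * L * \<bar>f y\<bar>"
          using hn[of n] by (simp add: q_def abs_mult pos_divide_le_eq mult_ac)
      qed
      show "AE y in lborel. (\<lambda>n. q n y) \<longlonglongrightarrow> f y * 0"
      proof (intro AE_I2)
        fix y
        have "((\<lambda>h. norm (\<kappa> (x - y + h) - \<kappa> (x - y) - dd h \<kappa> (x - y)) / norm h) \<longlongrightarrow> 0) (at 0)"
          using has_derivative_dd[OF d] unfolding has_derivative_at by blast
        then have "((\<lambda>h. norm (\<kappa> (x - y + h) - \<kappa> (x - y) - dd h \<kappa> (x - y)) / norm h) \<circ> h) \<longlonglongrightarrow> 0"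
          unfolding tendsto_at_iff_sequentially using hn h0 by simp
        then have "(\<lambda>n. norm ((\<kappa> (x - y + h n) - \<kappa> (x - y) - dd (h n) \<kappa> (x - y)) / norm (h n))) \<longlonglongrightarrow> 0"
          by (simp add: o_def)
        then have "(\<lambda>n. (\<kappa> (x - y + h n) - \<kappa> (x - y) - dd (h n) \<kappa> (x - y)) / norm (h n)) \<longlonglongrightarrow> 0"
          by (rule tendsto_norm_zero_cancel)
        then have "(\<lambda>n. f y * ((\<kappa> (x - y + h n) - \<kappa> (x - y) - dd (h n) \<kappa> (x - y)) / norm (h n))) \<longlonglongrightarrow> f y * 0"
          by (rule tendsto_mult_left)
        then show "(\<lambda>n. q n y) \<longlonglongrightarrow> f y * 0" unfolding q_def by simp
      qed
    qed (auto simp: q_def)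
    moreover have "(LINT y|lborel. q n y) = (conv \<kappa> f (x + h n) - conv \<kappa> f x - conv (dd (h n) \<kappa>) f x) / norm (h n)" for n
    proof -
      have "(LINT y|lborel. q n y) = (LINT y|lborel. f y * \<kappa> (x + h n - y) - f y * \<kappa> (x - y) - f y * dd (h n) \<kappa> (x - y)) / norm (h n)"
        unfolding q_def by (subst integral_divide_zero[symmetric]) (simp add: algebra_simps)
      also have "\<dots> = (conv \<kappa> f (x + h n) - conv \<kappa> f x - conv (dd (h n) \<kappa>) f x) / norm (h n)"
        unfolding e using i(1)[of "x + h n"] i by simp
      finally show ?thesis .
    qed
    ultimately have "(\<lambda>n. (conv \<kappa> f (x + h n) - conv \<kappa> f x - conv (dd (h n) \<kappa>) f x) / norm (h n)) \<longlonglongrightarrow> 0" by simp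
    from tendsto_norm[OF this]
    show "((\<lambda>h. norm (conv \<kappa> f (x + h) - conv \<kappa> f x - conv (dd h \<kappa>) f x) / norm h) \<circ> h) \<longlonglongrightarrow> 0"
      by (simp add: o_def)
  qed
  ultimately show ?thesis unfolding has_derivative_at using linear_conv_bounded_linear by blast
qed

lemma smooth_on_dilate:
  fixes f :: "'a::euclidean_space \<Rightarrow> real"
  assumes "smooth_on UNIV f" shows "smooth_on UNIV (\<lambda>x. f (c *\<^sub>R x))"
    and "dd v (\<lambda>x. f (c *\<^sub>R x)) x = c * dd v f (c *\<^sub>R x)"
proof -
  have der: "((\<lambda>x. f (c *\<^sub>R x)) has_derivative (\<lambda>v. c * dd v f (c *\<^sub>R x))) (at x)"
    if "\<And>x. f differentiable at x" for f :: "'a \<Rightarrow> real" and x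
  proof -
    have "((\<lambda>x. f (c *\<^sub>R x)) has_derivative (\<lambda>v. dd (c *\<^sub>R v) f (c *\<^sub>R x))) (at x)"
      by (rule has_derivative_compose[OF _ has_derivative_dd[OF that]]) (auto intro!: derivative_eq_intros)
    then show ?thesis
      using linear_scale[OF has_derivative_linear[OF has_derivative_dd[OF that]]] by simp
  qed
  have "Cn n UNIV (\<lambda>x. f (c *\<^sub>R x))" if "Cn n UNIV f" for n and f :: "'a \<Rightarrow> real"
    using that
  proof (induction n arbitrary: f)
    case (Suc n)
    have d: "f differentiable at x" for x using Suc.prems by simp
    have "Cn n UNIV (\<lambda>x. c * dd v f (c *\<^sub>R x))" for v
      by (rule Cn_mult[OF open_UNIV Cn_const Suc.IH]) (use Suc.prems in simp)
    moreover have "dd v (\<lambda>x. f (c *\<^sub>R x)) = (\<lambda>x. c * dd v f (c *\<^sub>R x))" for v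
      by (intro ext dd_eq[OF der] d)
    ultimately show ?case using der[OF d] by (auto simp: differentiable_def)
  qed simp
  then show "smooth_on UNIV (\<lambda>x. f (c *\<^sub>R x))"
    using assms by (simp add: smooth_on_iff_Cn)
  show "dd v (\<lambda>x. f (c *\<^sub>R x)) x = c * dd v f (c *\<^sub>R x)"
    by (intro dd_eq[OF der] smooth_on_differentiable[OF open_UNIV assms]) simp
qed

definition scl :: "nat \<Rightarrow> ('a::euclidean_space \<Rightarrow> real) \<Rightarrow> 'a \<Rightarrow> real" where
  "scl j \<kappa> x = (2 ^ j) ^ DIM('a) * \<kappa> ((2 ^ j) *\<^sub>R x)"

lemma smooth_on_scl: "smooth_on UNIV \<kappa> \<Longrightarrow> smooth_on UNIV (scl j \<kappa>)"
  unfolding scl_def[abs_def] by (intro smooth_on_cmult smooth_on_dilate open_UNIV)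

lemma dd_scl:
  assumes "smooth_on UNIV \<kappa>" shows "dd v (scl j \<kappa>) = (\<lambda>x. 2 ^ j * scl j (dd v \<kappa>) x)"
proof
  fix x :: 'a
  have "dd v (\<lambda>x. (2 ^ j) ^ DIM('a) * \<kappa> ((2 ^ j) *\<^sub>R x)) x = (2 ^ j) ^ DIM('a) * dd v (\<lambda>x. \<kappa> ((2 ^ j) *\<^sub>R x)) x"
    using dd_scaleR_left[OF smooth_on_differentiable[OF open_UNIV smooth_on_dilate(1)[OF assms, of "2^j"] UNIV_I],
        of v "(2 ^ j) ^ DIM('a)" x] by simp
  then show "dd v (scl j \<kappa>) x = 2 ^ j * scl j (dd v \<kappa>) x"
    unfolding smooth_on_dilate(2)[OF assms] scl_def[abs_def] by simp
qed

lemma scl_support: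
  fixes \<kappa> :: "'a::euclidean_space \<Rightarrow> real"
  assumes "\<And>x. norm x > R \<Longrightarrow> \<kappa> x = 0" "norm x > R" shows "scl j \<kappa> x = 0"
proof -
  have "1 * norm x \<le> 2 ^ j * norm x" by (intro mult_right_mono) auto
  then have "norm ((2 ^ j) *\<^sub>R x) > R" using assms(2) by simp
  then show ?thesis using assms(1) by (simp add: scl_def)
qed

lemma scl_L1:
  fixes \<kappa> :: "'a::euclidean_space \<Rightarrow> real"
  assumes [measurable]: "\<kappa> \<in> borel_measurable borel"
  shows "(LINT x|lborel. \<bar>scl j \<kappa> x\<bar>) = (LINT x|lborel. \<bar>\<kappa> x\<bar>)"
proof -
  have "(LINT x|lborel. \<bar>\<kappa> x\<bar>) = \<bar>2 ^ j\<bar> ^ DIM('a) *\<^sub>R (LINT x|lborel. \<bar>\<kappa> (0 + (2 ^ j) *\<^sub>R x)\<bar>)"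
    by (rule lborel_integral_affine) auto
  then show ?thesis by (simp add: scl_def abs_mult)
qed

lemma ft_scl:
  "\<kappa> \<in> borel_measurable borel \<Longrightarrow> ft (scl j \<kappa>) \<xi> = ft \<kappa> ((1 / 2 ^ j) *\<^sub>R \<xi>)"
  unfolding scl_def[abs_def] by (rule ft_dilate) auto

lemma bbs_smooth: "smooth_on UNIV f \<Longrightarrow> (\<And>x. norm x > R \<Longrightarrow> f x = 0) \<Longrightarrow> bbs f"
  by (rule bbs_continuous[OF smooth_on_continuous])

lemma sup_size_conv_scl:
  fixes \<kappa> :: "'a::euclidean_space \<Rightarrow> real"
  assumes k: "smooth_on UNIV \<kappa>" "\<And>x. norm x > R \<Longrightarrow> \<kappa> x = 0"
    and f: "\<And>j. bbs (f j)" "\<And>j x. \<bar>f j x\<bar> \<le> M"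
  shows "sup_size 0 (\<lambda>j. conv (scl j \<kappa>) (f j))"
proof -
  have "M \<ge> 0" using f(2)[of 0 0] by linarith
  have b: "bbs (scl j \<kappa>)" "bbs \<kappa>" for j
    using bbs_smooth[OF smooth_on_scl[OF k(1)] scl_support[OF k(2)]] bbs_smooth[OF k] by auto
  have "\<bar>conv (scl j \<kappa>) (f j) x\<bar> \<le> (LINT x|lborel. \<bar>\<kappa> x\<bar>) * M" for j x
    using conv_bound[OF bbs_integrable[OF b(1)] f(1) f(2), of j j x] scl_L1[OF bbs_measurable[OF b(2)], of j] by simp
  moreover have "conv (scl j \<kappa>) (f j) \<in> borel_measurable borel" for j
    by (intro conv_measurable bbs_measurable b f)
  ultimately show ?thesis
    using \<open>M \<ge> 0\<close> by (intro sup_sizeI[of _ "(LINT x|lborel. \<bar>\<kappa> x\<bar>) * M"]) auto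
qed

text \<open>Derivatives fall on the kernel, and each brings out 2^j and replaces \<kappa> by a
  derivative of it; hence the kernel is free in the induction. The second factor may vary with j,
  because it will be an iterated remainder.\<close>

lemma symb_conv_scl:
  fixes \<kappa> :: "'a::euclidean_space \<Rightarrow> real"
  assumes "smooth_on UNIV \<kappa>" "\<And>x. norm x > R \<Longrightarrow> \<kappa> x = 0"
    and f: "\<And>j. bbs (f j)" "\<And>j x. \<bar>f j x\<bar> \<le> M"
  shows "symb sup_size n 0 (\<lambda>j. conv (scl j \<kappa>) (f j))"
  using assms(1,2)
proof (induction n arbitrary: \<kappa>)
  case k: 0
  show ?case unfolding symb.simps by (rule sup_size_conv_scl[where R=R and M=M, OF k f])
next
  case (Suc n)
  note k = Suc.prems
  have der: "(conv (scl j \<kappa>) (f j) has_derivative (\<lambda>v. conv (dd v (scl j \<kappa>)) (f j) x)) (at x)" for j x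
    by (rule conv_has_derivative[where R=R, OF smooth_on_scl[OF k(1)] scl_support[OF k(2)] f(1)])
  have e: "dd v (conv (scl j \<kappa>) (f j)) = (\<lambda>x. 2 ^ j * conv (scl j (dd v \<kappa>)) (f j) x)" for v j
    by (intro ext, subst dd_eq[OF der]) (simp add: dd_scl[OF k(1)] conv_def mult.assoc)
  have "symb sup_size n 0 (\<lambda>j. conv (scl j (dd v \<kappa>)) (f j))" for v
  proof (rule Suc.IH)
    show "dd v \<kappa> x = 0" if "norm x > R" for x
      by (rule dd_zero_outside[of "cball 0 R"]) (use k that in auto)
  qed (rule smooth_on_dd[OF open_UNIV k(1)])
  then have "symb sup_size n (1 + 0) (\<lambda>j x. 2 ^ j * conv (scl j (dd v \<kappa>)) (f j) x)" for v
    by (intro symb_sup_mult symb_sup_const[of 1]) (auto simp: powr_realpow)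
  then have s: "symb sup_size n (0 + 1) (\<lambda>j. dd v (conv (scl j \<kappa>) (f j)))" for v
    unfolding e by simp
  have "sup_size 0 (\<lambda>j. conv (scl j \<kappa>) (f j))" by (rule sup_size_conv_scl[where R=R and M=M, OF k f])
  then show ?case unfolding symb.simps using s der by (auto simp: differentiable_def)
qed

lemma L2_size_from_ft:
  fixes F :: "nat \<Rightarrow> 'a::euclidean_space \<Rightarrow> real"
  assumes F: "\<And>j. bbs (F j)" and g: "bbs g" and C: "C \<ge> 0"
    and le: "\<And>j \<xi>. norm (ft (F j) \<xi>) \<le> C * 2 powr (r * real j) * norm (ft g \<xi>)"
  shows "L2_size r F"
proof -
  have "(LINT x|lborel. (F j x)\<^sup>2) \<le> (C\<^sup>2 * (LINT x|lborel. (g x)\<^sup>2)) * (2 powr (r * real j))\<^sup>2" for j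
  proof -
    let ?c = "(C * 2 powr (r * real j))\<^sup>2"
    let ?p = "(2 * pi) ^ DIM('a)"
    have [measurable]: "ft g \<in> borel_measurable borel" by (intro ft_measurable bbs_integrable g)
    have "ennreal (?p * (LINT x|lborel. (F j x)\<^sup>2)) = (\<integral>\<^sup>+\<xi>. ennreal ((norm (ft (F j) \<xi>))\<^sup>2) \<partial>lborel)"
      by (rule plancherel[symmetric]) (rule F)
    also have "\<dots> \<le> (\<integral>\<^sup>+\<xi>. ennreal ?c * ennreal ((norm (ft g \<xi>))\<^sup>2) \<partial>lborel)"
    proof (intro nn_integral_mono)
      fix \<xi>
      show "ennreal ((norm (ft (F j) \<xi>))\<^sup>2) \<le> ennreal ?c * ennreal ((norm (ft g \<xi>))\<^sup>2)"
        using power_mono[OF le[of j \<xi>] norm_ge_zero, of 2]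
        by (simp add: ennreal_mult[symmetric] power_mult_distrib)
    qed
    also have "\<dots> = ennreal ?c * (\<integral>\<^sup>+\<xi>. ennreal ((norm (ft g \<xi>))\<^sup>2) \<partial>lborel)"
      by (rule nn_integral_cmult) measurable
    also have "\<dots> = ennreal (?c * (?p * (LINT x|lborel. (g x)\<^sup>2)))"
      unfolding plancherel[OF g] by (simp add: ennreal_mult)
    finally have "?p * (LINT x|lborel. (F j x)\<^sup>2) \<le> ?c * (?p * (LINT x|lborel. (g x)\<^sup>2))"
      by (subst (asm) ennreal_le_iff) (auto intro!: mult_nonneg_nonneg)
    then have "?p * (LINT x|lborel. (F j x)\<^sup>2) \<le> ?p * (?c * (LINT x|lborel. (g x)\<^sup>2))" by (simp only: mult_ac)
    then have "(LINT x|lborel. (F j x)\<^sup>2) \<le> ?c * (LINT x|lborel. (g x)\<^sup>2)"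
      by (rule mult_left_le_imp_le) simp
    then show ?thesis by (simp add: power_mult_distrib mult_ac)
  qed
  then show ?thesis
    unfolding L2_size_def using F by (intro conjI allI exI[of _ "C\<^sup>2 * (LINT x|lborel. (g x)\<^sup>2)"]) auto
qed

text \<open>By Plancherel, i derivatives in L^2 amount to the weight |\<xi>|^i. Comparing with the
  transform of one fixed g reduces everything to pointwise bounds on multipliers.\<close>

lemma symb_L2_from_ft:
  fixes F :: "nat \<Rightarrow> 'a::euclidean_space \<Rightarrow> real"
  assumes "\<And>j. smooth_on UNIV (F j)" "\<And>j x. norm x > R \<Longrightarrow> F j x = 0" and g: "bbs g"
    and "\<And>i. \<exists>C\<ge>0. \<forall>j \<xi>. norm \<xi> ^ i * norm (ft (F j) \<xi>) \<le> C * 2 powr ((real i + r) * real j) * norm (ft g \<xi>)"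
  shows "symb L2_size n r F"
proof -
  have base: "L2_size r F"
    if s: "\<And>j. smooth_on UNIV (F j)" "\<And>j x. norm x > R \<Longrightarrow> F j x = 0"
    and h: "\<And>i. \<exists>C\<ge>0. \<forall>j \<xi>. norm \<xi> ^ i * norm (ft (F j) \<xi>) \<le> C * 2 powr ((real i + r) * real j) * norm (ft g \<xi>)"
    for F :: "nat \<Rightarrow> 'a \<Rightarrow> real" and r
  proof -
    obtain C where C: "C \<ge> 0" "\<forall>j \<xi>. norm \<xi> ^ 0 * norm (ft (F j) \<xi>) \<le> C * 2 powr ((real 0 + r) * real j) * norm (ft g \<xi>)"
      using h[of 0] by blast
    have "bbs (F j)" for j by (rule bbs_smooth[OF s])
    then show ?thesis using L2_size_from_ft[OF _ g C(1), of F r] C(2) by simp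
  qed
  show ?thesis using assms(1,2,4)
  proof (induction n arbitrary: F r)
    case 0
    show ?case unfolding symb.simps by (rule base[OF 0(1,2)]) (use 0(3) in blast)+
  next
    case (Suc n)
    note s = Suc.prems(1) and R = Suc.prems(2) and h = Suc.prems(3)
    have "symb L2_size n (r + 1) (\<lambda>j. dd v (F j))" for v
    proof (rule Suc.IH)
      show s': "smooth_on UNIV (dd v (F j))" for j by (rule smooth_on_dd[OF open_UNIV s])
      show "dd v (F j) x = 0" if "norm x > R" for j x
        by (rule dd_zero_outside[of "cball 0 R"]) (use R that in auto)
      fix i
      obtain C where C: "C \<ge> 0" "\<forall>j \<xi>. norm \<xi> ^ Suc i * norm (ft (F j) \<xi>) \<le> C * 2 powr ((real (Suc i) + r) * real j) * norm (ft g \<xi>)"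
        using h[of "Suc i"] by blast
      have "norm \<xi> ^ i * norm (ft (dd v (F j)) \<xi>) \<le> (norm v * C) * 2 powr ((real i + (r + 1)) * real j) * norm (ft g \<xi>)" for j \<xi>
      proof -
        have "ft (dd v (F j)) \<xi> = \<i> * of_real (v \<bullet> \<xi>) * ft (F j) \<xi>"
          by (rule ft_dd[where R=R, OF smooth_on_differentiable[OF open_UNIV s UNIV_I] smooth_on_continuous[OF s'] R])
        then have "norm \<xi> ^ i * norm (ft (dd v (F j)) \<xi>) = norm \<xi> ^ i * (\<bar>v \<bullet> \<xi>\<bar> * norm (ft (F j) \<xi>))"
          by (simp add: norm_mult)
        also have "\<dots> \<le> norm \<xi> ^ i * ((norm v * norm \<xi>) * norm (ft (F j) \<xi>))"
          by (intro mult_left_mono mult_right_mono Cauchy_Schwarz_ineq2) auto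
        also have "\<dots> = norm v * (norm \<xi> ^ Suc i * norm (ft (F j) \<xi>))" by simp
        also have "\<dots> \<le> norm v * (C * 2 powr ((real (Suc i) + r) * real j) * norm (ft g \<xi>))"
          using C(2) by (intro mult_left_mono) auto
        finally show ?thesis by (simp add: add_ac mult_ac)
      qed
      then show "\<exists>C\<ge>0. \<forall>j \<xi>. norm \<xi> ^ i * norm (ft (dd v (F j)) \<xi>) \<le> C * 2 powr ((real i + (r + 1)) * real j) * norm (ft g \<xi>)"
        using C(1) by (intro exI[of _ "norm v * C"]) auto
    qed
    moreover have "L2_size r F" by (rule base[OF s R]) (use h in blast)+
    ultimately show ?case unfolding symb.simps using smooth_on_differentiable[OF open_UNIV s] by auto
  qed
qed

section \<open>Mollifiers and their multipliers\<close>

lemma plateau_support: "r > 0 \<Longrightarrow> norm x > norm p + r \<Longrightarrow> plateau p r x = 0"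
  using norm_triangle_ineq2[of x p] by (intro plateau_0) (auto simp: dist_norm norm_minus_commute)

lemma bbs_plateau: "r > 0 \<Longrightarrow> bbs (plateau p r)"
  using bbs_smooth[OF smooth_on_plateau plateau_support] .

lemma plateau_integral_pos:
  assumes r: "r > 0" shows "(LINT x|lborel. plateau (p::'a::euclidean_space) r x) > 0"
proof -
  have "(LINT x|lborel. 1 * indicator (cball p (r/2) :: 'a set) x) \<le> (LINT x|lborel. plateau p r x)"
  proof (rule integral_mono[OF integrable_indicator_cball bbs_integrable[OF bbs_plateau[OF r]]])
    fix x :: 'a
    show "1 * indicator (cball p (r/2)) x \<le> plateau p r x"
      using plateau_1[OF r, of p x] plateau_bounds(1)[of p r x] by (cases "dist p x \<le> r/2") auto
  qed
  moreover have "(LINT x|lborel. 1 * indicator (cball p (r/2) :: 'a set) x) > (0::real)"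
    using content_cball_pos[of "r/2" p] r by simp
  ultimately show ?thesis by linarith
qed

lemma mollifier_exists:
  "\<exists>\<kappa> :: 'a::euclidean_space \<Rightarrow> real. smooth_on UNIV \<kappa> \<and> (\<forall>x. norm x > 1 \<longrightarrow> \<kappa> x = 0) \<and> (LINT x|lborel. \<kappa> x) = 1"
proof -
  let ?p = "plateau (0::'a) 1"
  have pos: "(LINT x|lborel. ?p x) > 0" by (rule plateau_integral_pos) simp
  show ?thesis
  proof (intro exI[of _ "\<lambda>x. (1 / (LINT x|lborel. ?p x)) * ?p x"] conjI allI impI)
    show "smooth_on UNIV (\<lambda>x. (1 / (LINT x|lborel. ?p x)) * ?p x)"
      by (intro smooth_on_cmult smooth_on_plateau open_UNIV)
    show "(LINT x|lborel. (1 / (LINT x|lborel. ?p x)) * ?p x) = 1"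
      using pos by (subst integral_mult_right_zero) simp
  qed (simp add: plateau_support)
qed

locale mollifier =
  fixes \<kappa> :: "'a::euclidean_space \<Rightarrow> real"
  assumes smooth: "smooth_on UNIV \<kappa>" and supp: "\<And>x. norm x > 1 \<Longrightarrow> \<kappa> x = 0"
    and mass: "(LINT x|lborel. \<kappa> x) = 1"
begin

abbreviation "A \<equiv> LINT x|lborel. \<bar>\<kappa> x\<bar>"

lemma bbs_kappa: "bbs \<kappa>" by (rule bbs_smooth[OF smooth supp])

lemma bbs_scl: "bbs (scl j \<kappa>)"
  by (rule bbs_smooth[OF smooth_on_scl[OF smooth] scl_support[OF supp]])

text \<open>\<open>rem j l f = (1 - T\<^sub>j)\<^sup>l f\<close> and \<open>appr N j f = (1 - (1 - T\<^sub>j)\<^sup>N) f\<close>, where \<open>T\<^sub>j\<close> is the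
  convolution with the mollifier at scale \<open>2\<^sup>-\<^sup>j\<close>. The power \<open>N\<close> makes the multiplier vanish to
  order \<open>N\<close> at the origin.\<close>

primrec rem :: "nat \<Rightarrow> nat \<Rightarrow> ('a \<Rightarrow> real) \<Rightarrow> 'a \<Rightarrow> real" where
  "rem j 0 f = f"
| "rem j (Suc l) f = (\<lambda>x. rem j l f x - conv (scl j \<kappa>) (rem j l f) x)"

definition appr :: "nat \<Rightarrow> nat \<Rightarrow> ('a \<Rightarrow> real) \<Rightarrow> 'a \<Rightarrow> real" where
  "appr N j f x = (\<Sum>l<N. conv (scl j \<kappa>) (rem j l f) x)"

lemma bbs_conv_scl: "bbs f \<Longrightarrow> bbs (conv (scl j \<kappa>) f)"
  by (rule bbs_conv[where R=1, OF bbs_integrable[OF bbs_scl] scl_support[OF supp]])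

lemma bbs_rem: "bbs f \<Longrightarrow> bbs (rem j l f)"
  by (induction l) (auto intro: bbs_diff bbs_conv_scl)

lemma appr_eq: "appr N j f x = f x - rem j N f x"
  by (induction N) (auto simp: appr_def)

lemma bbs_appr: "bbs f \<Longrightarrow> bbs (appr N j f)"
  unfolding appr_def[abs_def] by (intro bbs_sum bbs_conv_scl bbs_rem)

lemma support_rem:
  assumes "\<And>x. norm x > R \<Longrightarrow> f x = 0" "norm x > R + real l" shows "rem j l f x = 0"
  using assms(2)
proof (induction l arbitrary: x)
  case (Suc l)
  have "conv (scl j \<kappa>) (rem j l f) x = 0"
    by (rule conv_support[of 1 _ "R + real l"]) (use Suc scl_support[OF supp] in auto)
  then show ?case using Suc by simp
qed (use assms in simp)

lemma support_appr:
  assumes "\<And>x. norm x > R \<Longrightarrow> f x = 0" "norm x > R + real N" shows "appr N j f x = 0"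
  unfolding appr_eq using assms(1)[of x] support_rem[OF assms] assms(2) by simp

lemma rem_bound:
  assumes f: "bbs f" "\<And>x. \<bar>f x\<bar> \<le> M" shows "\<bar>rem j l f x\<bar> \<le> (1 + A) ^ l * M"
proof (induction l arbitrary: x)
  case (Suc l)
  have "\<bar>conv (scl j \<kappa>) (rem j l f) x\<bar> \<le> A * ((1 + A) ^ l * M)"
    using conv_bound[OF bbs_integrable[OF bbs_scl] bbs_rem[OF f(1)] Suc.IH, of j x]
    by (simp add: scl_L1[OF bbs_measurable[OF bbs_kappa]])
  then have "\<bar>rem j (Suc l) f x\<bar> \<le> (1 + A) ^ l * M + A * ((1 + A) ^ l * M)"
    using Suc.IH[of x] by simp
  then show ?case by (simp add: algebra_simps)
qed (use f in simp)

text \<open>The approximation is a sum of N mollifications, applied to remainders that are bounded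
  uniformly in j by \<open>rem_bound\<close>.\<close>

lemma symb_appr:
  assumes f: "bbs f" shows "symb sup_size n 0 (\<lambda>j. appr N j f)"
proof -
  obtain M where M: "\<forall>x. \<bar>f x\<bar> \<le> M" using f unfolding bbs_def by blast
  show ?thesis
  proof (induction N)
    case 0
    show ?case using symb_sup_const[of 0 "\<lambda>_. 0" 0 n] unfolding appr_def[abs_def] by simp
  next
    case (Suc N)
    have e: "(\<lambda>j. appr (Suc N) j f) = (\<lambda>j x. appr N j f x + conv (scl j \<kappa>) (rem j N f) x)"
      by (simp add: appr_def fun_eq_iff)
    show ?case unfolding e
      by (intro symb_sup_add Suc symb_conv_scl[where R=1 and M="(1 + A) ^ N * M"] smooth supp bbs_rem f rem_bound) (use M in auto)
  qed
qed

lemma ft_rem: "bbs f \<Longrightarrow> ft (rem j l f) \<xi> = (1 - ft \<kappa> ((1 / 2 ^ j) *\<^sub>R \<xi>)) ^ l * ft f \<xi>"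
proof (induction l)
  case (Suc l)
  have "ft (rem j (Suc l) f) \<xi> = ft (rem j l f) \<xi> - ft (conv (scl j \<kappa>) (rem j l f)) \<xi>"
    unfolding rem.simps by (intro ft_diff bbs_integrable bbs_rem bbs_conv_scl Suc)
  also have "ft (conv (scl j \<kappa>) (rem j l f)) \<xi> = ft \<kappa> ((1 / 2 ^ j) *\<^sub>R \<xi>) * ft (rem j l f) \<xi>"
    by (subst ft_conv[OF bbs_integrable[OF bbs_scl] bbs_rem[OF Suc.prems]])
      (simp add: ft_scl[OF bbs_measurable[OF bbs_kappa]])
  finally show ?case using Suc by (simp add: algebra_simps)
qed simp

text \<open>The multiplier of \<open>appr\<close> at unit scale. It has the two properties that
  matter: it differs from 1 by a zero of order N at the origin, and it decays rapidly.\<close>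

definition mul :: "nat \<Rightarrow> 'a \<Rightarrow> complex" where
  "mul N z = 1 - (1 - ft \<kappa> z) ^ N"

lemma ft_appr: "bbs f \<Longrightarrow> ft (appr N j f) \<xi> = mul N ((1 / 2 ^ j) *\<^sub>R \<xi>) * ft f \<xi>"
  unfolding appr_eq[abs_def] mul_def
  by (subst ft_diff) (auto intro: bbs_integrable bbs_rem simp: ft_rem algebra_simps)

text \<open>Mass one makes the transform 1 at the origin, and the support in the unit ball bounds |x
  . z| by |z|.\<close>

lemma ft_kappa_near_0: "norm (1 - ft \<kappa> z) \<le> A * norm z"
proof -
  have i: "integrable lborel \<kappa>" by (rule bbs_integrable[OF bbs_kappa])
  have "1 - ft \<kappa> z = (LINT x|lborel. complex_of_real (\<kappa> x) - cis (- (x \<bullet> z)) * complex_of_real (\<kappa> x))"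
    unfolding ft_def using i ft_integrable[OF i, of z] mass
    by (subst Bochner_Integration.integral_diff) auto
  also have "norm \<dots> \<le> (LINT x|lborel. norm (complex_of_real (\<kappa> x) - cis (- (x \<bullet> z)) * complex_of_real (\<kappa> x)))"
    by (rule integral_norm_bound)
  also have "\<dots> \<le> (LINT x|lborel. \<bar>\<kappa> x\<bar> * norm z)"
  proof (intro integral_mono integrable_norm Bochner_Integration.integrable_diff integrable_mult_left integrable_abs i ft_integrable)
    show "integrable lborel (\<lambda>x. complex_of_real (\<kappa> x))" using i by simp
    fix x
    have "norm (complex_of_real (\<kappa> x) - cis (- (x \<bullet> z)) * complex_of_real (\<kappa> x)) = norm (1 - cis (- (x \<bullet> z))) * \<bar>\<kappa> x\<bar>"
      by (metis left_diff_distrib mult_1 norm_mult norm_of_real)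
    also have "\<dots> \<le> norm z * \<bar>\<kappa> x\<bar>"
    proof (cases "norm x > 1")
      case False
      have "norm (1 - cis (- (x \<bullet> z))) \<le> \<bar>x \<bullet> z\<bar>"
        using iexp_approx1[of "- (x \<bullet> z)" 0] by (simp add: cis_conv_exp norm_minus_commute)
      also have "\<dots> \<le> norm x * norm z" by (rule Cauchy_Schwarz_ineq2)
      also have "\<dots> \<le> 1 * norm z" using False by (intro mult_right_mono) auto
      finally show ?thesis by (intro mult_right_mono) auto
    qed (simp add: supp)
    finally show "norm (complex_of_real (\<kappa> x) - cis (- (x \<bullet> z)) * complex_of_real (\<kappa> x)) \<le> \<bar>\<kappa> x\<bar> * norm z"
      by (simp add: mult.commute)
  qed
  also have "\<dots> = A * norm z" by simp
  finally show ?thesis .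
qed

lemma norm_one_minus_ft_kappa: "norm (1 - ft \<kappa> z) \<le> 1 + A"
  using norm_triangle_ineq4[of 1 "ft \<kappa> z"] ft_bound[OF bbs_integrable[OF bbs_kappa], of z] by simp

lemma A_nonneg: "A \<ge> 0" by simp

text \<open>A geometric sum splits off the factor \<open>ft \<kappa> z\<close>, so the rapid decay
  of the transform of \<kappa> is inherited.\<close>

lemma norm_mul_le: "norm (mul N z) \<le> norm (ft \<kappa> z) * (real N * (1 + A) ^ N)"
proof -
  have "mul N z = ft \<kappa> z * (\<Sum>l<N. (1 - ft \<kappa> z) ^ l)"
    unfolding mul_def using one_diff_power_eq[of "1 - ft \<kappa> z" N] by simp
  also have "norm \<dots> \<le> norm (ft \<kappa> z) * (\<Sum>l<N. norm ((1 - ft \<kappa> z) ^ l))"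
    unfolding norm_mult by (intro mult_left_mono norm_sum) auto
  also have "\<dots> \<le> norm (ft \<kappa> z) * (\<Sum>l<N. (1 + A) ^ N)"
  proof (intro mult_left_mono sum_mono)
    fix l assume "l \<in> {..<N}"
    have "norm ((1 - ft \<kappa> z) ^ l) \<le> (1 + A) ^ l"
      unfolding norm_power by (intro power_mono norm_one_minus_ft_kappa) auto
    also have "\<dots> \<le> (1 + A) ^ N" using \<open>l \<in> _\<close> A_nonneg by (intro power_increasing) auto
    finally show "norm ((1 - ft \<kappa> z) ^ l) \<le> (1 + A) ^ N" .
  qed auto
  finally show ?thesis by simp
qed

text \<open>Replacing the weight by the larger homogeneous |\<xi>|^(-lam) makes the expression
  homogeneous, and \<xi> = 2^j z brings out the power of 2. The replacement fails at the origin,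
  which is why m is required to vanish there.\<close>

lemma multiplier_scaled:
  fixes m :: "'a \<Rightarrow> complex"
  assumes C: "\<And>z. z \<noteq> 0 \<Longrightarrow> norm z powr (real i - lam) * norm (m z) \<le> C" and m0: "m 0 = 0" and C0: "C \<ge> 0"
    and lam: "lam \<ge> 0"
  shows "norm \<xi> ^ i * (norm (m ((1 / 2 ^ j) *\<^sub>R \<xi>)) * (1 + (norm \<xi>)\<^sup>2) powr (- lam / 2))
    \<le> C * 2 powr ((real i - lam) * real j)"
proof (cases "\<xi> = 0")
  case True
  then show ?thesis using m0 C0 by simp
next
  case False
  define z where "z = (1 / 2 ^ j) *\<^sub>R \<xi>"
  have z: "z \<noteq> 0" using False by (simp add: z_def)
  have \<xi>: "norm \<xi> = 2 powr real j * norm z" by (simp add: z_def powr_realpow)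
  have "(1 + (norm \<xi>)\<^sup>2) powr (- lam / 2) \<le> ((norm \<xi>)\<^sup>2) powr (- lam / 2)"
    using False lam by (intro powr_mono2') auto
  also have "\<dots> = norm \<xi> powr (- lam)"
    using False powr_powr[of "norm \<xi>" 2 "- lam / 2"] by (simp add: powr_numeral)
  finally have "norm \<xi> ^ i * (norm (m z) * (1 + (norm \<xi>)\<^sup>2) powr (- lam / 2)) \<le> norm \<xi> ^ i * (norm (m z) * norm \<xi> powr (- lam))"
    by (intro mult_left_mono) auto
  also have "\<dots> = norm \<xi> powr (real i - lam) * norm (m z)"
    using False by (simp add: powr_realpow[symmetric] powr_diff powr_minus_divide)
  also have "norm \<xi> powr (real i - lam) = 2 powr ((real i - lam) * real j) * norm z powr (real i - lam)"
    unfolding \<xi> by (subst powr_mult) (auto simp: powr_powr mult.commute)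
  also have "\<dots> * norm (m z) = (norm z powr (real i - lam) * norm (m z)) * 2 powr ((real i - lam) * real j)" by simp
  also have "\<dots> \<le> C * 2 powr ((real i - lam) * real j)" by (intro mult_right_mono C z) auto
  finally show ?thesis unfolding z_def .
qed

lemma ft_kappa_0: "ft \<kappa> 0 = 1"
  using ft_kappa_near_0[of 0] by simp

text \<open>Near the origin the zero of order N \<ge> lam compensates the singular power; away from
  it the power is at most 1 and the multiplier is bounded.\<close>

lemma rem_multiplier_bound:
  assumes lam: "0 \<le> lam" "lam \<le> real N" and that: "z \<noteq> 0"
  shows "norm z powr (real 0 - lam) * norm ((1 - ft \<kappa> z) ^ N) \<le> (1 + A) ^ N"
proof (cases "norm z \<le> 1")
  case True
  have "norm z powr (real 0 - lam) * norm ((1 - ft \<kappa> z) ^ N) \<le> norm z powr (- lam) * ((1 + A) * norm z) ^ N"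
    unfolding norm_power using ft_kappa_near_0[of z]
    by (auto intro!: mult_left_mono power_mono order_trans[OF ft_kappa_near_0] mult_right_mono)
  also have "\<dots> = norm z powr (real N - lam) * (1 + A) ^ N"
    using that by (simp add: power_mult_distrib powr_diff powr_minus_divide powr_realpow)
  also have "\<dots> \<le> 1 * (1 + A) ^ N"
    using True that lam A_nonneg by (intro mult_right_mono powr_le1) auto
  finally show ?thesis by simp
next
  case False
  have "norm z powr (- lam) \<le> norm z powr 0" using False lam by (intro powr_mono) auto
  then have "norm z powr (real 0 - lam) \<le> 1" using that by simp
  then have "norm z powr (real 0 - lam) * norm ((1 - ft \<kappa> z) ^ N) \<le> 1 * (1 + A) ^ N"
    unfolding norm_power by (intro mult_mono power_mono norm_one_minus_ft_kappa) auto
  then show ?thesis by simp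
qed

text \<open>The point z/2 belongs to the next scale. For |z| \<le> 1 both multipliers are within
  O(|z|^N) of 1, and for |z| > 1 their rapid decay absorbs |z|^i.\<close>

lemma diff_multiplier_bound:
  assumes lam: "0 \<le> lam" "lam \<le> real N"
  shows "\<exists>C\<ge>0. \<forall>z. z \<noteq> 0 \<longrightarrow> norm z powr (real i - lam) * norm (mul N ((1/2) *\<^sub>R z) - mul N z) \<le> C"
proof -
  obtain D where D: "D \<ge> 0" "\<forall>z. norm (ft \<kappa> z) * norm z ^ i \<le> D"
    using ft_rapid_decay[where R=1, OF smooth supp] by blast
  define B where "B = real N * (1 + A) ^ N"
  have B0: "B \<ge> 0" unfolding B_def using A_nonneg by simp
  have M: "norm (mul N z) * norm z ^ i \<le> B * D" for z
  proof -
    have "norm (mul N z) * norm z ^ i \<le> (norm (ft \<kappa> z) * B) * norm z ^ i"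
      unfolding B_def by (intro mult_right_mono norm_mul_le) auto
    also have "\<dots> = B * (norm (ft \<kappa> z) * norm z ^ i)" by simp
    also have "\<dots> \<le> B * D" using D B0 by (intro mult_left_mono) auto
    finally show ?thesis .
  qed
  \<comment> \<open>The first summand serves |z| \<le> 1, the others |z| > 1; 2^i comes from
    evaluating the decay at z/2.\<close>
  define C where "C = 2 * (1 + A) ^ N + (2 ^ i * (B * D) + B * D)"
  have C0: "C \<ge> 0" unfolding C_def using A_nonneg B0 D by (intro add_nonneg_nonneg mult_nonneg_nonneg) auto
  have "norm z powr (real i - lam) * norm (mul N ((1/2) *\<^sub>R z) - mul N z) \<le> C" if z: "z \<noteq> 0" for z
  proof (cases "norm z \<le> 1")
    case True
    have p: "norm ((1 - ft \<kappa> y) ^ N) \<le> ((1 + A) * norm z) ^ N" if "norm y \<le> norm z" for y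
    proof -
      have "norm (1 - ft \<kappa> y) \<le> A * norm y" by (rule ft_kappa_near_0)
      also have "\<dots> \<le> (1 + A) * norm z" using that A_nonneg by (intro mult_mono) auto
      finally show ?thesis unfolding norm_power by (intro power_mono) auto
    qed
    have "norm (mul N ((1/2) *\<^sub>R z) - mul N z) = norm ((1 - ft \<kappa> z) ^ N - (1 - ft \<kappa> ((1/2) *\<^sub>R z)) ^ N)"
      unfolding mul_def by simp
    also have "\<dots> \<le> ((1 + A) * norm z) ^ N + ((1 + A) * norm z) ^ N"
      by (intro order_trans[OF norm_triangle_ineq4] add_mono p) auto
    finally have "norm z powr (real i - lam) * norm (mul N ((1/2) *\<^sub>R z) - mul N z) \<le>
        norm z powr (real i - lam) * (2 * ((1 + A) * norm z) ^ N)"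
      by (intro mult_left_mono) auto
    also have "\<dots> = norm z powr (real i + real N - lam) * (2 * (1 + A) ^ N)"
      using z by (simp add: power_mult_distrib powr_diff powr_add powr_realpow)
    also have "\<dots> \<le> 1 * (2 * (1 + A) ^ N)"
      using True z lam A_nonneg by (intro mult_right_mono powr_le1) auto
    also have "\<dots> \<le> C" unfolding C_def using B0 D by simp
    finally show ?thesis .
  next
    case False
    have "norm z powr (real i - lam) \<le> norm z powr real i" using False lam by (intro powr_mono) auto
    then have "norm z powr (real i - lam) \<le> norm z ^ i" using z by (simp add: powr_realpow)
    then have "norm z powr (real i - lam) * norm (mul N ((1/2) *\<^sub>R z) - mul N z) \<le>
        norm z ^ i * (norm (mul N ((1/2) *\<^sub>R z)) + norm (mul N z))"
      by (intro mult_mono norm_triangle_ineq4) auto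
    also have "\<dots> = 2 ^ i * (norm (mul N ((1/2) *\<^sub>R z)) * norm ((1/2) *\<^sub>R z) ^ i) + norm (mul N z) * norm z ^ i"
      by (simp add: algebra_simps power_divide)
    also have "\<dots> \<le> 2 ^ i * (B * D) + B * D" by (intro add_mono mult_left_mono M) auto
    also have "\<dots> \<le> C" unfolding C_def using A_nonneg by simp
    finally show ?thesis .
  qed
  then show ?thesis using C0 by blast
qed

end

text \<open>Functions \<open>k * g\<close>, where the Fourier transform of \<open>k\<close> decays of order \<open>\<lambda>\<close> and \<open>g\<close> is in
  \<open>L\<^sup>2\<close>, are in \<open>H\<^sup>\<lambda>\<^sup>,\<^sup>2\<close>; this is expressed by the quality of their dyadic approximations.\<close>

theorem smooth_approximation:
  fixes k g :: "'a::euclidean_space \<Rightarrow> real"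
  assumes k: "integrable lborel k" "\<And>x. norm x > R \<Longrightarrow> k x = 0" and g: "bbs g" and lam: "lam > 0"
    and decay: "\<And>\<xi>. norm (ft k \<xi>) \<le> D * (1 + (norm \<xi>)\<^sup>2) powr (- lam / 2)"
  shows "\<exists>G. (\<forall>n. symb sup_size n 0 G) \<and> (\<forall>n. symb L2_size n (- lam) (\<lambda>j x. G (Suc j) x - G j x)) \<and>
    L2_size (- lam) (\<lambda>j x. conv k g x - G j x) \<and> (\<forall>j. bbs (G j))"
proof -
  obtain \<kappa> :: "'a \<Rightarrow> real" where "smooth_on UNIV \<kappa>" "\<forall>x. norm x > 1 \<longrightarrow> \<kappa> x = 0" "(LINT x|lborel. \<kappa> x) = 1"
    using mollifier_exists by blast
  then interpret mollifier \<kappa> by unfold_locales auto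
  define f where "f = conv k g"
  \<comment> \<open>Order N \<ge> lam absorbs |z|^(-lam) at the origin; positivity of N makes the
    multiplier of the remainder vanish there, as \<open>multiplier_scaled\<close> demands.\<close>
  define N where "N = nat \<lceil>lam\<rceil> + 1"
  have N: "lam \<le> real N" "N > 0" unfolding N_def by linarith+
  have f: "bbs f" unfolding f_def by (rule bbs_conv[OF k g])
  obtain C T where T: "\<forall>x. norm x > T \<longrightarrow> f x = 0" using bbsD[OF f] by blast
  have D0: "D \<ge> 0"
  proof -
    have "0 \<le> D * (1 + (norm (0::'a))\<^sup>2) powr (- lam / 2)" using decay[of 0] norm_ge_zero order_trans by blast
    then show ?thesis by simp
  qed
  have ftf: "norm (ft f \<xi>) \<le> D * (1 + (norm \<xi>)\<^sup>2) powr (- lam / 2) * norm (ft g \<xi>)" for \<xi>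
    unfolding f_def ft_conv[OF k(1) g] norm_mult by (intro mult_right_mono decay) auto
  \<comment> \<open>A bound for the multiplier m at unit scale becomes, at scale j, a bound relative
    to the transform of g. It is used for successive differences and for the remainder.\<close>
  have mult: "norm \<xi> ^ i * norm (m ((1 / 2 ^ j) *\<^sub>R \<xi>) * ft f \<xi>) \<le> (C * D) * 2 powr ((real i + (- lam)) * real j) * norm (ft g \<xi>)"
    if C: "C \<ge> 0" "\<And>z. z \<noteq> 0 \<Longrightarrow> norm z powr (real i - lam) * norm (m z) \<le> C" and m0: "m 0 = 0"
    for C m i j and \<xi> :: 'a
  proof -
    have "norm \<xi> ^ i * norm (m ((1 / 2 ^ j) *\<^sub>R \<xi>) * ft f \<xi>) \<le>
      norm \<xi> ^ i * (norm (m ((1 / 2 ^ j) *\<^sub>R \<xi>)) * (D * (1 + (norm \<xi>)\<^sup>2) powr (- lam / 2) * norm (ft g \<xi>)))"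
      unfolding norm_mult by (intro mult_left_mono ftf) auto
    also have "\<dots> = (norm \<xi> ^ i * (norm (m ((1 / 2 ^ j) *\<^sub>R \<xi>)) * (1 + (norm \<xi>)\<^sup>2) powr (- lam / 2))) * (D * norm (ft g \<xi>))"
      by simp
    also have "\<dots> \<le> (C * 2 powr ((real i - lam) * real j)) * (D * norm (ft g \<xi>))"
      by (intro mult_right_mono multiplier_scaled C m0) (use lam D0 in auto)
    finally show ?thesis by (simp add: mult_ac)
  qed
  let ?G = "\<lambda>j. appr N j f"
  have s: "symb sup_size n 0 ?G" for n by (rule symb_appr[OF f])
  have sm: "smooth_on UNIV (?G j)" for j by (rule symb_smooth[OF s])
  have "symb L2_size n (- lam) (\<lambda>j x. ?G (Suc j) x - ?G j x)" for n
  proof (rule symb_L2_from_ft[OF _ _ g])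
    fix j
    have "smooth_on UNIV (\<lambda>x. ?G (Suc j) x + (-1) * ?G j x)"
      by (intro smooth_on_add smooth_on_cmult sm open_UNIV)
    then show "smooth_on UNIV (\<lambda>x. ?G (Suc j) x - ?G j x)" by simp
    show "?G (Suc j) x - ?G j x = 0" if "norm x > T + real N" for x
      using support_appr[where R=T and f=f and x=x and N=N] T that by simp
  next
    fix i
    obtain C where C: "C \<ge> 0" "\<forall>z. z \<noteq> 0 \<longrightarrow> norm z powr (real i - lam) * norm (mul N ((1/2) *\<^sub>R z) - mul N z) \<le> C"
      using diff_multiplier_bound[of lam N i] lam N by auto
    have "norm \<xi> ^ i * norm (ft (\<lambda>x. ?G (Suc j) x - ?G j x) \<xi>) \<le> (C * D) * 2 powr ((real i + (- lam)) * real j) * norm (ft g \<xi>)" for j \<xi>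
    proof -
      have "ft (\<lambda>x. ?G (Suc j) x - ?G j x) \<xi> = mul N ((1 / 2 ^ Suc j) *\<^sub>R \<xi>) * ft f \<xi> - mul N ((1 / 2 ^ j) *\<^sub>R \<xi>) * ft f \<xi>"
        by (subst ft_diff) (auto intro: bbs_integrable bbs_appr f simp: ft_appr[OF f])
      also have "\<dots> = (mul N ((1/2) *\<^sub>R ((1 / 2 ^ j) *\<^sub>R \<xi>)) - mul N ((1 / 2 ^ j) *\<^sub>R \<xi>)) * ft f \<xi>"
        by (simp add: left_diff_distrib)
      finally show ?thesis using mult[of C i "\<lambda>z. mul N ((1/2) *\<^sub>R z) - mul N z" \<xi> j] C by simp
    qed
    then show "\<exists>C\<ge>0. \<forall>j \<xi>. norm \<xi> ^ i * norm (ft (\<lambda>x. ?G (Suc j) x - ?G j x) \<xi>) \<le> C * 2 powr ((real i + (- lam)) * real j) * norm (ft g \<xi>)"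
      using C(1) D0 by (intro exI[of _ "C * D"]) auto
  qed
  moreover have "L2_size (- lam) (\<lambda>j x. f x - ?G j x)"
  proof -
    have e: "(\<lambda>x. f x - ?G j x) = rem j N f" for j by (simp add: appr_eq fun_eq_iff)
    have "norm (ft (rem j N f) \<xi>) \<le> ((1 + A) ^ N * D) * 2 powr ((- lam) * real j) * norm (ft g \<xi>)" for j \<xi>
      using mult[of "(1 + A) ^ N" 0 "\<lambda>z. (1 - ft \<kappa> z) ^ N" \<xi> j] rem_multiplier_bound[of lam N] lam N A_nonneg
      by (simp add: ft_rem[OF f] ft_kappa_0)
    then show ?thesis unfolding e
      by (intro L2_size_from_ft[OF bbs_rem[OF f] g, of "(1 + A) ^ N * D"]) (use A_nonneg D0 in auto)
  qed
  ultimately show ?thesis using s bbs_appr[OF f] unfolding f_def by blast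
qed

section \<open>Integration along parallel lines\<close>

abbreviation line_point :: "real \<Rightarrow> real \<Rightarrow> real \<Rightarrow> real^2" where
  "line_point \<theta> s t \<equiv> s *\<^sub>R unit_vec \<theta> + t *\<^sub>R line_dir \<theta>"

lemma inner_unit_vec_line_dir:
  "unit_vec \<theta> \<bullet> unit_vec \<theta> = 1" "line_dir \<theta> \<bullet> line_dir \<theta> = 1" "unit_vec \<theta> \<bullet> line_dir \<theta> = 0"
  "line_dir \<theta> \<bullet> unit_vec \<theta> = 0"
  by (simp_all add: unit_vec_def line_dir_def inner_vec_def sum_2 flip: power2_eq_square)

lemma inner_line_point:
  "line_point \<theta> s t \<bullet> unit_vec \<theta> = s" "line_point \<theta> s t \<bullet> line_dir \<theta> = t"
  "line_point \<theta> s t \<bullet> line_point \<theta> s' t' = s * s' + t * t'"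
  by (simp_all add: inner_add_left inner_add_right inner_unit_vec_line_dir)

lemma norm_line_point: "\<bar>s\<bar> \<le> norm (line_point \<theta> s t)" "\<bar>t\<bar> \<le> norm (line_point \<theta> s t)"
proof -
  have n: "norm (unit_vec \<theta>) = 1" "norm (line_dir \<theta>) = 1"
    by (simp_all add: norm_eq_sqrt_inner inner_unit_vec_line_dir)
  show "\<bar>s\<bar> \<le> norm (line_point \<theta> s t)" "\<bar>t\<bar> \<le> norm (line_point \<theta> s t)"
    using Cauchy_Schwarz_ineq2[of "line_point \<theta> s t" "unit_vec \<theta>"] Cauchy_Schwarz_ineq2[of "line_point \<theta> s t" "line_dir \<theta>"]
    unfolding inner_line_point n by simp_all
qed

lemma Basis_real2: "(Basis :: (real^2) set) = {axis 1 1, axis 2 1}"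
  by (auto simp: Basis_vec_def UNIV_2)

lemma axis_neq: "(axis 1 1 :: real^2) \<noteq> axis 2 1"
  by (simp add: axis_eq_axis)

lemma lborel_pair_real2: "distr (lborel :: (real \<times> real) measure) borel (\<lambda>(s, t). vector [s, t] :: real^2) = lborel"
proof (rule lborel_eqI[symmetric])
  have c: "continuous_on UNIV (\<lambda>(s, t). vector [s, t] :: real^2)"
  proof -
    have "(\<lambda>(s, t). vector [s, t] :: real^2) = (\<lambda>p. fst p *\<^sub>R axis 1 1 + snd p *\<^sub>R axis 2 1)"
      by (auto simp: vec_eq_iff forall_2 axis_def)
    then show ?thesis by (auto intro!: continuous_intros)
  qed
  then have [measurable]: "(\<lambda>(s, t). vector [s, t] :: real^2) \<in> borel_measurable borel"
    by (rule borel_measurable_continuous_onI)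
  fix l u :: "real^2" assume lu: "\<And>b. b \<in> Basis \<Longrightarrow> l \<bullet> b \<le> u \<bullet> b"
  then have lu': "l $ 1 \<le> u $ 1" "l $ 2 \<le> u $ 2"
    using lu[of "axis 1 1"] lu[of "axis 2 1"] by (auto simp: Basis_real2 inner_axis)
  have pre: "(\<lambda>(s, t). vector [s, t] :: real^2) -` box l u = {l$1<..<u$1} \<times> {l$2<..<u$2}"
    by (auto simp: box_def Basis_real2 inner_axis)
  have "emeasure (distr lborel borel (\<lambda>(s, t). vector [s, t] :: real^2)) (box l u) =
      emeasure (lborel :: (real \<times> real) measure) ({l$1<..<u$1} \<times> {l$2<..<u$2})"
    by (subst emeasure_distr) (auto simp: pre)
  also have "\<dots> = emeasure lborel {l$1<..<u$1} * emeasure lborel {l$2<..<u$2}"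
    unfolding lborel_prod[symmetric] by (rule lborel.emeasure_pair_measure_Times) auto
  also have "\<dots> = ennreal (\<Prod>b\<in>Basis. (u - l) \<bullet> b)"
    using lu' by (simp add: Basis_real2 axis_neq inner_axis inner_diff_left ennreal_mult)
  finally show "emeasure (distr lborel borel (\<lambda>(s, t). vector [s, t] :: real^2)) (box l u) = ennreal (\<Prod>b\<in>Basis. (u - l) \<bullet> b)" .
qed simp

lemma lborel_distr_orthogonal:
  fixes Q :: "real^2 \<Rightarrow> real^2"
  assumes Q: "orthogonal_transformation Q" shows "distr lborel borel Q = lborel"
proof (rule lborel_eqI[symmetric])
  have [measurable]: "Q \<in> borel_measurable borel"
    using Q by (intro borel_measurable_continuous_onI linear_continuous_on)
      (simp add: orthogonal_transformation_linear linear_conv_bounded_linear[symmetric])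
  fix l u :: "real^2" assume lu: "\<And>b. b \<in> Basis \<Longrightarrow> l \<bullet> b \<le> u \<bullet> b"
  have bij: "bij Q" by (rule orthogonal_transformation_bij[OF Q])
  have pre: "Q -` box l u = inv Q ` box l u" by (rule bij_vimage_eq_inv_image[OF bij])
  have m: "Q -` box l u \<in> sets borel" using measurable_sets[of Q borel borel "box l u"] by simp
  have lm: "box l u \<in> lmeasurable" by simp
  have "inv Q ` box l u \<in> lmeasurable"
    by (rule measurable_orthogonal_image[OF orthogonal_transformation_inv[OF Q] lm])
  then have fin: "emeasure lebesgue (inv Q ` box l u) = ennreal (measure lebesgue (inv Q ` box l u))"
    by (intro emeasure_eq_ennreal_measure fmeasurableD2)
  have "emeasure (distr lborel borel Q) (box l u) = emeasure lborel (Q -` box l u)"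
    by (subst emeasure_distr) auto
  also have "\<dots> = emeasure lebesgue (inv Q ` box l u)"
    using m unfolding pre by simp
  also have "\<dots> = ennreal (measure lebesgue (box l u))"
    unfolding fin measure_orthogonal_image[OF orthogonal_transformation_inv[OF Q] lm] ..
  also have "\<dots> = ennreal (\<Prod>b\<in>Basis. (u - l) \<bullet> b)"
    using lu by (simp add: measure_lborel_box_eq)
  finally show "emeasure (distr lborel borel Q) (box l u) = ennreal (\<Prod>b\<in>Basis. (u - l) \<bullet> b)" .
qed simp

lemma continuous_line_point: "continuous_on UNIV (\<lambda>(s, t). line_point \<theta> s t)"
  unfolding case_prod_beta by (intro continuous_intros)

lemma measurable_line_point [measurable]: "(\<lambda>(s, t). line_point \<theta> s t) \<in> borel_measurable borel"
  by (rule borel_measurable_continuous_onI[OF continuous_line_point])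

text \<open>The coordinates (s, t) are the identification of pairs with vectors followed by an
  orthogonal map, and both preserve Lebesgue measure.\<close>

lemma lborel_distr_line_point: "distr (lborel :: (real \<times> real) measure) borel (\<lambda>(s, t). line_point \<theta> s t) = lborel"
proof -
  define Q :: "real^2 \<Rightarrow> real^2" where "Q y = line_point \<theta> (y $ 1) (y $ 2)" for y
  have "linear Q" unfolding Q_def by (intro linearI) (auto simp: algebra_simps)
  moreover have "Q x \<bullet> Q y = x \<bullet> y" for x y
    unfolding Q_def inner_line_point(3) by (simp add: inner_vec_def sum_2)
  ultimately have Q: "orthogonal_transformation Q" by (simp add: orthogonal_transformation_def)
  have [measurable]: "Q \<in> borel_measurable borel"
    unfolding Q_def by (intro borel_measurable_continuous_onI continuous_intros)
  have [measurable]: "(\<lambda>(s, t). vector [s, t] :: real^2) \<in> borel_measurable borel"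
  proof -
    have "(\<lambda>(s, t). vector [s, t] :: real^2) = (\<lambda>p. fst p *\<^sub>R axis 1 1 + snd p *\<^sub>R axis 2 1)"
      by (auto simp: vec_eq_iff forall_2 axis_def)
    then show ?thesis by (auto intro!: borel_measurable_continuous_onI continuous_intros)
  qed
  have "lborel = distr (distr lborel borel (\<lambda>(s, t). vector [s, t])) borel Q"
    unfolding lborel_pair_real2 lborel_distr_orthogonal[OF Q] ..
  also have "\<dots> = distr lborel borel (Q \<circ> (\<lambda>(s, t). vector [s, t]))"
    by (rule distr_distr) auto
  also have "Q \<circ> (\<lambda>(s, t). vector [s, t]) = (\<lambda>(s, t). line_point \<theta> s t)"
    by (auto simp: Q_def fun_eq_iff)
  finally show ?thesis by simp
qed

lemma integral_line_fubini:
  fixes F :: "real^2 \<Rightarrow> 'b::{banach,second_countable_topology}"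
  assumes F: "integrable lborel F"
  shows "(LINT x|lborel. F x) = (LINT s|lborel. LINT t|lborel. F (line_point \<theta> s t))"
proof -
  have [measurable]: "F \<in> borel_measurable borel" using F by auto
  have i: "integrable (lborel \<Otimes>\<^sub>M lborel) (\<lambda>(s, t). F (line_point \<theta> s t))"
  proof -
    have "integrable (distr lborel borel (\<lambda>(s, t). line_point \<theta> s t)) F"
      unfolding lborel_distr_line_point by (rule F)
    then have "integrable lborel (\<lambda>p. F ((\<lambda>(s, t). line_point \<theta> s t) p))"
      by (subst (asm) integrable_distr_eq) auto
    then show ?thesis unfolding lborel_prod by (simp add: case_prod_beta')
  qed
  have "(LINT x|lborel. F x) = (LINT x|distr lborel borel (\<lambda>(s, t). line_point \<theta> s t). F x)"
    unfolding lborel_distr_line_point ..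
  also have "\<dots> = (LINT p|lborel. F ((\<lambda>(s, t). line_point \<theta> s t) p))"
    by (rule integral_distr) auto
  also have "\<dots> = (LINT p|(lborel \<Otimes>\<^sub>M lborel). (\<lambda>(s, t). F (line_point \<theta> s t)) p)"
    unfolding lborel_prod by (simp add: case_prod_beta)
  also have "\<dots> = (LINT s|lborel. LINT t|lborel. F (line_point \<theta> s t))"
    using lborel_pair.integral_fst'[OF i] by simp
  finally show ?thesis .
qed

text \<open>The Radon transform of \<open>F\<close> at the fixed angle
  \<open>\<theta>\<close>.\<close>

definition slice :: "real \<Rightarrow> (real^2 \<Rightarrow> real) \<Rightarrow> real \<Rightarrow> real" where
  "slice \<theta> F s = (LINT t|lborel. F (line_point \<theta> s t))"

lemma bbs_line: assumes F: "bbs F" shows "bbs (\<lambda>t. F (line_point \<theta> s t))"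
proof -
  obtain C R where "C \<ge> 0 \<and> R > 0 \<and> (\<forall>x. \<bar>F x\<bar> \<le> C) \<and> (\<forall>x. norm x > R \<longrightarrow> F x = 0)"
    using bbsD[OF F] by blast
  then have C: "\<And>x. \<bar>F x\<bar> \<le> C" "\<And>x. norm x > R \<Longrightarrow> F x = 0" by auto
  have [measurable]: "F \<in> borel_measurable borel" by (rule bbs_measurable[OF F])
  show ?thesis
  proof (rule bbsI[of _ C R])
    show "F (line_point \<theta> s t) = 0" if "norm t > R" for t
      using C(2) norm_line_point(2)[where t=t and \<theta>=\<theta> and s=s] that by simp
  qed (use C in auto)
qed

lemma bbs_slice:
  assumes F: "bbs F" and R: "R \<ge> 0" "\<And>x. norm x > R \<Longrightarrow> F x = 0"
  shows "bbs (slice \<theta> F)" "(slice \<theta> F s)\<^sup>2 \<le> 2 * R * slice \<theta> (\<lambda>x. (F x)\<^sup>2) s"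
    "norm s > R \<Longrightarrow> slice \<theta> F s = 0"
proof -
  obtain C where C: "\<forall>x. \<bar>F x\<bar> \<le> C" using F unfolding bbs_def by blast
  have C0: "C \<ge> 0" using C[rule_format, of 0] by linarith
  have [measurable]: "F \<in> borel_measurable borel" by (rule bbs_measurable[OF F])
  have z: "F (line_point \<theta> s t) = 0" if "\<bar>t\<bar> > R \<or> \<bar>s\<bar> > R" for s t
    using R(2)[of "line_point \<theta> s t"] norm_line_point[where t=t and \<theta>=\<theta> and s=s] that by linarith
  have ind: "integrable lborel (\<lambda>t. c * indicator (cball (0::real) R) t :: real)" for c
    by (rule integrable_indicator_cball)
  have indi: "(LINT t|lborel. c * indicator (cball (0::real) R) t) = c * (2 * R)" for c
    using R(1) by (simp add: cball_eq_atLeastAtMost)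
  have le: "\<bar>F (line_point \<theta> s t)\<bar> \<le> C * indicator (cball (0::real) R) t" for s t
    using z[of t s] C by (cases "\<bar>t\<bar> > R") auto
  show s0: "norm s > R \<Longrightarrow> slice \<theta> F s = 0" for s
    unfolding slice_def using z by simp
  show "bbs (slice \<theta> F)"
  proof (rule bbsI[of _ "C * (2 * R)" R])
    show "slice \<theta> F \<in> borel_measurable borel"
      unfolding slice_def[abs_def] by measurable
    show "\<bar>slice \<theta> F s\<bar> \<le> C * (2 * R)" for s
    proof -
      have "\<bar>slice \<theta> F s\<bar> \<le> (LINT t|lborel. \<bar>F (line_point \<theta> s t)\<bar>)"
        unfolding slice_def by (rule integral_abs_bound)
      also have "\<dots> \<le> (LINT t|lborel. C * indicator (cball (0::real) R) t)"
      proof (rule integral_mono)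
        show "integrable lborel (\<lambda>t. \<bar>F (line_point \<theta> s t)\<bar>)"
          by (intro integrable_abs bbs_integrable bbs_line F)
        show "integrable lborel (\<lambda>t. C * indicator (cball (0::real) R) t)" by (rule ind)
        show "\<bar>F (line_point \<theta> s t)\<bar> \<le> C * indicator (cball (0::real) R) t" for t by (rule le)
      qed
      finally show ?thesis unfolding indi .
    qed
  qed (use s0 in auto)
  show "(slice \<theta> F s)\<^sup>2 \<le> 2 * R * slice \<theta> (\<lambda>x. (F x)\<^sup>2) s"
  proof (cases "R = 0")
    case True
    have "AE t in lborel. F (line_point \<theta> s t) = 0"
    proof -
      have "AE t in lborel. t \<noteq> (0::real)" by (rule AE_lborel_singleton)
      then show ?thesis using z True by (auto elim!: eventually_mono)
    qed
    then have "slice \<theta> F s = 0"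
      unfolding slice_def by (rule integral_eq_zero_AE)
    then show ?thesis using True by simp
  next
    case False
    \<comment> \<open>The mean of F over the segment |t| \<le> R that carries it; expanding the
      square of F minus this mean gives the Cauchy-Schwarz inequality.\<close>
    define a where "a = slice \<theta> F s / (2 * R)"
    have i: "integrable lborel (\<lambda>t. F (line_point \<theta> s t))" "integrable lborel (\<lambda>t. (F (line_point \<theta> s t))\<^sup>2)"
      by (intro bbs_integrable bbs_power2 bbs_line F)+
    have "0 \<le> (LINT t|lborel. (F (line_point \<theta> s t) - a * indicator (cball (0::real) R) t)\<^sup>2)" by simp
    also have "\<dots> = (LINT t|lborel. ((F (line_point \<theta> s t))\<^sup>2 - 2 * a * F (line_point \<theta> s t)) + a\<^sup>2 * indicator (cball (0::real) R) t)"
    proof (intro Bochner_Integration.integral_cong refl)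
      fix t show "(F (line_point \<theta> s t) - a * indicator (cball (0::real) R) t)\<^sup>2 = ((F (line_point \<theta> s t))\<^sup>2 - 2 * a * F (line_point \<theta> s t)) + a\<^sup>2 * indicator (cball (0::real) R) t"
        using z[of t s] by (cases "\<bar>t\<bar> > R") (auto simp: power2_diff)
    qed
    also have "\<dots> = (slice \<theta> (\<lambda>x. (F x)\<^sup>2) s - 2 * a * slice \<theta> F s) + a\<^sup>2 * (2 * R)"
    proof -
      have 1: "integrable lborel (\<lambda>t. 2 * a * F (line_point \<theta> s t))" by (intro integrable_mult_right i)
      have 2: "integrable lborel (\<lambda>t. (F (line_point \<theta> s t))\<^sup>2 - 2 * a * F (line_point \<theta> s t))"
        by (intro Bochner_Integration.integrable_diff i 1)
      show ?thesis
        unfolding Bochner_Integration.integral_add[OF 2 ind] Bochner_Integration.integral_diff[OF i(2) 1] indi slice_def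
        by (simp only: integral_mult_right_zero)
    qed
    also have "\<dots> = slice \<theta> (\<lambda>x. (F x)\<^sup>2) s - (slice \<theta> F s)\<^sup>2 / (2 * R)"
      using False unfolding a_def by (simp add: power2_eq_square field_simps)
    finally show ?thesis using False R(1) by (simp add: field_simps)
  qed
qed

text \<open>The Fourier slice theorem: on the line with offset s the phase is the constant
  s\<sigma>, so integrating in t first leaves a transform in s.\<close>

lemma ft_slice:
  assumes F: "bbs F"
  shows "ft (slice \<theta> F) \<sigma> = ft F (\<sigma> *\<^sub>R unit_vec \<theta>)"
proof -
  have "ft F (\<sigma> *\<^sub>R unit_vec \<theta>) = (LINT s|lborel. LINT t|lborel. cis (- (line_point \<theta> s t \<bullet> (\<sigma> *\<^sub>R unit_vec \<theta>))) * complex_of_real (F (line_point \<theta> s t)))"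
    unfolding ft_def by (rule integral_line_fubini) (intro ft_integrable bbs_integrable F)
  also have "\<dots> = (LINT s|lborel. LINT t|lborel. cis (- (s * \<sigma>)) * complex_of_real (F (line_point \<theta> s t)))"
    by (simp add: inner_line_point mult.commute del: inner_add_left)
  also have "\<dots> = ft (slice \<theta> F) \<sigma>"
    unfolding ft_def slice_def by (simp add: integral_complex_of_real)
  finally show ?thesis by simp
qed

text \<open>One-dimensional Plancherel for the slice contributes 2 pi, and Cauchy-Schwarz on
  segments of length 2R contributes 2R. Bounded support is what permits restricting the transform to
  a line of frequencies without loss of derivatives.\<close>

theorem line_bessel:
  assumes F: "bbs F" and R: "R \<ge> 0" "\<And>x. norm x > R \<Longrightarrow> F x = 0"
  shows "(\<integral>\<^sup>+\<sigma>. ennreal ((norm (ft F (\<sigma> *\<^sub>R unit_vec \<theta>)))\<^sup>2) \<partial>lborel) \<le> ennreal (4 * pi * R * (LINT x|lborel. (F x)\<^sup>2))"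
proof -
  have b2: "bbs (\<lambda>x. (F x)\<^sup>2)" by (rule bbs_power2[OF F])
  have "(\<integral>\<^sup>+\<sigma>. ennreal ((norm (ft F (\<sigma> *\<^sub>R unit_vec \<theta>)))\<^sup>2) \<partial>lborel) = ennreal ((2 * pi) ^ DIM(real) * (LINT s|lborel. (slice \<theta> F s)\<^sup>2))"
    unfolding ft_slice[OF F, symmetric] by (rule plancherel) (rule bbs_slice[OF F R])
  also have "(LINT s|lborel. (slice \<theta> F s)\<^sup>2) \<le> (LINT s|lborel. 2 * R * slice \<theta> (\<lambda>x. (F x)\<^sup>2) s)"
    by (intro integral_mono integrable_mult_right bbs_integrable bbs_power2 bbs_slice[where R=R] b2 F) (use R in auto)
  also have "\<dots> = 2 * R * (LINT x|lborel. (F x)\<^sup>2)"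
    unfolding integral_line_fubini[OF bbs_integrable[OF b2], of \<theta>] slice_def by simp
  finally show ?thesis by (simp add: ennreal_leI mult_ac)
qed

section \<open>Integration by parts over a domain\<close>

lemma smooth_on_id_real: "smooth_on UNIV (\<lambda>x::real. x)"
  using smooth_on_inner[of "1::real"] by simp

lemma smooth_on_step_real: "smooth_on UNIV (step :: real \<Rightarrow> real)"
  using smooth_on_step[OF open_UNIV smooth_on_id_real] by simp

text \<open>The last equation says that \<open>v + q w\<close> is tangent to the level sets of \<open>\<rho>\<close>.\<close>

definition adapted :: "'a::euclidean_space set \<Rightarrow> 'a \<Rightarrow> 'a \<Rightarrow> ('a \<Rightarrow> real) \<Rightarrow> 'a set \<Rightarrow> bool" where
  "adapted \<Omega> v w q K \<longleftrightarrow> closed K \<and> smooth_on UNIV q \<and> (\<exists>R. \<forall>x. norm x > R \<longrightarrow> q x = 0) \<and>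
     (\<exists>\<rho>. smooth_on UNIV \<rho> \<and> (\<forall>x\<in>K. (x \<in> \<Omega> \<longleftrightarrow> \<rho> x \<le> 0) \<and> dd v \<rho> x + q x * dd w \<rho> x = 0))"

text \<open>The divergence of the vector field X (v + q w), that is, minus the transpose of
  differentiation along v + q w.\<close>

definition transport :: "'a::euclidean_space \<Rightarrow> 'a \<Rightarrow> ('a \<Rightarrow> real) \<Rightarrow> ('a \<Rightarrow> real) \<Rightarrow> 'a \<Rightarrow> real" where
  "transport v w q X = (\<lambda>x. dd v X x + dd w (\<lambda>x. q x * X x) x)"

lemma smooth_transport:
  "smooth_on UNIV q \<Longrightarrow> smooth_on UNIV X \<Longrightarrow> smooth_on UNIV (transport v w q X)"
  unfolding transport_def by (intro smooth_on_add smooth_on_dd smooth_on_mult open_UNIV)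

lemma transport_outside:
  assumes "closed K" "\<And>x. x \<notin> K \<Longrightarrow> X x = 0" "x \<notin> K" shows "transport v w q X x = 0"
  unfolding transport_def using assms dd_zero_outside[of K X x] dd_zero_outside[of K "\<lambda>x. q x * X x" x] by simp

text \<open>Replace the indicator of \<open>\<Omega>\<close> by smooth functions of \<open>\<rho>\<close>, which are annihilated by the
  tangential field; no boundary terms appear.\<close>

lemma ft_transport:
  fixes X :: "'a::euclidean_space \<Rightarrow> real"
  assumes ad: "adapted \<Omega> v w q K" and \<Omega>: "\<Omega> \<in> sets borel"
    and X: "smooth_on UNIV X" "\<And>x. x \<notin> K \<Longrightarrow> X x = 0" and R: "K \<subseteq> cball 0 R"
    and vw: "v \<bullet> v = 1" "w \<bullet> v = 0"
  shows "ft (\<lambda>x. indicator \<Omega> x * transport v w q X x) (\<sigma> *\<^sub>R v) = \<i> * of_real \<sigma> * ft (\<lambda>x. indicator \<Omega> x * X x) (\<sigma> *\<^sub>R v)"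
proof -
  obtain \<rho> where K: "closed K" and q: "smooth_on UNIV q" and \<rho>: "smooth_on UNIV \<rho>"
    and \<rho>\<Omega>: "\<And>x. x \<in> K \<Longrightarrow> x \<in> \<Omega> \<longleftrightarrow> \<rho> x \<le> 0" and tan: "\<And>x. x \<in> K \<Longrightarrow> dd v \<rho> x + q x * dd w \<rho> x = 0"
    using ad unfolding adapted_def by blast
  note df = smooth_on_differentiable[OF open_UNIV _ UNIV_I]
  \<comment> \<open>On \<open>K\<close> these tend to the indicator of \<Omega> at every point,
    boundary included, since S n is exactly 1 where \<rho> \<le> 0 and eventually 0 where \<rho> >
    0.\<close>
  define S where "S n x = 1 - step (real n * \<rho> x)" for n x
  have S: "smooth_on UNIV (S n)" for n
    unfolding S_def[abs_def] by (intro smooth_on_minus_const smooth_on_step smooth_on_cmult \<rho> open_UNIV)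
  have ddS: "dd u (S n) x = - (dd (real n * dd u \<rho> x) step (real n * \<rho> x))" for u n x
  proof -
    have 1: "((\<lambda>x. real n * \<rho> x) has_derivative (\<lambda>u. real n * dd u \<rho> x)) (at x)"
      by (intro has_derivative_mult_right has_derivative_dd df \<rho>)
    have "((\<lambda>x. 1 - step (real n * \<rho> x)) has_derivative (\<lambda>u. 0 - dd (real n * dd u \<rho> x) step (real n * \<rho> x))) (at x)"
      by (intro has_derivative_diff has_derivative_const has_derivative_compose[OF 1] has_derivative_dd df smooth_on_step_real)
    then show ?thesis unfolding S_def[abs_def] by (subst dd_eq) auto
  qed
  have lin: "linear (\<lambda>h. dd h step y)" for y
    using has_derivative_dd[OF df[OF smooth_on_step_real]] has_derivative_linear by blast
  \<comment> \<open>By the chain rule a function of \<rho> is annihilated by every field that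
    annihilates \<rho>.\<close>
  have tanS: "dd v (S n) x + q x * dd w (S n) x = 0" if "x \<in> K" for n x
  proof -
    have "dd v (S n) x + q x * dd w (S n) x = - (dd (real n * dd v \<rho> x + q x * (real n * dd w \<rho> x)) step (real n * \<rho> x))"
      unfolding ddS linear_add[OF lin] using linear_scale[OF lin, of "q x" "real n * dd w \<rho> x" "real n * \<rho> x"] by simp
    also have "real n * dd v \<rho> x + q x * (real n * dd w \<rho> x) = real n * (dd v \<rho> x + q x * dd w \<rho> x)"
      by (simp add: algebra_simps)
    finally show ?thesis using tan[OF that] linear_0[OF lin] by simp
  qed
  have R0: "x \<notin> K" if "norm x > R" for x using R that by auto
  have qX: "smooth_on UNIV (\<lambda>x. q x * X x)" by (intro smooth_on_mult q X open_UNIV)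
  have SX: "smooth_on UNIV (\<lambda>x. S n x * X x)" "smooth_on UNIV (\<lambda>x. S n x * (q x * X x))" for n
    by (intro smooth_on_mult S X qX open_UNIV)+
  have sup: "S n x * X x = 0" "S n x * (q x * X x) = 0" if "norm x > R" for n x
    using X(2)[OF R0[OF that]] by simp_all
  have TX: "smooth_on UNIV (transport v w q X)" by (rule smooth_transport[OF q X(1)])
  have TX0: "transport v w q X x = 0" if "x \<notin> K" for x by (rule transport_outside[OF K X(2) that])
  have bX: "bbs X" "bbs (transport v w q X)"
    using bbs_smooth[OF X(1), of R] bbs_smooth[OF TX, of R] X(2) TX0 R0 by auto
  have Sb: "\<bar>S n x\<bar> \<le> 1" for n x using step_bounds[of "real n * \<rho> x"] by (simp add: S_def)
  have Sm [measurable]: "S n \<in> borel_measurable borel" for n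
    by (intro borel_measurable_continuous_onI smooth_on_continuous S)
  \<comment> \<open>As the field annihilates S n, the factor may be moved inside the divergence. On
    frequencies along v the derivative in direction v becomes i\<sigma>, and that in direction w
    disappears because w is orthogonal to v.\<close>
  have step1: "ft (\<lambda>x. S n x * transport v w q X x) (\<sigma> *\<^sub>R v) = \<i> * of_real \<sigma> * ft (\<lambda>x. S n x * X x) (\<sigma> *\<^sub>R v)" for n
  proof -
    have eq: "S n x * transport v w q X x = dd v (\<lambda>x. S n x * X x) x + dd w (\<lambda>x. S n x * (q x * X x)) x" for x
    proof -
      have "dd v (\<lambda>x. S n x * X x) x + dd w (\<lambda>x. S n x * (q x * X x)) x =
        S n x * transport v w q X x + X x * (dd v (S n) x + q x * dd w (S n) x)"
        unfolding dd_mult[OF df[OF S] df[OF X(1)]] dd_mult[OF df[OF S] df[OF qX]] transport_def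
        by (simp add: algebra_simps)
      then show ?thesis using tanS[of x n] X(2)[of x] by (cases "x \<in> K") auto
    qed
    have i: "integrable lborel (dd v (\<lambda>x. S n x * X x))" "integrable lborel (dd w (\<lambda>x. S n x * (q x * X x)))"
    proof -
      have z: "dd u f x = 0" if "\<And>x. norm x > R \<Longrightarrow> f x = 0" "norm x > R" for u and f :: "'a \<Rightarrow> real" and x
        by (rule dd_zero_outside[of "cball 0 R"]) (use that in auto)
      show "integrable lborel (dd v (\<lambda>x. S n x * X x))" "integrable lborel (dd w (\<lambda>x. S n x * (q x * X x)))"
        by (intro bbs_integrable bbs_smooth[of _ R] smooth_on_dd open_UNIV SX z sup; assumption)+
    qed
    have "ft (\<lambda>x. S n x * transport v w q X x) (\<sigma> *\<^sub>R v) =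
        ft (dd v (\<lambda>x. S n x * X x)) (\<sigma> *\<^sub>R v) + ft (dd w (\<lambda>x. S n x * (q x * X x))) (\<sigma> *\<^sub>R v)"
      unfolding eq by (rule ft_add[OF i])
    also have "ft (dd v (\<lambda>x. S n x * X x)) (\<sigma> *\<^sub>R v) = \<i> * of_real (v \<bullet> (\<sigma> *\<^sub>R v)) * ft (\<lambda>x. S n x * X x) (\<sigma> *\<^sub>R v)"
      by (rule ft_dd[where R=R])
        (intro df SX smooth_on_continuous smooth_on_dd open_UNIV sup; assumption)+
    also have "ft (dd w (\<lambda>x. S n x * (q x * X x))) (\<sigma> *\<^sub>R v) = \<i> * of_real (w \<bullet> (\<sigma> *\<^sub>R v)) * ft (\<lambda>x. S n x * (q x * X x)) (\<sigma> *\<^sub>R v)"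
      by (rule ft_dd[where R=R])
        (intro df SX smooth_on_continuous smooth_on_dd open_UNIV sup; assumption)+
    finally show ?thesis using vw by simp
  qed
  have lim: "(\<lambda>n. ft (\<lambda>x. S n x * Y x) (\<sigma> *\<^sub>R v)) \<longlonglongrightarrow> ft (\<lambda>x. indicator \<Omega> x * Y x) (\<sigma> *\<^sub>R v)"
    if Y: "bbs Y" "\<And>x. x \<notin> K \<Longrightarrow> Y x = 0" for Y
    unfolding ft_def
  proof (rule integral_dominated_convergence[where w="\<lambda>x. \<bar>Y x\<bar>"])
    have [measurable]: "Y \<in> borel_measurable borel" by (rule bbs_measurable[OF Y(1)])
    show "integrable lborel (\<lambda>x. \<bar>Y x\<bar>)" by (intro integrable_abs bbs_integrable Y)
    show "AE x in lborel. norm (cis (- (x \<bullet> (\<sigma> *\<^sub>R v))) * complex_of_real (S n x * Y x)) \<le> \<bar>Y x\<bar>" for n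
      using Sb mult_right_mono[OF Sb abs_ge_zero[of "Y _"]] by (intro AE_I2) (simp add: norm_mult abs_mult)
    show "AE x in lborel. (\<lambda>n. cis (- (x \<bullet> (\<sigma> *\<^sub>R v))) * complex_of_real (S n x * Y x)) \<longlonglongrightarrow>
        cis (- (x \<bullet> (\<sigma> *\<^sub>R v))) * complex_of_real (indicator \<Omega> x * Y x)"
    proof (rule AE_I2, rule tendsto_mult_left, rule tendsto_of_real)
      fix x
      show "(\<lambda>n. S n x * Y x) \<longlonglongrightarrow> indicator \<Omega> x * Y x"
      proof (cases "x \<in> K")
        case True
        have "(\<lambda>n. S n x) \<longlonglongrightarrow> indicator \<Omega> x"
        proof (cases "\<rho> x \<le> 0")
          case le: True
          have "S n x = 1" for n using le unfolding S_def by (simp add: step_0 mult_nonneg_nonpos)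
          then show ?thesis using \<rho>\<Omega>[OF True] le by simp
        next
          case False
          obtain m :: nat where m: "1 / \<rho> x < real m" using reals_Archimedean2 by blast
          have "S n x = 0" if "n \<ge> m" for n
          proof -
            have "1 / \<rho> x \<le> real n" using m that by linarith
            then have "real n * \<rho> x \<ge> 1" using False by (simp add: field_simps)
            then show ?thesis unfolding S_def by (simp add: step_1)
          qed
          then have "\<forall>\<^sub>F n in sequentially. S n x = 0" unfolding eventually_sequentially by blast
          then show ?thesis using \<rho>\<Omega>[OF True] False by (simp add: tendsto_eventually)
        qed
        then show ?thesis by (rule tendsto_mult_right)
      qed (simp add: Y)
    qed
    show "(\<lambda>x. cis (- (x \<bullet> (\<sigma> *\<^sub>R v))) * complex_of_real (indicator \<Omega> x * Y x)) \<in> borel_measurable lborel"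
      using \<Omega> by measurable
    show "(\<lambda>x. cis (- (x \<bullet> (\<sigma> *\<^sub>R v))) * complex_of_real (S n x * Y x)) \<in> borel_measurable lborel" for n
      by measurable
  qed
  have "(\<lambda>n. \<i> * of_real \<sigma> * ft (\<lambda>x. S n x * X x) (\<sigma> *\<^sub>R v)) \<longlonglongrightarrow> \<i> * of_real \<sigma> * ft (\<lambda>x. indicator \<Omega> x * X x) (\<sigma> *\<^sub>R v)"
    by (intro tendsto_mult_left lim bX X)
  moreover have "(\<lambda>n. ft (\<lambda>x. S n x * transport v w q X x) (\<sigma> *\<^sub>R v)) \<longlonglongrightarrow> ft (\<lambda>x. indicator \<Omega> x * transport v w q X x) (\<sigma> *\<^sub>R v)"
    by (intro lim bX TX0)
  ultimately show ?thesis unfolding step1 by (rule LIMSEQ_unique[rotated])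
qed

section \<open>Weighted estimates\<close>

text \<open>A transport is one derivative with fixed coefficients, hence costs one factor
  2^j.\<close>

lemma symb_L2_transport:
  assumes X: "symb L2_size (Suc n) r X" and q: "smooth_on UNIV q" "\<And>x. norm x > R \<Longrightarrow> q x = 0"
  shows "symb L2_size n (r + 1) (\<lambda>j. transport v w q (X j))"
proof -
  have "symb L2_size (Suc n) (0 + r) (\<lambda>j x. q x * X j x)"
    by (rule symb_L2_mult[OF symb_sup_smooth[where R=R, OF q order_refl] X])
  then have 1: "symb L2_size n (r + 1) (\<lambda>j. dd w (\<lambda>x. q x * X j x))" by simp
  have 2: "symb L2_size n (r + 1) (\<lambda>j. dd v (X j))" using X by simp
  show ?thesis unfolding transport_def by (rule symb_L2_add[OF 2 1])
qed

lemma symb_L2_transport_iter: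
  assumes X: "\<And>n. symb L2_size n r X" and q: "smooth_on UNIV q" "\<And>x. norm x > R \<Longrightarrow> q x = 0"
  shows "symb L2_size n (r + real m) (\<lambda>j. (transport v w q ^^ m) (X j))"
proof (induction m arbitrary: n)
  case (Suc m)
  have "symb L2_size n (r + real m + 1) (\<lambda>j. transport v w q ((transport v w q ^^ m) (X j)))"
    by (rule symb_L2_transport[where R=R, OF Suc q])
  then show ?case by (simp add: add_ac)
qed (use X in simp)

text \<open>The support stays in \<open>K\<close> under transport, so \<open>ft_transport\<close>
  can be repeated, gaining a factor i\<sigma> each time.\<close>

lemma transport_iter:
  fixes X :: "'a::euclidean_space \<Rightarrow> real"
  assumes ad: "adapted \<Omega> v w q K" and \<Omega>: "\<Omega> \<in> sets borel"
    and X: "smooth_on UNIV X" "\<And>x. x \<notin> K \<Longrightarrow> X x = 0" and R: "K \<subseteq> cball 0 R"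
    and vw: "v \<bullet> v = 1" "w \<bullet> v = 0"
  shows "smooth_on UNIV ((transport v w q ^^ m) X) \<and> (\<forall>x. x \<notin> K \<longrightarrow> (transport v w q ^^ m) X x = 0) \<and>
    ft (\<lambda>x. indicator \<Omega> x * (transport v w q ^^ m) X x) (\<sigma> *\<^sub>R v) = (\<i> * of_real \<sigma>) ^ m * ft (\<lambda>x. indicator \<Omega> x * X x) (\<sigma> *\<^sub>R v)"
proof (induction m)
  case (Suc m)
  let ?Y = "(transport v w q ^^ m) X"
  have K: "closed K" and q: "smooth_on UNIV q" using ad unfolding adapted_def by auto
  have Y: "smooth_on UNIV ?Y" "\<And>x. x \<notin> K \<Longrightarrow> ?Y x = 0" using Suc by auto
  show ?case
    using smooth_transport[OF q Y(1), of v w] transport_outside[OF K Y(2), where v=v and w=w and q=q]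
      ft_transport[OF ad \<Omega> Y R vw, of \<sigma>] Suc by simp
qed (use X in auto)

lemma bbs_indicator:
  assumes F: "bbs F" and \<Omega>: "\<Omega> \<in> sets borel"
  shows "bbs (\<lambda>x. indicator \<Omega> x * F x)" "(LINT x|lborel. (indicator \<Omega> x * F x)\<^sup>2) \<le> (LINT x|lborel. (F x)\<^sup>2)"
proof -
  show b: "bbs (\<lambda>x. indicator \<Omega> x * F x)"
    by (rule bbs_mult_bounded[OF F, of _ 1]) (use \<Omega> in \<open>auto simp: indicator_def\<close>)
  show "(LINT x|lborel. (indicator \<Omega> x * F x)\<^sup>2) \<le> (LINT x|lborel. (F x)\<^sup>2)"
    by (intro integral_mono bbs_integrable bbs_power2 b F) (auto simp: indicator_def)
qed

lemma bbs_mult_exp: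
  assumes A: "bbs A" and F: "bbs F" shows "bbs (\<lambda>x. A x * exp (- F x))"
proof -
  obtain B where B: "\<And>x. \<bar>F x\<bar> \<le> B" using F unfolding bbs_def by blast
  have "\<bar>exp (- F x)\<bar> \<le> exp B" for x using B[of x] by simp
  then have "bbs (\<lambda>x. exp (- F x) * A x)"
    by (intro bbs_mult_bounded[OF A]) (use bbs_measurable[OF F] in auto)
  then show ?thesis by (simp add: mult.commute)
qed

text \<open>Separates frequencies at |\<sigma>| = 2^j: with y = \<sigma>^2/4^j the weight is at most
  4^(j\<beta>) (1 + y)^\<beta>, and the fractional power of 1 + y is replaced by the integer power
  m, for which integration by parts is available.\<close>

lemma weight_bound:
  fixes \<sigma> \<beta> :: real
  assumes "0 \<le> \<beta>" "\<beta> \<le> real m"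
  shows "(1 + \<sigma>\<^sup>2) powr \<beta> \<le> 2 powr (2 * \<beta> * real j) * 2 ^ m * (1 + 2 powr (- 2 * real m * real j) * (\<sigma> ^ m)\<^sup>2)"
proof -
  define y where "y = \<sigma>\<^sup>2 / 4 ^ j"
  have y: "y \<ge> 0" unfolding y_def by simp
  have 4: "(4::real) ^ j = 2 powr (2 * real j)"
    using powr_powr[of 2 2 "real j"] by (simp add: powr_realpow)
  have "(1::real) \<le> 4 ^ j" by simp
  then have "1 + \<sigma>\<^sup>2 \<le> 4 ^ j * (1 + y)" unfolding y_def distrib_left by simp
  then have "(1 + \<sigma>\<^sup>2) powr \<beta> \<le> (4 ^ j * (1 + y)) powr \<beta>"
    using assms by (intro powr_mono2) auto
  also have "\<dots> = 2 powr (2 * \<beta> * real j) * (1 + y) powr \<beta>"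
    using y unfolding 4 by (subst powr_mult) (auto simp: powr_powr mult_ac)
  also have "\<dots> \<le> 2 powr (2 * \<beta> * real j) * (1 + y) powr real m"
    using y assms by (intro mult_left_mono powr_mono) auto
  also have "(1 + y) powr real m = (1 + y) ^ m" using y by (simp add: powr_realpow)
  also have "(1 + y) ^ m \<le> 2 ^ m * (1 + y ^ m)"
  proof -
    have "(1 + y) ^ m \<le> (2 * max 1 y) ^ m" using y by (intro power_mono) auto
    also have "\<dots> \<le> 2 ^ m * (1 + y ^ m)"
      unfolding power_mult_distrib using y by (intro mult_left_mono) (auto simp: max_def)
    finally show ?thesis .
  qed
  also have "y ^ m = 2 powr (- 2 * real m * real j) * (\<sigma> ^ m)\<^sup>2"
  proof -
    have "(2::real) powr (- 2 * real m * real j) = 1 / (4 ^ j) ^ m"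
      unfolding 4 by (simp add: powr_realpow[symmetric] powr_powr powr_minus_divide[symmetric] mult_ac)
    then show ?thesis unfolding y_def by (simp add: power_divide power_mult[symmetric] mult.commute)
  qed
  finally show ?thesis by (simp add: mult.assoc mult_left_mono)
qed

text \<open>The bounds with no transport and with m transports are interpolated through
  \<open>weight_bound\<close>, each L^2 norm in \<sigma> being controlled by
  \<open>line_bessel\<close>.\<close>

lemma weighted_piece:
  fixes X :: "nat \<Rightarrow> real^2 \<Rightarrow> real"
  assumes ad: "adapted \<Omega> (unit_vec \<theta>) (line_dir \<theta>) q K" and \<Omega>: "\<Omega> \<in> sets borel"
    and R: "K \<subseteq> cball 0 R" "R \<ge> 0"
    and X: "\<And>n. symb L2_size n (- lam) X" "\<And>j x. x \<notin> K \<Longrightarrow> X j x = 0" and \<beta>: "0 \<le> \<beta>"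
  shows "\<exists>C\<ge>0. \<forall>j. (\<integral>\<^sup>+\<sigma>. ennreal ((1 + \<sigma>\<^sup>2) powr \<beta> * (norm (ft (\<lambda>x. indicator \<Omega> x * X j x) (\<sigma> *\<^sub>R unit_vec \<theta>)))\<^sup>2) \<partial>lborel)
    \<le> ennreal (C * 2 powr (2 * (\<beta> - lam) * real j))"
proof -
  \<comment> \<open>Transports can only be iterated a whole number of times.\<close>
  define m where "m = nat \<lceil>\<beta>\<rceil>"
  have m: "\<beta> \<le> real m" unfolding m_def by linarith
  let ?T = "transport (unit_vec \<theta>) (line_dir \<theta>) q"
  define Y where "Y j = (?T ^^ m) (X j)" for j
  have q: "smooth_on UNIV q" using ad unfolding adapted_def by blast
  obtain Rq where Rq: "\<And>x. norm x > Rq \<Longrightarrow> q x = 0" using ad unfolding adapted_def by blast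
  have sX: "smooth_on UNIV (X j)" for j by (rule symb_smooth[OF X(1)])
  have it: "smooth_on UNIV (Y j) \<and> (\<forall>x. x \<notin> K \<longrightarrow> Y j x = 0) \<and>
      ft (\<lambda>x. indicator \<Omega> x * Y j x) (\<sigma> *\<^sub>R unit_vec \<theta>) = (\<i> * of_real \<sigma>) ^ m * ft (\<lambda>x. indicator \<Omega> x * X j x) (\<sigma> *\<^sub>R unit_vec \<theta>)" for j \<sigma>
    unfolding Y_def by (rule transport_iter[OF ad \<Omega> sX X(2) R(1)]) (simp_all add: inner_unit_vec_line_dir)
  have "symb L2_size 0 (- lam + real m) Y"
    unfolding Y_def by (rule symb_L2_transport_iter[where R=Rq, OF X(1) q Rq])
  then have LY: "L2_size (- lam + real m) Y" by simp
  have LX: "L2_size (- lam) X" using X(1)[of 0] by simp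
  obtain C where C: "C \<ge> 0" "\<And>j. (LINT x|lborel. (X j x)\<^sup>2) \<le> C * (2 powr (- lam * real j))\<^sup>2"
    using LX unfolding L2_size_def by blast
  obtain D where D: "D \<ge> 0" "\<And>j. (LINT x|lborel. (Y j x)\<^sup>2) \<le> D * (2 powr ((- lam + real m) * real j))\<^sup>2"
    using LY unfolding L2_size_def by blast
  have b: "bbs (X j)" "bbs (Y j)" for j using LX LY unfolding L2_size_def by auto
  have K0: "x \<notin> K" if "norm x > R" for x using R that by auto
  define U where "U j \<sigma> = (norm (ft (\<lambda>x. indicator \<Omega> x * X j x) (\<sigma> *\<^sub>R unit_vec \<theta>)))\<^sup>2" for j \<sigma>
  define V where "V j \<sigma> = (norm (ft (\<lambda>x. indicator \<Omega> x * Y j x) (\<sigma> *\<^sub>R unit_vec \<theta>)))\<^sup>2" for j \<sigma>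
  have U0: "U j \<sigma> \<ge> 0" "V j \<sigma> \<ge> 0" for j \<sigma> unfolding U_def V_def by auto
  have [measurable]: "U j \<in> borel_measurable borel" "V j \<in> borel_measurable borel" for j
  proof -
    note [measurable] = ft_line_measurable[OF bbs_integrable[OF bbs_indicator(1)[OF b(1) \<Omega>]]] ft_line_measurable[OF bbs_integrable[OF bbs_indicator(1)[OF b(2) \<Omega>]]]
    show "U j \<in> borel_measurable borel" "V j \<in> borel_measurable borel" unfolding U_def V_def by measurable
  qed
  have VU: "V j \<sigma> = (\<sigma> ^ m)\<^sup>2 * U j \<sigma>" for j \<sigma>
    unfolding V_def U_def it[THEN conjunct2, THEN conjunct2] norm_mult norm_power
    by (simp add: norm_mult power_mult_distrib power_abs[symmetric])
  have IU: "(\<integral>\<^sup>+\<sigma>. ennreal (U j \<sigma>) \<partial>lborel) \<le> ennreal (4 * pi * R * (C * (2 powr (- lam * real j))\<^sup>2))" for j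
  proof -
    have "(\<integral>\<^sup>+\<sigma>. ennreal (U j \<sigma>) \<partial>lborel) \<le> ennreal (4 * pi * R * (LINT x|lborel. (indicator \<Omega> x * X j x)\<^sup>2))"
      unfolding U_def by (rule line_bessel[OF bbs_indicator(1)[OF b(1) \<Omega>] R(2)]) (use X(2) K0 in auto)
    also have "\<dots> \<le> ennreal (4 * pi * R * (C * (2 powr (- lam * real j))\<^sup>2))"
      by (intro ennreal_leI mult_left_mono order_trans[OF bbs_indicator(2)[OF b(1) \<Omega>] C(2)]) (use R(2) in auto)
    finally show ?thesis .
  qed
  have IV: "(\<integral>\<^sup>+\<sigma>. ennreal (V j \<sigma>) \<partial>lborel) \<le> ennreal (4 * pi * R * (D * (2 powr ((- lam + real m) * real j))\<^sup>2))" for j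
  proof -
    have "(\<integral>\<^sup>+\<sigma>. ennreal (V j \<sigma>) \<partial>lborel) \<le> ennreal (4 * pi * R * (LINT x|lborel. (indicator \<Omega> x * Y j x)\<^sup>2))"
      unfolding V_def by (rule line_bessel[OF bbs_indicator(1)[OF b(2) \<Omega>] R(2)]) (use it K0 in auto)
    also have "\<dots> \<le> ennreal (4 * pi * R * (D * (2 powr ((- lam + real m) * real j))\<^sup>2))"
      by (intro ennreal_leI mult_left_mono order_trans[OF bbs_indicator(2)[OF b(2) \<Omega>] D(2)]) (use R(2) in auto)
    finally show ?thesis .
  qed
  define E where "E = 2 ^ m * (4 * pi * R) * (C + D)"
  have E0: "E \<ge> 0" unfolding E_def using C D R by simp
  have "(\<integral>\<^sup>+\<sigma>. ennreal ((1 + \<sigma>\<^sup>2) powr \<beta> * U j \<sigma>) \<partial>lborel) \<le> ennreal (E * 2 powr (2 * (\<beta> - lam) * real j))" for j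
  proof -
    \<comment> \<open>In the second term ?b = 2^(-2mj) cancels exactly the growth caused by the m
      transports, so both terms have size 2^(2(\<beta>-\<lambda>)j).\<close>
    let ?a = "2 powr (2 * \<beta> * real j) * 2 ^ m" and ?b = "2 powr (- 2 * real m * real j)"
    have "(\<integral>\<^sup>+\<sigma>. ennreal ((1 + \<sigma>\<^sup>2) powr \<beta> * U j \<sigma>) \<partial>lborel) \<le>
        (\<integral>\<^sup>+\<sigma>. ennreal ?a * (ennreal (U j \<sigma>) + ennreal ?b * ennreal (V j \<sigma>)) \<partial>lborel)"
    proof (intro nn_integral_mono)
      fix \<sigma>
      have "(1 + \<sigma>\<^sup>2) powr \<beta> * U j \<sigma> \<le> (?a * (1 + ?b * (\<sigma> ^ m)\<^sup>2)) * U j \<sigma>"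
        by (intro mult_right_mono weight_bound \<beta> m U0)
      also have "\<dots> = ?a * (U j \<sigma> + ?b * V j \<sigma>)" unfolding VU by (simp add: algebra_simps)
      finally have "ennreal ((1 + \<sigma>\<^sup>2) powr \<beta> * U j \<sigma>) \<le> ennreal (?a * (U j \<sigma> + ?b * V j \<sigma>))" by (rule ennreal_leI)
      also have "\<dots> = ennreal ?a * (ennreal (U j \<sigma>) + ennreal ?b * ennreal (V j \<sigma>))"
        using U0 by (simp add: ennreal_mult ennreal_plus)
      finally show "ennreal ((1 + \<sigma>\<^sup>2) powr \<beta> * U j \<sigma>) \<le> ennreal ?a * (ennreal (U j \<sigma>) + ennreal ?b * ennreal (V j \<sigma>))" .
    qed
    also have "\<dots> = ennreal ?a * ((\<integral>\<^sup>+\<sigma>. ennreal (U j \<sigma>) \<partial>lborel) + ennreal ?b * (\<integral>\<^sup>+\<sigma>. ennreal (V j \<sigma>) \<partial>lborel))"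
      by (simp add: nn_integral_cmult nn_integral_add)
    also have "\<dots> \<le> ennreal ?a * (ennreal (4 * pi * R * (C * (2 powr (- lam * real j))\<^sup>2)) +
        ennreal ?b * ennreal (4 * pi * R * (D * (2 powr ((- lam + real m) * real j))\<^sup>2)))"
      by (intro mult_left_mono add_mono IU IV) auto
    also have "\<dots> = ennreal (?a * (4 * pi * R * (C * (2 powr (- lam * real j))\<^sup>2) +
        ?b * (4 * pi * R * (D * (2 powr ((- lam + real m) * real j))\<^sup>2))))"
      using C(1) D(1) R(2) by (simp add: ennreal_mult ennreal_plus)
    also have "?a * (4 * pi * R * (C * (2 powr (- lam * real j))\<^sup>2) + ?b * (4 * pi * R * (D * (2 powr ((- lam + real m) * real j))\<^sup>2)))
        = E * 2 powr (2 * (\<beta> - lam) * real j)"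
    proof -
      have sq: "(2 powr z)\<^sup>2 = (2::real) powr (2 * z)" for z by (simp add: power2_eq_square powr_add[symmetric])
      have 1: "(2::real) powr (2 * \<beta> * real j) * (2 powr (- lam * real j))\<^sup>2 = 2 powr (2 * (\<beta> - lam) * real j)"
        unfolding sq powr_add[symmetric] by (simp add: algebra_simps)
      have 2: "(2::real) powr (2 * \<beta> * real j) * (?b * (2 powr ((- lam + real m) * real j))\<^sup>2) = 2 powr (2 * (\<beta> - lam) * real j)"
        unfolding sq powr_add[symmetric] by (simp add: algebra_simps)
      have "?a * (4 * pi * R * (C * (2 powr (- lam * real j))\<^sup>2) + ?b * (4 * pi * R * (D * (2 powr ((- lam + real m) * real j))\<^sup>2))) =
        2 ^ m * (4 * pi * R) * (C * (2 powr (2 * \<beta> * real j) * (2 powr (- lam * real j))\<^sup>2) +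
          D * (2 powr (2 * \<beta> * real j) * (?b * (2 powr ((- lam + real m) * real j))\<^sup>2)))"
        by (simp add: algebra_simps)
      then show ?thesis unfolding 1 2 E_def by (simp add: algebra_simps)
    qed
    finally show ?thesis .
  qed
  then show ?thesis unfolding U_def using E0 by blast
qed

text \<open>The triangle inequality for a telescoping series in a weighted L^2 space, made pointwise
  so that it reaches the pointwise limit L. A Cauchy-Schwarz inequality with weights r^j leads to
  one nonnegative majorant valid for all partial sums.\<close>

lemma weighted_limit:
  fixes H :: "nat \<Rightarrow> real \<Rightarrow> complex" and W :: "real \<Rightarrow> real"
  assumes [measurable]: "W \<in> borel_measurable borel" "\<And>j. H j \<in> borel_measurable borel"
    and W0: "\<And>\<sigma>. W \<sigma> \<ge> 0" and lim: "\<And>\<sigma>. (\<lambda>j. H j \<sigma>) \<longlonglongrightarrow> L \<sigma>"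
    and base: "(\<integral>\<^sup>+\<sigma>. ennreal (W \<sigma> * (norm (H 0 \<sigma>))\<^sup>2) \<partial>lborel) < \<infinity>"
    and C: "C \<ge> 0" and r: "0 < r" "r < 1"
    and diff: "\<And>j. (\<integral>\<^sup>+\<sigma>. ennreal (W \<sigma> * (norm (H (Suc j) \<sigma> - H j \<sigma>))\<^sup>2) \<partial>lborel) \<le> ennreal (C * (r ^ j)\<^sup>2)"
  shows "(\<integral>\<^sup>+\<sigma>. ennreal (W \<sigma> * (norm (L \<sigma>))\<^sup>2) \<partial>lborel) < \<infinity>"
proof -
  define S where "S = 1 / (1 - r)"
  have S: "S \<ge> 0" "(\<Sum>j<J. r ^ j) \<le> S" for J
    using r unfolding S_def by (auto simp: sum_gp_strict field_simps)
  define d where "d j \<sigma> = norm (H (Suc j) \<sigma> - H j \<sigma>)" for j \<sigma>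
  have [measurable]: "d j \<in> borel_measurable borel" for j unfolding d_def by measurable
  define B where "B \<sigma> = ennreal (2 * W \<sigma> * (norm (H 0 \<sigma>))\<^sup>2) + ennreal (2 * S) * (\<Sum>j. ennreal (W \<sigma> * (d j \<sigma>)\<^sup>2 / r ^ j))" for \<sigma>
  \<comment> \<open>Each increment is written as sqrt (r^j) times a quotient; the first factors
    contribute a geometric sum bounded by S.\<close>
  have fin: "(norm (H J \<sigma> - H 0 \<sigma>))\<^sup>2 \<le> S * (\<Sum>j<J. (d j \<sigma>)\<^sup>2 / r ^ j)" for J \<sigma>
  proof -
    have "H J \<sigma> - H 0 \<sigma> = (\<Sum>j<J. H (Suc j) \<sigma> - H j \<sigma>)" by (rule sum_lessThan_telescope[symmetric])
    also have "norm \<dots> \<le> (\<Sum>j<J. d j \<sigma>)" unfolding d_def by (rule norm_sum)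
    also have "\<dots> = (\<Sum>j<J. sqrt (r ^ j) * (d j \<sigma> / sqrt (r ^ j)))" using r by simp
    finally have "(norm (H J \<sigma> - H 0 \<sigma>))\<^sup>2 \<le> (\<Sum>j<J. sqrt (r ^ j) * (d j \<sigma> / sqrt (r ^ j)))\<^sup>2"
      by (intro power_mono) auto
    also have "\<dots> \<le> (\<Sum>j<J. (sqrt (r ^ j))\<^sup>2) * (\<Sum>j<J. (d j \<sigma> / sqrt (r ^ j))\<^sup>2)"
      by (rule Cauchy_Schwarz_ineq_sum)
    also have "\<dots> = (\<Sum>j<J. r ^ j) * (\<Sum>j<J. (d j \<sigma>)\<^sup>2 / r ^ j)" using r by (simp add: power_divide)
    also have "\<dots> \<le> S * (\<Sum>j<J. (d j \<sigma>)\<^sup>2 / r ^ j)"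
      using r by (intro mult_right_mono S sum_nonneg) auto
    finally show ?thesis .
  qed
  have HB: "ennreal (W \<sigma> * (norm (H J \<sigma>))\<^sup>2) \<le> B \<sigma>" for J \<sigma>
  proof -
    let ?x = "norm (H 0 \<sigma>)" and ?y = "norm (H J \<sigma> - H 0 \<sigma>)"
    have "norm (H J \<sigma>) \<le> ?x + ?y" using norm_triangle_ineq[of "H 0 \<sigma>" "H J \<sigma> - H 0 \<sigma>"] by simp
    then have "(norm (H J \<sigma>))\<^sup>2 \<le> (?x + ?y)\<^sup>2" by (intro power_mono) auto
    also have "\<dots> \<le> 2 * ?x\<^sup>2 + 2 * ?y\<^sup>2"
      using zero_le_power2[of "?x - ?y"] by (simp add: power2_sum power2_diff)
    finally have "W \<sigma> * (norm (H J \<sigma>))\<^sup>2 \<le> W \<sigma> * (2 * ?x\<^sup>2 + 2 * (S * (\<Sum>j<J. (d j \<sigma>)\<^sup>2 / r ^ j)))"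
      using fin[of J \<sigma>] by (intro mult_left_mono W0) linarith
    also have "\<dots> = 2 * W \<sigma> * ?x\<^sup>2 + 2 * S * (\<Sum>j<J. W \<sigma> * (d j \<sigma>)\<^sup>2 / r ^ j)"
      by (simp add: algebra_simps sum_distrib_left)
    finally have "ennreal (W \<sigma> * (norm (H J \<sigma>))\<^sup>2) \<le> ennreal (2 * W \<sigma> * ?x\<^sup>2 + 2 * S * (\<Sum>j<J. W \<sigma> * (d j \<sigma>)\<^sup>2 / r ^ j))"
      by (rule ennreal_leI)
    also have "\<dots> = ennreal (2 * W \<sigma> * ?x\<^sup>2) + ennreal (2 * S) * ennreal (\<Sum>j<J. W \<sigma> * (d j \<sigma>)\<^sup>2 / r ^ j)"
    proof -
      have a: "0 \<le> 2 * W \<sigma> * ?x\<^sup>2" "0 \<le> 2 * S" using W0 S by simp_all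
      have b: "0 \<le> (\<Sum>j<J. W \<sigma> * (d j \<sigma>)\<^sup>2 / r ^ j)" using W0 r by (intro sum_nonneg) simp
      show ?thesis unfolding ennreal_mult[OF a(2) b, symmetric] by (rule ennreal_plus[OF a(1) mult_nonneg_nonneg[OF a(2) b]])
    qed
    also have "ennreal (\<Sum>j<J. W \<sigma> * (d j \<sigma>)\<^sup>2 / r ^ j) = (\<Sum>j<J. ennreal (W \<sigma> * (d j \<sigma>)\<^sup>2 / r ^ j))"
      using W0 r by (intro sum_ennreal[symmetric]) auto
    also have "ennreal (2 * W \<sigma> * ?x\<^sup>2) + ennreal (2 * S) * (\<Sum>j<J. ennreal (W \<sigma> * (d j \<sigma>)\<^sup>2 / r ^ j)) \<le> B \<sigma>"
      unfolding B_def by (intro add_left_mono mult_left_mono sum_le_suminf) auto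
    finally show ?thesis .
  qed
  have "ennreal (W \<sigma> * (norm (L \<sigma>))\<^sup>2) \<le> B \<sigma>" for \<sigma>
  proof (rule LIMSEQ_le_const2)
    show "(\<lambda>J. ennreal (W \<sigma> * (norm (H J \<sigma>))\<^sup>2)) \<longlonglongrightarrow> ennreal (W \<sigma> * (norm (L \<sigma>))\<^sup>2)"
      by (intro tendsto_ennrealI tendsto_mult tendsto_const tendsto_power tendsto_norm lim)
    show "\<exists>N. \<forall>J\<ge>N. ennreal (W \<sigma> * (norm (H J \<sigma>))\<^sup>2) \<le> B \<sigma>" using HB by blast
  qed
  then have "(\<integral>\<^sup>+\<sigma>. ennreal (W \<sigma> * (norm (L \<sigma>))\<^sup>2) \<partial>lborel) \<le> (\<integral>\<^sup>+\<sigma>. B \<sigma> \<partial>lborel)"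
    by (intro nn_integral_mono)
  also have "\<dots> = (\<integral>\<^sup>+\<sigma>. ennreal (2 * W \<sigma> * (norm (H 0 \<sigma>))\<^sup>2) \<partial>lborel) +
      ennreal (2 * S) * (\<Sum>j. \<integral>\<^sup>+\<sigma>. ennreal (W \<sigma> * (d j \<sigma>)\<^sup>2 / r ^ j) \<partial>lborel)"
    unfolding B_def by (simp add: nn_integral_add nn_integral_cmult nn_integral_suminf)
  also have "\<dots> < \<infinity>"
  proof -
    have "(\<integral>\<^sup>+\<sigma>. ennreal (2 * W \<sigma> * (norm (H 0 \<sigma>))\<^sup>2) \<partial>lborel) = 2 * (\<integral>\<^sup>+\<sigma>. ennreal (W \<sigma> * (norm (H 0 \<sigma>))\<^sup>2) \<partial>lborel)"
      using W0 by (subst nn_integral_cmult[symmetric]) (auto simp: ennreal_mult mult.assoc)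
    then have 1: "(\<integral>\<^sup>+\<sigma>. ennreal (2 * W \<sigma> * (norm (H 0 \<sigma>))\<^sup>2) \<partial>lborel) < \<infinity>"
      using base by (simp add: ennreal_mult_less_top)
    \<comment> \<open>Dividing by r^j uses up half of the assumed decay (r^j)^2, and the remaining
      r^j is still summable.\<close>
    have "(\<integral>\<^sup>+\<sigma>. ennreal (W \<sigma> * (d j \<sigma>)\<^sup>2 / r ^ j) \<partial>lborel) \<le> ennreal (C * r ^ j)" for j
    proof -
      have "(\<integral>\<^sup>+\<sigma>. ennreal (W \<sigma> * (d j \<sigma>)\<^sup>2 / r ^ j) \<partial>lborel) = (\<integral>\<^sup>+\<sigma>. ennreal (1 / r ^ j) * ennreal (W \<sigma> * (d j \<sigma>)\<^sup>2) \<partial>lborel)"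
        using W0 r by (intro nn_integral_cong) (simp add: ennreal_mult[symmetric])
      also have "\<dots> = ennreal (1 / r ^ j) * (\<integral>\<^sup>+\<sigma>. ennreal (W \<sigma> * (d j \<sigma>)\<^sup>2) \<partial>lborel)"
        by (rule nn_integral_cmult) measurable
      also have "\<dots> \<le> ennreal (1 / r ^ j) * ennreal (C * (r ^ j)\<^sup>2)"
        unfolding d_def by (intro mult_left_mono diff) auto
      also have "\<dots> = ennreal (C * r ^ j)"
        using r C by (simp add: ennreal_mult[symmetric] power2_eq_square)
      finally show ?thesis .
    qed
    then have "(\<Sum>j. \<integral>\<^sup>+\<sigma>. ennreal (W \<sigma> * (d j \<sigma>)\<^sup>2 / r ^ j) \<partial>lborel) \<le> (\<Sum>j. ennreal (C * r ^ j))"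
      by (intro suminf_le) auto
    also have "\<dots> = ennreal (\<Sum>j. C * r ^ j)"
      using r C by (intro suminf_ennreal2 summable_mult summable_geometric) auto
    finally have 2: "(\<Sum>j. \<integral>\<^sup>+\<sigma>. ennreal (W \<sigma> * (d j \<sigma>)\<^sup>2 / r ^ j) \<partial>lborel) < \<infinity>"
      by (auto simp: less_top[symmetric] top_unique)
    show ?thesis using 1 2 by (simp add: ennreal_mult_less_top)
  qed
  finally show ?thesis .
qed

lemma symb_sup_shift:
  assumes "symb sup_size n r F" shows "symb sup_size n r (\<lambda>j. F (Suc j))"
proof -
  have *: "sup_size r (\<lambda>j. F (Suc j))" if F: "sup_size r F" for r and F :: "nat \<Rightarrow> 'a \<Rightarrow> real"
  proof -
    obtain C where C: "C \<ge> 0" "\<forall>j x. \<bar>F j x\<bar> \<le> C * 2 powr (r * real j)" using F unfolding sup_size_def by blast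
    show ?thesis
    proof (rule sup_sizeI[of _ "C * 2 powr r"])
      fix j x show "\<bar>F (Suc j) x\<bar> \<le> C * 2 powr r * 2 powr (r * real j)"
        using C(2)[rule_format, of "Suc j" x] by (simp add: distrib_left powr_add mult.assoc)
    qed (use C F in \<open>auto simp: sup_size_def\<close>)
  qed
  show ?thesis using assms
  proof (induction n arbitrary: r F)
    case (Suc n)
    have "symb sup_size n (r + 1) (\<lambda>j. dd v (F (Suc j)))" for v
      by (rule Suc.IH[of "r + 1" "\<lambda>j. dd v (F j)"]) (use Suc.prems in simp)
    then show ?case using Suc.prems * by simp
  qed (simp add: *)
qed

lemma symb_L2_smooth:
  assumes "smooth_on UNIV f" "\<And>x. norm x > R \<Longrightarrow> f x = 0" "r \<ge> 0"
  shows "symb L2_size n r (\<lambda>j. f)"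
proof -
  have 1: "L2_size r (\<lambda>j. f)"
    if "smooth_on UNIV f" "\<And>x. norm x > R \<Longrightarrow> f x = 0" "r \<ge> 0" for f and r
  proof -
    have "(LINT x|lborel. (f x)\<^sup>2) * 1 \<le> (LINT x|lborel. (f x)\<^sup>2) * (2 powr (r * real j))\<^sup>2" for j
      using that(3) ge_one_powr_ge_zero[of 2 "r * real j"] by (intro mult_left_mono one_le_power) auto
    then show ?thesis unfolding L2_size_def using bbs_smooth[OF that(1,2)]
      by (intro conjI allI exI[of _ "LINT x|lborel. (f x)\<^sup>2"]) auto
  qed
  show ?thesis using assms
  proof (induction n arbitrary: f r)
    case 0
    then show ?case using 1[of f r] by simp
  next
    case (Suc n)
    have "symb L2_size n (r + 1) (\<lambda>j. dd v f)" for v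
    proof (rule Suc.IH)
      show "dd v f x = 0" if "norm x > R" for x
        by (rule dd_zero_outside[of "cball 0 R"]) (use Suc.prems(2) that in auto)
    qed (use Suc.prems smooth_on_dd[OF open_UNIV] in auto)
    then show ?case
      using 1[of f r] smooth_on_differentiable[OF open_UNIV Suc.prems(1)] Suc.prems by auto
  qed
qed

text \<open>The exponential is telescoped along the smooth approximations of the convolution:
  \<open>weighted_piece\<close> estimates the first term and each difference, and
  \<open>weighted_limit\<close> sums them.\<close>

lemma weighted_nonlinear:
  fixes k g A :: "real^2 \<Rightarrow> real"
  assumes ad: "adapted \<Omega> (unit_vec \<theta>) (line_dir \<theta>) q K" and \<Omega>: "\<Omega> \<in> sets borel"
    and R: "K \<subseteq> cball 0 R" "R \<ge> 0"
    and A: "smooth_on UNIV A" "\<And>x. x \<notin> K \<Longrightarrow> A x = 0"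
    and k: "integrable lborel k" "\<And>x. norm x > T \<Longrightarrow> k x = 0" and g: "bbs g"
    and decay: "\<And>\<xi>. norm (ft k \<xi>) \<le> D * (1 + (norm \<xi>)\<^sup>2) powr (- lam / 2)"
    and \<beta>: "0 \<le> \<beta>" "\<beta> < lam"
  shows "(\<integral>\<^sup>+\<sigma>. ennreal ((1 + \<sigma>\<^sup>2) powr \<beta> *
    (norm (ft (\<lambda>x. indicator \<Omega> x * (A x * exp (- conv k g x))) (\<sigma> *\<^sub>R unit_vec \<theta>)))\<^sup>2) \<partial>lborel) < \<infinity>"
proof -
  obtain G where G: "\<And>n. symb sup_size n 0 G"
    and dG: "\<And>n. symb L2_size n (- lam) (\<lambda>j x. G (Suc j) x - G j x)"
    and rG: "L2_size (- lam) (\<lambda>j x. conv k g x - G j x)" and bG: "\<And>j. bbs (G j)"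
    using smooth_approximation[where R=T, OF k g _ decay] \<beta> by auto
  have bC: "bbs (conv k g)" by (rule bbs_conv[OF k g])
  obtain M where M: "M \<ge> 0" "\<And>j x. \<bar>G j x\<bar> \<le> M"
    using G[of 0] unfolding symb.simps sup_size_def by auto
  obtain M' where M': "\<And>x. \<bar>conv k g x\<bar> \<le> M'" using bC unfolding bbs_def by blast
  have A0: "A x = 0" if "norm x > R" for x
  proof -
    have "x \<notin> K" using R that by auto
    then show ?thesis by (rule A(2))
  qed
  have bA: "bbs A" by (rule bbs_smooth[OF A(1) A0])
  have [measurable]: "A \<in> borel_measurable borel" "conv k g \<in> borel_measurable borel" "G j \<in> borel_measurable borel" for j
    by (intro bbs_measurable bA bC bG)+
  note bAe = bbs_mult_exp[OF bA]
  define H where "H j \<sigma> = ft (\<lambda>x. indicator \<Omega> x * (A x * exp (- G j x))) (\<sigma> *\<^sub>R unit_vec \<theta>)" for j \<sigma>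
  have iH: "integrable lborel (\<lambda>x. indicator \<Omega> x * (A x * exp (- G j x)))" for j
    by (intro bbs_integrable bbs_indicator bAe bG \<Omega>)
  have iL: "integrable lborel (\<lambda>x. indicator \<Omega> x * (A x * exp (- conv k g x)))"
    by (intro bbs_integrable bbs_indicator bAe bC \<Omega>)
  \<comment> \<open>The ratio is below 1 precisely because \<beta> < lam.\<close>
  define r where "r = 2 powr (\<beta> - lam)"
  have r: "0 < r" "r < 1" unfolding r_def using \<beta> by (auto simp: powr_less_one)
  have rj: "2 powr (2 * (\<beta> - lam) * real j) = (r ^ j)\<^sup>2" for j
    unfolding r_def by (simp add: powr_realpow[symmetric] powr_powr flip: power_mult) (simp add: mult_ac)
  let ?X = "\<lambda>j x. A x * (exp (- G (Suc j) x) - exp (- G j x))"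
  have "symb L2_size n (0 + (- lam)) ?X" for n
    by (rule symb_L2_mult[OF symb_sup_smooth[where R=R, OF A(1) A0] symb_L2_exp_diff[OF symb_sup_shift[OF G] G dG]]) simp_all
  then obtain C where C: "C \<ge> 0" "\<And>j. (\<integral>\<^sup>+\<sigma>. ennreal ((1 + \<sigma>\<^sup>2) powr \<beta> * (norm (ft (\<lambda>x. indicator \<Omega> x * ?X j x) (\<sigma> *\<^sub>R unit_vec \<theta>)))\<^sup>2) \<partial>lborel)
      \<le> ennreal (C * 2 powr (2 * (\<beta> - lam) * real j))"
    using weighted_piece[OF ad \<Omega> R, of lam ?X \<beta>] A(2) \<beta> by auto
  have Hd: "H (Suc j) \<sigma> - H j \<sigma> = ft (\<lambda>x. indicator \<Omega> x * ?X j x) (\<sigma> *\<^sub>R unit_vec \<theta>)" for j \<sigma>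
    unfolding H_def by (subst ft_diff[OF iH iH, symmetric]) (simp add: algebra_simps)
  \<comment> \<open>The single function with G 0 is disguised as a sequence of order - lam by the
    factor 2^(- lam j), so that \<open>weighted_piece\<close> applies; only the member j = 0, with
    factor 1, is used.\<close>
  let ?Y = "\<lambda>j x. 2 powr (- lam * real j) * (A x * exp (- G 0 x))"
  have s0: "smooth_on UNIV (\<lambda>x. A x * exp (- G 0 x))"
    by (intro smooth_on_mult A open_UNIV symb_smooth[OF symb_sup_exp[OF G]])
  have "symb L2_size n (- lam + 0) ?Y" for n
    by (rule symb_L2_mult[OF symb_sup_const[of 1] symb_L2_smooth[where R=R, OF s0]]) (auto simp: A0)
  then obtain C' where "C' \<ge> 0" "\<And>j. (\<integral>\<^sup>+\<sigma>. ennreal ((1 + \<sigma>\<^sup>2) powr \<beta> * (norm (ft (\<lambda>x. indicator \<Omega> x * ?Y j x) (\<sigma> *\<^sub>R unit_vec \<theta>)))\<^sup>2) \<partial>lborel)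
      \<le> ennreal (C' * 2 powr (2 * (\<beta> - lam) * real j))"
    using weighted_piece[OF ad \<Omega> R, of lam ?Y \<beta>] A(2) \<beta> by auto
  from this(2)[of 0] have base: "(\<integral>\<^sup>+\<sigma>. ennreal ((1 + \<sigma>\<^sup>2) powr \<beta> * (norm (H 0 \<sigma>))\<^sup>2) \<partial>lborel) < \<infinity>"
    unfolding H_def by (auto intro: le_less_trans)
  have lim: "(\<lambda>j. H j \<sigma>) \<longlonglongrightarrow> ft (\<lambda>x. indicator \<Omega> x * (A x * exp (- conv k g x))) (\<sigma> *\<^sub>R unit_vec \<theta>)" for \<sigma>
  proof -
    obtain E where E: "E \<ge> 0" "\<And>j. (LINT x|lborel. (conv k g x - G j x)\<^sup>2) \<le> E * (2 powr (- lam * real j))\<^sup>2"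
      using rG unfolding L2_size_def by blast
    define B where "B = exp (M + \<bar>M'\<bar>)"
    \<comment> \<open>The inequality 2xy \<le> e x^2 + y^2/e with e = 2^(- lam j) balances the fixed
      L^2 norm of A against an error whose square is O(e^2), so the L^1 error is O(e) and the
      transforms converge pointwise.\<close>
    have le: "norm (H j \<sigma> - ft (\<lambda>x. indicator \<Omega> x * (A x * exp (- conv k g x))) (\<sigma> *\<^sub>R unit_vec \<theta>))
        \<le> 2 powr (- lam * real j) * (B / 2 * ((LINT x|lborel. (A x)\<^sup>2) + E))" for j
    proof -
      define e where "e = 2 powr (- lam * real j)"
      have e: "e > 0" unfolding e_def by simp
      have bD: "bbs (\<lambda>x. conv k g x - G j x)" by (rule bbs_diff[OF bC bG])
      let ?F = "\<lambda>x. indicator \<Omega> x * (A x * exp (- G j x)) - indicator \<Omega> x * (A x * exp (- conv k g x))"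
      have "norm (H j \<sigma> - ft (\<lambda>x. indicator \<Omega> x * (A x * exp (- conv k g x))) (\<sigma> *\<^sub>R unit_vec \<theta>)) = norm (ft ?F (\<sigma> *\<^sub>R unit_vec \<theta>))"
        unfolding H_def by (subst ft_diff[OF iH iL]) simp
      also have "\<dots> \<le> (LINT x|lborel. \<bar>?F x\<bar>)"
        by (intro ft_bound Bochner_Integration.integrable_diff iH iL)
      also have "\<dots> \<le> (LINT x|lborel. B / 2 * (e * (A x)\<^sup>2 + (conv k g x - G j x)\<^sup>2 / e))"
      proof (intro integral_mono integrable_abs Bochner_Integration.integrable_diff iH iL integrable_mult_right Bochner_Integration.integrable_add
          integrable_divide bbs_integrable[OF bbs_power2[OF bA]] bbs_integrable[OF bbs_power2[OF bD]])
        fix x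
        have "\<bar>exp (- G j x) - exp (- conv k g x)\<bar> \<le> B * \<bar>G j x - conv k g x\<bar>"
          unfolding B_def by (rule exp_minus_diff_le) (use M(1) M'[of x] M(2)[of j x] in linarith)+
        then have "\<bar>A x\<bar> * \<bar>exp (- G j x) - exp (- conv k g x)\<bar> \<le> \<bar>A x\<bar> * (B * \<bar>G j x - conv k g x\<bar>)"
          by (intro mult_left_mono) auto
        moreover have "\<bar>?F x\<bar> \<le> \<bar>A x\<bar> * \<bar>exp (- G j x) - exp (- conv k g x)\<bar>"
          by (auto simp: indicator_def abs_mult[symmetric] right_diff_distrib)
        moreover have "\<bar>A x\<bar> * \<bar>G j x - conv k g x\<bar> \<le> 1 / 2 * (e * (A x)\<^sup>2 + (conv k g x - G j x)\<^sup>2 / e)"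
        proof -
          have "0 \<le> (sqrt e * \<bar>A x\<bar> - \<bar>G j x - conv k g x\<bar> / sqrt e)\<^sup>2" by simp
          also have "\<dots> = e * (A x)\<^sup>2 + (conv k g x - G j x)\<^sup>2 / e - 2 * (\<bar>A x\<bar> * \<bar>G j x - conv k g x\<bar>)"
            using e by (simp add: power2_diff power_mult_distrib power_divide power2_commute[of "G j x"])
          finally show ?thesis by simp
        qed
        then have "B * (\<bar>A x\<bar> * \<bar>G j x - conv k g x\<bar>) \<le> B * (1 / 2 * (e * (A x)\<^sup>2 + (conv k g x - G j x)\<^sup>2 / e))"
          unfolding B_def by (intro mult_left_mono) auto
        ultimately show "\<bar>?F x\<bar> \<le> B / 2 * (e * (A x)\<^sup>2 + (conv k g x - G j x)\<^sup>2 / e)"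
          by (simp add: mult_ac)
      qed
      also have "\<dots> = B / 2 * (e * (LINT x|lborel. (A x)\<^sup>2) + (LINT x|lborel. (conv k g x - G j x)\<^sup>2) / e)"
      proof -
        have i: "integrable lborel (\<lambda>x. e * (A x)\<^sup>2)" "integrable lborel (\<lambda>x. (conv k g x - G j x)\<^sup>2 / e)"
          by (intro integrable_mult_right integrable_divide bbs_integrable[OF bbs_power2[OF bA]] bbs_integrable[OF bbs_power2[OF bD]])+
        show ?thesis
          unfolding integral_mult_right_zero Bochner_Integration.integral_add[OF i] integral_divide_zero ..
      qed
      also have "\<dots> \<le> B / 2 * (e * (LINT x|lborel. (A x)\<^sup>2) + (E * e\<^sup>2) / e)"
        using E(2)[of j] e unfolding e_def[symmetric] B_def by (intro mult_left_mono add_left_mono divide_right_mono) auto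
      also have "\<dots> = e * (B / 2 * ((LINT x|lborel. (A x)\<^sup>2) + E))"
        using e by (simp add: power2_eq_square algebra_simps)
      finally show ?thesis unfolding e_def .
    qed
    have "(\<lambda>j. (2 powr (- lam)) ^ j * (B / 2 * ((LINT x|lborel. (A x)\<^sup>2) + E))) \<longlonglongrightarrow> 0"
      by (intro tendsto_mult_left_zero LIMSEQ_power_zero) (use \<beta> in \<open>auto simp: powr_less_one\<close>)
    moreover have "(2 powr (- lam)) ^ j = 2 powr (- lam * real j)" for j
      by (simp add: powr_realpow[symmetric] powr_powr)
    ultimately have l0: "(\<lambda>j. 2 powr (- lam * real j) * (B / 2 * ((LINT x|lborel. (A x)\<^sup>2) + E))) \<longlonglongrightarrow> 0" by simp
    show ?thesis
      by (rule LIM_zero_cancel, rule Lim_null_comparison[OF _ l0], rule always_eventually, rule allI, rule le)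
  qed
  show ?thesis
  proof (rule weighted_limit[where H=H, OF _ _ _ lim base C(1) r])
    show "H j \<in> borel_measurable borel" for j
      unfolding H_def by (rule ft_line_measurable[OF iH])
    show "(\<integral>\<^sup>+\<sigma>. ennreal ((1 + \<sigma>\<^sup>2) powr \<beta> * (norm (H (Suc j) \<sigma> - H j \<sigma>))\<^sup>2) \<partial>lborel) \<le> ennreal (C * (r ^ j)\<^sup>2)" for j
      unfolding Hd rj[symmetric] by (rule C(2))
  qed auto
qed

section \<open>Adapted neighbourhoods of the points of a transversal line\<close>

text \<open>In a ball without boundary points the constant -1 defines \<Omega>, and v needs no
  correction.\<close>

lemma adapted_interior:
  fixes p v w :: "'a::euclidean_space"
  assumes p: "p \<in> interior \<Omega>" shows "\<exists>r>0. \<exists>q. adapted \<Omega> v w q (cball p r)"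
proof -
  obtain r where r: "r > 0" "cball p r \<subseteq> \<Omega>"
    using p by (auto simp: mem_interior_cball)
  have "adapted \<Omega> v w (\<lambda>x. 0) (cball p r)"
    unfolding adapted_def
  proof (intro conjI exI[of _ "\<lambda>x::'a. - 1 :: real"])
    show "\<forall>x\<in>cball p r. (x \<in> \<Omega> \<longleftrightarrow> (- 1 :: real) \<le> 0) \<and> dd v (\<lambda>x. - 1) x + 0 * dd w (\<lambda>x. - 1 :: real) x = 0"
      using r(2) by auto
  qed (auto intro: smooth_on_const)
  then show ?thesis using r(1) by blast
qed

text \<open>Transversality says that \<rho> has a nonzero derivative along w at p, hence nearby.
  There the tangency equation is solved by division, and a cutoff makes the solution and \<rho>
  global.\<close>

lemma adapted_frontier:
  fixes p v w :: "real^2"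
  assumes def: "local_defining_function \<Omega> p \<rho>" and nt: "frechet_derivative \<rho> (at p) w \<noteq> 0"
  shows "\<exists>r>0. \<exists>q. adapted \<Omega> v w q (cball p r)"
proof -
  obtain U where U: "open U" "p \<in> U" "smooth_on U \<rho>" "\<Omega> \<inter> U = {x \<in> U. \<rho> x \<le> 0}"
    using def unfolding local_defining_function_def by blast
  have sd: "smooth_on U (dd u \<rho>)" for u by (rule smooth_on_dd[OF U(1,3)])
  have cont: "continuous_on U (dd w \<rho>)"
    using smooth_on_differentiable[OF U(1) sd] by (intro continuous_at_imp_continuous_on ballI differentiable_imp_continuous_within)
  define V where "V = U \<inter> dd w \<rho> -` (- {0})"
  have V: "open V" unfolding V_def by (rule continuous_open_preimage[OF cont U(1) open_Compl[OF closed_singleton]])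
  have pV: "p \<in> V" using U(2) nt unfolding V_def by (simp add: dd_def)
  have VU: "V \<subseteq> U" unfolding V_def by blast
  obtain e where e: "e > 0" "cball p e \<subseteq> V" using V pV open_contains_cball by blast
  let ?P = "plateau p e"
  define \<rho>' where "\<rho>' x = ?P x * \<rho> x" for x
  \<comment> \<open>The unique coefficient that makes v + q w tangent to the level sets of \<rho>,
    times the cutoff.\<close>
  define q where "q x = ?P x * ((-1) * dd v \<rho> x * inverse (dd w \<rho> x))" for x
  have P0: "?P x = 0" if "x \<notin> cball p e" for x using plateau_0[OF e(1), of p x] that by simp
  have sP: "smooth_on V ?P" by (rule smooth_on_subset[OF smooth_on_plateau]) simp
  have s\<rho>: "smooth_on UNIV \<rho>'"
    by (rule smooth_on_extend[OF V _ closed_cball e(2)])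
      (use P0 in \<open>auto simp: \<rho>'_def[abs_def] intro!: smooth_on_mult[OF V sP] smooth_on_subset[OF U(3) VU]\<close>)
  have sq: "smooth_on UNIV q"
  proof (rule smooth_on_extend[OF V _ closed_cball e(2)])
    show "smooth_on V q"
      unfolding q_def[abs_def]
      by (intro smooth_on_mult[OF V] sP smooth_on_const V smooth_on_inverse smooth_on_subset[OF sd VU])
        (simp add: V_def)
  qed (use P0 in \<open>auto simp: q_def\<close>)
  have P1: "?P x = 1" if "x \<in> ball p (e / 2)" for x using plateau_1[OF e(1), of p x] that by simp
  have eq: "\<rho>' x = \<rho> x" if "x \<in> ball p (e / 2)" for x using P1[OF that] by (simp add: \<rho>'_def)
  \<comment> \<open>A quarter of the radius puts the closed ball inside the open ball of radius e/2,
    where the cutoff is 1 and the derivatives of \<rho> and of its extension agree.\<close>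
  have "adapted \<Omega> v w q (cball p (e / 4))"
    unfolding adapted_def
  proof (intro conjI exI[of _ \<rho>'] ballI sq s\<rho> closed_cball)
    have "norm p + e < norm x \<Longrightarrow> q x = 0" for x
      using norm_triangle_ineq2[of x p] P0[of x] by (auto simp: q_def dist_norm norm_minus_commute)
    then show "\<exists>R. \<forall>x. R < norm x \<longrightarrow> q x = 0" by blast
    fix x assume x: "x \<in> cball p (e / 4)"
    have xb: "x \<in> ball p (e / 2)" using x e(1) by simp
    have xV: "x \<in> V" using x e by (auto simp: subset_iff)
    show "x \<in> \<Omega> \<longleftrightarrow> \<rho>' x \<le> 0" using U(4) xV VU eq[OF xb] by auto
    have "dd u \<rho>' x = dd u \<rho> x" for u by (rule dd_cong[OF open_ball xb eq])
    then show "dd v \<rho>' x + q x * dd w \<rho>' x = 0"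
      using xV by (simp add: q_def P1[OF xb] V_def)
  qed
  then show ?thesis using e(1) by (intro exI[of _ "e / 4"]) auto
qed

lemma adapted_transversal:
  assumes \<Omega>: "compact_smooth_domain \<Omega>" and nt: "\<not> line_tangent_to_boundary s \<theta> \<Omega>"
    and p: "p \<in> line s \<theta>" "p \<in> \<Omega>"
  shows "\<exists>r>0. \<exists>q. adapted \<Omega> v (line_dir \<theta>) q (cball p r)"
proof (cases "p \<in> interior \<Omega>")
  case False
  have "closed \<Omega>" using \<Omega> unfolding compact_smooth_domain_def by (simp add: compact_imp_closed)
  then have fr: "p \<in> frontier \<Omega>" using p(2) False by (simp add: frontier_def closure_closed)
  then obtain \<rho> where "local_defining_function \<Omega> p \<rho>" using \<Omega> unfolding compact_smooth_domain_def by blast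
  moreover then have "frechet_derivative \<rho> (at p) (line_dir \<theta>) \<noteq> 0"
    using nt p(1) fr unfolding line_tangent_to_boundary_def by blast
  ultimately show ?thesis by (rule adapted_frontier)
qed (rule adapted_interior)

text \<open>Compactness is used twice: on the part of \<Omega> on the line, to select finitely many
  balls, and on the part of \<Omega> outside them, whose positive distance from the line is the
  width of the strip. Half radii appear because a plateau is guaranteed to be 1 only there.\<close>

lemma finite_adapted_cover:
  assumes \<Omega>: "compact_smooth_domain \<Omega>" and nt: "\<not> line_tangent_to_boundary s \<theta> \<Omega>"
  shows "\<exists>F r q \<epsilon>. finite F \<and> \<epsilon> > 0 \<and> (\<forall>p\<in>F. r p > 0 \<and> adapted \<Omega> v (line_dir \<theta>) (q p) (cball p (r p))) \<and>
    (\<forall>x\<in>\<Omega>. \<bar>x \<bullet> unit_vec \<theta> - s\<bar> < \<epsilon> \<longrightarrow> (\<exists>p\<in>F. dist p x < r p / 2))"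
proof -
  have c\<Omega>: "compact \<Omega>" using \<Omega> unfolding compact_smooth_domain_def by blast
  define L where "L = line s \<theta> \<inter> \<Omega>"
  have cont: "continuous_on UNIV (\<lambda>x. x \<bullet> unit_vec \<theta>)" by (intro continuous_intros)
  have "closed (line s \<theta>)" unfolding line_def by (intro closed_Collect_eq continuous_intros)
  then have cL: "compact L" unfolding L_def using c\<Omega> by (rule closed_Int_compact)
  have "\<forall>p\<in>L. \<exists>r. r > 0 \<and> (\<exists>q. adapted \<Omega> v (line_dir \<theta>) q (cball p r))"
    unfolding L_def using adapted_transversal[OF \<Omega> nt] by blast
  then obtain r where r: "\<forall>p\<in>L. r p > 0 \<and> (\<exists>q. adapted \<Omega> v (line_dir \<theta>) q (cball p (r p)))"
    by (rule bchoice[THEN exE])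
  then obtain q where q: "\<forall>p\<in>L. adapted \<Omega> v (line_dir \<theta>) (q p) (cball p (r p))"
    using bchoice[of L "\<lambda>p q. adapted \<Omega> v (line_dir \<theta>) q (cball p (r p))"] by blast
  have "L \<subseteq> (\<Union>p\<in>L. ball p (r p / 2))" using r by auto
  then obtain F where F: "F \<subseteq> L" "finite F" "L \<subseteq> (\<Union>p\<in>F. ball p (r p / 2))"
    using compactE_image[OF cL, of L "\<lambda>p. ball p (r p / 2)"] by auto
  define O' where "O' = (\<Union>p\<in>F. ball p (r p / 2))"
  have cK: "compact (\<Omega> - O')" unfolding O'_def by (intro compact_diff c\<Omega> open_UN ballI open_ball)
  have "\<exists>\<epsilon>>0. \<forall>x\<in>\<Omega> - O'. \<epsilon> \<le> \<bar>x \<bullet> unit_vec \<theta> - s\<bar>"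
  proof (cases "\<Omega> - O' = {}")
    case False
    have "continuous_on (\<Omega> - O') (\<lambda>x. \<bar>x \<bullet> unit_vec \<theta> - s\<bar>)" by (intro continuous_intros)
    then obtain z where z: "z \<in> \<Omega> - O'" "\<forall>x\<in>\<Omega> - O'. \<bar>z \<bullet> unit_vec \<theta> - s\<bar> \<le> \<bar>x \<bullet> unit_vec \<theta> - s\<bar>"
      using continuous_attains_inf[OF cK False, of "\<lambda>x. \<bar>x \<bullet> unit_vec \<theta> - s\<bar>"] by blast
    have "z \<notin> L" using z(1) F(3) unfolding O'_def by blast
    then have "\<bar>z \<bullet> unit_vec \<theta> - s\<bar> > 0" using z(1) unfolding L_def line_def by auto
    then show ?thesis using z(2) by blast
  qed (auto intro: exI[of _ 1])
  then obtain \<epsilon> where \<epsilon>: "\<epsilon> > 0" "\<forall>x\<in>\<Omega> - O'. \<epsilon> \<le> \<bar>x \<bullet> unit_vec \<theta> - s\<bar>" by blast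
  show ?thesis
  proof (intro exI conjI)
    show "finite F" "\<epsilon> > 0" by fact+
    show "\<forall>p\<in>F. r p > 0 \<and> adapted \<Omega> v (line_dir \<theta>) (q p) (cball p (r p))" using r q F(1) by blast
    show "\<forall>x\<in>\<Omega>. \<bar>x \<bullet> unit_vec \<theta> - s\<bar> < \<epsilon> \<longrightarrow> (\<exists>p\<in>F. dist p x < r p / 2)"
      using \<epsilon>(2) unfolding O'_def by force
  qed
qed

section \<open>Pointwise decay from the distributional definition\<close>

lemma fourier_eq_ft:
  assumes [measurable]: "f \<in> borel_measurable borel"
  shows "fourier (\<lambda>x. complex_of_real (f x)) \<xi> = ft f \<xi>"
  unfolding fourier_def ft_def cis_conv_exp by (subst integral_completion) auto

text \<open>The definition supplies only some representative with an almost everywhere bound.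
  Testing it on bumps that concentrate at a point, together with continuity of the transform and of
  the weight, turns this into a bound everywhere.\<close>

lemma decay_from_H_space:
  fixes k k' :: "'a::euclidean_space \<Rightarrow> real"
  assumes k': "integrable lborel k'" and k: "k \<in> borel_measurable lebesgue" and ae: "AE x in lborel. k x = k' x"
    and H: "distr_of_fun (\<lambda>x. complex_of_real (k x)) \<in> H_space lam \<infinity>" and lam: "lam > 0"
  shows "\<exists>D. \<forall>\<xi>. norm (ft k' \<xi>) \<le> D * (1 + (norm \<xi>)\<^sup>2) powr (- lam / 2)"
proof -
  obtain h where h: "h \<in> borel_measurable lebesgue"
    and hs: "\<And>\<psi>. \<psi> \<in> schwartz \<Longrightarrow> integrable lebesgue (\<lambda>\<xi>. h \<xi> * \<psi> \<xi>)"
      "\<And>\<psi>. \<psi> \<in> schwartz \<Longrightarrow> fourier_distr (distr_of_fun (\<lambda>x. complex_of_real (k x))) \<psi> = distr_of_fun h \<psi>"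
    and fin: "finite_Lp \<infinity> (\<lambda>\<xi>. complex_of_real ((1 + (norm \<xi>)\<^sup>2) powr (lam / 2)) * h \<xi>)"
    using H unfolding H_space_def by blast
  obtain C0 where C0: "AE \<xi> in lebesgue. norm (complex_of_real ((1 + (norm \<xi>)\<^sup>2) powr (lam / 2)) * h \<xi>) \<le> C0"
    using fin unfolding finite_Lp_def by auto
  define C where "C = max C0 0"
  define W where "W \<xi> = C * (1 + (norm \<xi>)\<^sup>2) powr (- lam / 2)" for \<xi> :: 'a
  have one: "1 + (norm \<xi>)\<^sup>2 > 0" for \<xi> :: 'a by (rule add_pos_nonneg) auto
  have hW: "AE \<xi> in lebesgue. norm (h \<xi>) \<le> W \<xi>"
    using C0
  proof eventually_elim
    case (elim \<xi>)
    have "(1 + (norm \<xi>)\<^sup>2) powr (lam / 2) * norm (h \<xi>) \<le> C" using elim unfolding C_def by (simp add: norm_mult)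
    then have "(1 + (norm \<xi>)\<^sup>2) powr (- lam / 2) * ((1 + (norm \<xi>)\<^sup>2) powr (lam / 2) * norm (h \<xi>)) \<le> (1 + (norm \<xi>)\<^sup>2) powr (- lam / 2) * C"
      by (intro mult_left_mono) auto
    moreover have "(1 + (norm \<xi>)\<^sup>2) powr (- lam / 2) * (1 + (norm \<xi>)\<^sup>2) powr (lam / 2) = 1"
      using one[of \<xi>] by (simp add: powr_add[symmetric])
    ultimately show ?case unfolding W_def by (simp only: mult.assoc[symmetric] mult_1_left mult.commute[of C])
  qed
  have "norm (ft k' \<xi>\<^sub>0) \<le> W \<xi>\<^sub>0" for \<xi>\<^sub>0
  proof (rule field_le_epsilon)
    fix e0 :: real assume e0: "e0 > 0"
    \<comment> \<open>Half of the error is for the variation of the weight over the bump, half for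
      that of the transform.\<close>
    define e where "e = e0 / 2"
    have e: "e > 0" using e0 by (simp add: e_def)
    have cW: "isCont W \<xi>\<^sub>0"
      unfolding W_def using one[of \<xi>\<^sub>0] by (intro continuous_intros) auto
    have cF: "isCont (ft k') \<xi>\<^sub>0" using continuous_on_ft[OF k'] by (simp add: continuous_on_eq_continuous_at)
    obtain d1 where d1: "d1 > 0" "\<And>y. dist y \<xi>\<^sub>0 < d1 \<Longrightarrow> dist (W y) (W \<xi>\<^sub>0) < e"
      using cW e unfolding continuous_at_eps_delta by blast
    obtain d2 where d2: "d2 > 0" "\<And>y. dist y \<xi>\<^sub>0 < d2 \<Longrightarrow> dist (ft k' y) (ft k' \<xi>\<^sub>0) < e"
      using cF e unfolding continuous_at_eps_delta by blast
    define d where "d = min d1 d2"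
    have d: "d > 0" using d1 d2 by (simp add: d_def)
    define p where "p = plateau \<xi>\<^sub>0 d"
    have bp: "bbs p" unfolding p_def by (rule bbs_plateau[OF d])
    have p0: "p y \<ge> 0" "dist y \<xi>\<^sub>0 \<ge> d \<Longrightarrow> p y = 0" for y
      unfolding p_def using plateau_bounds plateau_0[OF d] by (auto simp: dist_commute)
    have mp: "(LINT y|lborel. p y) > 0" unfolding p_def by (rule plateau_integral_pos[OF d])
    have ip: "integrable lborel p" by (rule bbs_integrable[OF bp])
    have [measurable]: "p \<in> borel_measurable borel" by (rule bbs_measurable[OF bp])
    have [measurable]: "k' \<in> borel_measurable borel" using k' by auto
    have [measurable]: "ft k' \<in> borel_measurable borel" "ft p \<in> borel_measurable borel" by (intro ft_measurable k' ip)+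
    have ps: "(\<lambda>x. complex_of_real (p x)) \<in> schwartz"
      unfolding p_def
      by (rule schwartz_compact_supp[of _ "norm \<xi>\<^sub>0 + d"]) (use d plateau_support smooth_on_of_real[OF open_UNIV smooth_on_plateau] in auto)
    \<comment> \<open>The multiplication formula moves the transform from the bump to the kernel,
      after the kernel is replaced by its Borel representative.\<close>
    have lhs: "fourier_distr (distr_of_fun (\<lambda>x. complex_of_real (k x))) (\<lambda>x. complex_of_real (p x)) =
        (LINT y|lborel. ft k' y * complex_of_real (p y))"
    proof -
      have "fourier_distr (distr_of_fun (\<lambda>x. complex_of_real (k x))) (\<lambda>x. complex_of_real (p x)) =
          (LINT x|lebesgue. complex_of_real (k x) * ft p x)"
        unfolding fourier_distr_def distr_of_fun_def by (simp add: fourier_eq_ft)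
      also have "\<dots> = (LINT x|lebesgue. complex_of_real (k' x) * ft p x)"
      proof (rule integral_cong_AE)
        show "AE x in lebesgue. complex_of_real (k x) * ft p x = complex_of_real (k' x) * ft p x"
          using AE_completion[OF ae] by eventually_elim simp
        have m: "ft p \<in> borel_measurable lebesgue" "k' \<in> borel_measurable lebesgue" by (auto intro: measurable_completion)
        show "(\<lambda>x. complex_of_real (k x) * ft p x) \<in> borel_measurable lebesgue"
          "(\<lambda>x. complex_of_real (k' x) * ft p x) \<in> borel_measurable lebesgue"
          using k m by measurable
      qed
      also have "\<dots> = (LINT x|lborel. complex_of_real (k' x) * ft p x)"
        by (rule integral_completion) measurable
      also have "\<dots> = (LINT x|lborel. complex_of_real (k' x) * (LINT y|lborel. cis (- (y \<bullet> x)) * complex_of_real (p y)))"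
        by (simp add: ft_def)
      also have "\<dots> = (LINT y|lborel. (LINT x|lborel. cis (- (x \<bullet> y)) * complex_of_real (k' x)) * complex_of_real (p y))"
        by (rule fourier_swap) (use k' ip in auto)
      finally show ?thesis by (simp add: ft_def)
    qed
    have i1: "integrable lborel (\<lambda>y. ft k' y * complex_of_real (p y))"
    proof (rule Bochner_Integration.integrable_bound[of _ "\<lambda>y. (LINT x|lborel. \<bar>k' x\<bar>) * p y"])
      show "AE y in lborel. norm (ft k' y * complex_of_real (p y)) \<le> norm ((LINT x|lborel. \<bar>k' x\<bar>) * p y)"
        using ft_bound[OF k'] by (intro AE_I2) (auto simp: norm_mult abs_mult intro!: mult_right_mono)
    qed (use ip in auto)
    have up: "norm (distr_of_fun h (\<lambda>x. complex_of_real (p x))) \<le> (W \<xi>\<^sub>0 + e) * (LINT y|lborel. p y)"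
    proof -
      have "norm (distr_of_fun h (\<lambda>x. complex_of_real (p x))) \<le> (LINT y|lebesgue. norm (h y * complex_of_real (p y)))"
        unfolding distr_of_fun_def by (rule integral_norm_bound)
      also have "\<dots> \<le> (LINT y|lebesgue. (W \<xi>\<^sub>0 + e) * p y)"
      proof (rule integral_mono_AE)
        show "integrable lebesgue (\<lambda>y. norm (h y * complex_of_real (p y)))" by (rule integrable_norm[OF hs(1)[OF ps]])
        show "integrable lebesgue (\<lambda>y. (W \<xi>\<^sub>0 + e) * p y)"
          using ip by (subst integrable_completion) auto
        show "AE y in lebesgue. norm (h y * complex_of_real (p y)) \<le> (W \<xi>\<^sub>0 + e) * p y"
          using hW
        proof eventually_elim
          case (elim y)
          show ?case
          proof (cases "dist y \<xi>\<^sub>0 < d")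
            case True
            then have "W y \<le> W \<xi>\<^sub>0 + e" using d1(2)[of y] by (simp add: d_def dist_real_def)
            then show ?thesis using elim p0(1)[of y] by (auto simp: norm_mult intro!: mult_right_mono)
          qed (use p0 in auto)
        qed
      qed
      also have "\<dots> = (LINT y|lborel. (W \<xi>\<^sub>0 + e) * p y)" by (rule integral_completion) measurable
      finally show ?thesis by simp
    qed
    have "ft k' \<xi>\<^sub>0 * complex_of_real (LINT y|lborel. p y) = (LINT y|lborel. ft k' \<xi>\<^sub>0 * complex_of_real (p y))"
      by (simp add: integral_complex_of_real)
    also have "\<dots> = (LINT y|lborel. ft k' y * complex_of_real (p y)) - (LINT y|lborel. (ft k' y - ft k' \<xi>\<^sub>0) * complex_of_real (p y))"
      using i1 ip by (simp add: left_diff_distrib)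
    finally have "norm (ft k' \<xi>\<^sub>0 * complex_of_real (LINT y|lborel. p y)) \<le>
        norm (LINT y|lborel. ft k' y * complex_of_real (p y)) + norm (LINT y|lborel. (ft k' y - ft k' \<xi>\<^sub>0) * complex_of_real (p y))"
      using norm_triangle_ineq4 by metis
    also have "norm (LINT y|lborel. ft k' y * complex_of_real (p y)) \<le> (W \<xi>\<^sub>0 + e) * (LINT y|lborel. p y)"
      using up hs(2)[OF ps] lhs by simp
    also have "norm (LINT y|lborel. (ft k' y - ft k' \<xi>\<^sub>0) * complex_of_real (p y)) \<le> (LINT y|lborel. e * p y)"
    proof (rule order_trans[OF integral_norm_bound], rule integral_mono)
      show "integrable lborel (\<lambda>y. norm ((ft k' y - ft k' \<xi>\<^sub>0) * complex_of_real (p y)))"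
        unfolding left_diff_distrib using i1 ip by (intro integrable_norm Bochner_Integration.integrable_diff integrable_mult_right) auto
      show "integrable lborel (\<lambda>y. e * p y)" using ip by simp
      fix y
      show "norm ((ft k' y - ft k' \<xi>\<^sub>0) * complex_of_real (p y)) \<le> e * p y"
      proof (cases "dist y \<xi>\<^sub>0 < d")
        case True
        then show ?thesis using d2(2)[of y] p0(1)[of y] by (auto simp: d_def dist_norm norm_mult intro!: mult_right_mono)
      qed (use p0 in auto)
    qed
    also have "(LINT y|lborel. e * p y) = e * (LINT y|lborel. p y)" by simp
    finally have "norm (ft k' \<xi>\<^sub>0) * (LINT y|lborel. p y) \<le> (W \<xi>\<^sub>0 + e0) * (LINT y|lborel. p y)"
      using mp by (simp add: norm_mult e_def algebra_simps)
    then show "norm (ft k' \<xi>\<^sub>0) \<le> W \<xi>\<^sub>0 + e0" using mp by simp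
  qed
  then show ?thesis unfolding W_def by blast
qed

section \<open>Functions as distributions\<close>

lemma integrable_mult_continuous_bounded:
  fixes g \<psi> :: "'a::euclidean_space \<Rightarrow> complex"
  assumes g: "integrable lborel g" and \<psi>: "continuous_on UNIV \<psi>" "\<And>x. norm (\<psi> x) \<le> M"
  shows "integrable lborel (\<lambda>x. g x * \<psi> x)" "norm (distr_of_fun g \<psi>) \<le> (LINT x|lborel. norm (g x)) * M"
    "integrable lebesgue (\<lambda>x. g x * \<psi> x)"
proof -
  have [measurable]: "g \<in> borel_measurable borel" "\<psi> \<in> borel_measurable borel"
    using g borel_measurable_continuous_onI[OF \<psi>(1)] by auto
  have b: "norm (g x * \<psi> x) \<le> norm (g x) * M" for x
    unfolding norm_mult by (intro mult_left_mono \<psi>) auto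
  have i: "integrable lborel (\<lambda>x. norm (g x) * M)" using g by simp
  show gi: "integrable lborel (\<lambda>x. g x * \<psi> x)"
    by (rule Bochner_Integration.integrable_bound[OF i])
      (auto intro!: AE_I2 order_trans[OF b abs_ge_self])
  then show "integrable lebesgue (\<lambda>x. g x * \<psi> x)" by (subst integrable_completion) auto
  have "distr_of_fun g \<psi> = (LINT x|lborel. g x * \<psi> x)"
    unfolding distr_of_fun_def by (rule integral_completion) measurable
  also have "norm \<dots> \<le> (LINT x|lborel. norm (g x * \<psi> x))" by (rule integral_norm_bound)
  also have "\<dots> \<le> (LINT x|lborel. norm (g x) * M)"
    by (intro integral_mono integrable_norm gi i b)
  finally show "norm (distr_of_fun g \<psi>) \<le> (LINT x|lborel. norm (g x)) * M" using g by simp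
qed

lemma linear_functional_distr_of_fun:
  fixes g :: "'a::euclidean_space \<Rightarrow> complex"
  assumes g: "integrable lborel g"
    and V: "\<And>\<psi>. \<psi> \<in> V \<Longrightarrow> continuous_on UNIV \<psi> \<and> (\<exists>M. \<forall>x. norm (\<psi> x) \<le> M)"
  shows "linear_functional_on V (distr_of_fun g)"
proof -
  have i: "integrable lebesgue (\<lambda>x. g x * \<psi> x)" if "\<psi> \<in> V" for \<psi>
    using V[OF that] integrable_mult_continuous_bounded(3)[OF g] by blast
  show ?thesis
    unfolding linear_functional_on_def distr_of_fun_def
  proof (intro conjI ballI allI)
    fix \<psi> \<omega> assume "\<psi> \<in> V" "\<omega> \<in> V"
    then show "(LINT x|lebesgue. g x * (\<psi> x + \<omega> x)) = (LINT x|lebesgue. g x * \<psi> x) + (LINT x|lebesgue. g x * \<omega> x)"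
      unfolding distrib_left by (intro Bochner_Integration.integral_add i)
  next
    fix \<psi> c
    have "(LINT x|lebesgue. g x * (c * \<psi> x)) = (LINT x|lebesgue. c * (g x * \<psi> x))" by (simp add: mult_ac)
    then show "(LINT x|lebesgue. g x * (c * \<psi> x)) = c * (LINT x|lebesgue. g x * \<psi> x)" by simp
  qed
qed

lemma test_function_bounded:
  assumes "\<psi> \<in> test_functions" shows "continuous_on UNIV \<psi> \<and> (\<exists>M. \<forall>x. norm (\<psi> x) \<le> M)"
proof -
  have s: "smooth_on UNIV \<psi>" and c: "compact (closure {x. \<psi> x \<noteq> 0})" using assms unfolding test_functions_def by auto
  obtain R where R: "\<forall>x\<in>closure {x. \<psi> x \<noteq> 0}. norm x \<le> R" using compact_imp_bounded[OF c] bounded_iff by blast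
  have "\<psi> x = 0" if "norm x > R" for x
    using R closure_subset[of "{x. \<psi> x \<noteq> 0}"] that by force
  then show ?thesis using compact_supp_bounded[OF smooth_on_continuous[OF s]] smooth_on_continuous[OF s] by blast
qed

lemma schwartzD:
  "\<psi> \<in> schwartz \<Longrightarrow> set vs \<subseteq> Basis \<Longrightarrow> \<exists>C. \<forall>x. (1 + norm x) ^ N * norm (partials vs \<psi> x) \<le> C"
  unfolding schwartz_def by blast

lemma schwartz_bounded:
  assumes "\<psi> \<in> schwartz" shows "continuous_on UNIV \<psi> \<and> (\<exists>M. \<forall>x. norm (\<psi> x) \<le> M)"
proof -
  have s: "smooth_on UNIV \<psi>" using assms unfolding schwartz_def by blast
  have "\<exists>C. \<forall>x. (1 + norm x) ^ 0 * norm (partials [] \<psi> x) \<le> C"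
    by (rule schwartzD[OF assms]) simp
  then show ?thesis using smooth_on_continuous[OF s] by simp
qed

lemma distribution_distr_of_fun:
  fixes g :: "'a::euclidean_space \<Rightarrow> complex"
  assumes g: "integrable lborel g" shows "distribution (distr_of_fun g)"
  unfolding distribution_def
proof (intro conjI allI impI)
  show "linear_functional_on test_functions (distr_of_fun g)"
    by (rule linear_functional_distr_of_fun[OF g test_function_bounded])
  fix K :: "'a set" assume "compact K"
  show "\<exists>C N. \<forall>\<psi>\<in>test_functions. \<forall>M. {x. \<psi> x \<noteq> 0} \<subseteq> K \<longrightarrow>
        (\<forall>vs x. set vs \<subseteq> Basis \<longrightarrow> length vs \<le> N \<longrightarrow> norm (partials vs \<psi> x) \<le> M) \<longrightarrow>
        norm (distr_of_fun g \<psi>) \<le> C * M"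
  proof (intro exI[of _ "LINT x|lborel. norm (g x)"] exI[of _ 0] ballI allI impI)
    fix \<psi> :: "'a \<Rightarrow> complex" and M
    assume \<psi>: "\<psi> \<in> test_functions" and M: "\<forall>vs x. set vs \<subseteq> Basis \<longrightarrow> length vs \<le> 0 \<longrightarrow> norm (partials vs \<psi> x) \<le> M"
    have "norm (\<psi> x) \<le> M" for x using M[rule_format, of "[]" x] by simp
    then show "norm (distr_of_fun g \<psi>) \<le> (LINT x|lborel. norm (g x)) * M"
      using test_function_bounded[OF \<psi>] by (intro integrable_mult_continuous_bounded(2)[OF g]) auto
  qed
qed

lemma tempered_distr_of_fun:
  fixes g :: "'a::euclidean_space \<Rightarrow> complex"
  assumes g: "integrable lborel g" shows "tempered_distribution (distr_of_fun g)"
  unfolding tempered_distribution_def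
proof (intro conjI)
  show "linear_functional_on schwartz (distr_of_fun g)"
    by (rule linear_functional_distr_of_fun[OF g schwartz_bounded])
  show "\<exists>C N. \<forall>\<psi>\<in>schwartz. \<forall>M.
        (\<forall>vs x. set vs \<subseteq> Basis \<longrightarrow> length vs \<le> N \<longrightarrow> (1 + norm x) ^ N * norm (partials vs \<psi> x) \<le> M) \<longrightarrow>
        norm (distr_of_fun g \<psi>) \<le> C * M"
  proof (intro exI[of _ "LINT x|lborel. norm (g x)"] exI[of _ 0] ballI allI impI)
    fix \<psi> :: "'a \<Rightarrow> complex" and M
    assume \<psi>: "\<psi> \<in> schwartz" and M: "\<forall>vs x. set vs \<subseteq> Basis \<longrightarrow> length vs \<le> 0 \<longrightarrow> (1 + norm x) ^ 0 * norm (partials vs \<psi> x) \<le> M"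
    have "norm (\<psi> x) \<le> M" for x using M[rule_format, of "[]" x] by simp
    then show "norm (distr_of_fun g \<psi>) \<le> (LINT x|lborel. norm (g x)) * M"
      using schwartz_bounded[OF \<psi>] by (intro integrable_mult_continuous_bounded(2)[OF g]) auto
  qed
qed

text \<open>On the real line two powers of decay suffice, by comparison with 1/(1 + x^2).\<close>

lemma schwartz_integrable_real:
  fixes \<psi> :: "real \<Rightarrow> complex"
  assumes \<psi>: "\<psi> \<in> schwartz" shows "integrable lborel \<psi>"
proof -
  have "\<exists>C. \<forall>x. (1 + norm x) ^ 2 * norm (partials [] \<psi> x) \<le> C"
    by (rule schwartzD[OF \<psi>]) simp
  then obtain C where C: "\<And>x. (1 + \<bar>x\<bar>)\<^sup>2 * norm (\<psi> x) \<le> C" by auto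
  have [measurable]: "\<psi> \<in> borel_measurable borel"
    using schwartz_bounded[OF \<psi>] by (intro borel_measurable_continuous_onI) auto
  have i: "integrable lborel (\<lambda>x::real. C * inverse (1 + x^2))"
    using integrable_inverse_1_plus_square
    by (intro integrable_mult_right) (simp add: set_integrable_def einterval_def)
  show ?thesis
  proof (rule Bochner_Integration.integrable_bound[OF i])
    show "AE x in lborel. norm (\<psi> x) \<le> norm (C * inverse (1 + x\<^sup>2))"
    proof (intro AE_I2)
      fix x :: real
      have p: "1 + x\<^sup>2 > 0" by (rule add_pos_nonneg) auto
      have "(1 + x\<^sup>2) * norm (\<psi> x) \<le> (1 + \<bar>x\<bar>)\<^sup>2 * norm (\<psi> x)"
        by (intro mult_right_mono) (auto simp: power2_sum)
      also have "\<dots> \<le> C" by (rule C)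
      finally have "norm (\<psi> x) \<le> C * inverse (1 + x\<^sup>2)" using p by (simp add: field_simps)
      then show "norm (\<psi> x) \<le> norm (C * inverse (1 + x\<^sup>2))" by simp
    qed
  qed auto
qed

text \<open>Reduces the distributional notion to one weighted integral: \<eta> itself serves as the
  localising test function, and the transform of the localised distribution is represented by
  \<open>ft\<close> of the product \<eta> H.\<close>

lemma H_locally_near_real:
  fixes H \<eta> :: "real \<Rightarrow> real"
  assumes H: "bbs H" and \<eta>: "smooth_on UNIV \<eta>" "\<And>x. norm x > R \<Longrightarrow> \<eta> x = 0" "\<eta> s \<noteq> 0"
    and fin: "(\<integral>\<^sup>+\<sigma>. ennreal ((1 + \<sigma>\<^sup>2) powr \<beta> * (norm (ft (\<lambda>x. \<eta> x * H x) \<sigma>))\<^sup>2) \<partial>lborel) < \<infinity>"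
  shows "fun_H_locally_near \<beta> 2 s (\<lambda>x. complex_of_real (H x))"
proof -
  have iH: "integrable lborel (\<lambda>x. complex_of_real (H x))" using bbs_integrable[OF H] by simp
  have b\<eta>: "bbs \<eta>" by (rule bbs_smooth[OF \<eta>(1,2)])
  let ?g = "\<lambda>x. complex_of_real (\<eta> x * H x)"
  have b: "bbs (\<lambda>x. \<eta> x * H x)" by (rule bbs_mult[OF b\<eta> H])
  have ig: "integrable lborel ?g" using bbs_integrable[OF b] by (simp only: complex_of_real_integrable_eq)
  have [measurable]: "H \<in> borel_measurable borel" "\<eta> \<in> borel_measurable borel" by (intro bbs_measurable H b\<eta>)+
  have [measurable]: "ft (\<lambda>x. \<eta> x * H x) \<in> borel_measurable borel" by (intro ft_measurable bbs_integrable b)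
  have li: "locally_integrable (\<lambda>x. complex_of_real (H x))"
    unfolding locally_integrable_def set_integrable_def
  proof (intro allI impI)
    fix K :: "real set" assume "compact K"
    then have [measurable]: "K \<in> sets borel" by (simp add: borel_compact)
    have "integrable lborel (\<lambda>x. indicator K x *\<^sub>R complex_of_real (H x))"
      by (rule integrable_mult_indicator[OF _ iH]) simp
    then show "integrable lebesgue (\<lambda>x. indicator K x *\<^sub>R complex_of_real (H x))"
      by (subst integrable_completion) auto
  qed
  have \<eta>t: "(\<lambda>x. complex_of_real (\<eta> x)) \<in> test_functions"
  proof -
    have "norm x \<le> R" if "\<eta> x \<noteq> 0" for x using \<eta>(2)[of x] that by linarith
    then have "{x. complex_of_real (\<eta> x) \<noteq> 0} \<subseteq> cball 0 R" by auto
    then have "bounded {x. complex_of_real (\<eta> x) \<noteq> 0}" by (rule bounded_subset[OF bounded_cball])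
    then show ?thesis unfolding test_functions_def
      using smooth_on_of_real[OF open_UNIV \<eta>(1)] by (simp add: compact_closure)
  qed
  have Teq: "(\<lambda>\<psi>. distr_of_fun (\<lambda>x. complex_of_real (H x)) (\<lambda>x. complex_of_real (\<eta> x) * \<psi> x)) = distr_of_fun ?g"
    by (rule ext) (simp add: distr_of_fun_def mult_ac)
  have "distr_of_fun ?g \<in> H_space \<beta> 2"
    unfolding H_space_def
  proof (intro CollectI conjI exI[of _ "ft (\<lambda>x. \<eta> x * H x)"] ballI)
    show "tempered_distribution (distr_of_fun ?g)" by (rule tempered_distr_of_fun[OF ig])
    show "ft (\<lambda>x. \<eta> x * H x) \<in> borel_measurable lebesgue" by (rule measurable_completion) measurable
    fix \<psi> :: "real \<Rightarrow> complex" assume \<psi>: "\<psi> \<in> schwartz"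
    have i\<psi>: "integrable lborel \<psi>" by (rule schwartz_integrable_real[OF \<psi>])
    have [measurable]: "\<psi> \<in> borel_measurable borel" using i\<psi> by auto
    have cb: "integrable lborel (\<lambda>\<xi>. \<psi> \<xi> * ft (\<lambda>x. \<eta> x * H x) \<xi>)"
      by (rule integrable_mult_continuous_bounded(1)[OF i\<psi> continuous_on_ft[OF bbs_integrable[OF b]] ft_bound[OF bbs_integrable[OF b]]])
    then show "integrable lebesgue (\<lambda>\<xi>. ft (\<lambda>x. \<eta> x * H x) \<xi> * \<psi> \<xi>)"
      by (subst integrable_completion) (auto simp: mult.commute)
    have F\<psi>: "fourier \<psi> x = (LINT y|lborel. cis (- (y \<bullet> x)) * \<psi> y)" for x
      unfolding fourier_def cis_conv_exp by (subst integral_completion) auto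
    have [measurable]: "fourier \<psi> \<in> borel_measurable borel"
      unfolding F\<psi>[abs_def] by measurable
    have "fourier_distr (distr_of_fun ?g) \<psi> = (LINT x|lborel. ?g x * fourier \<psi> x)"
      unfolding fourier_distr_def distr_of_fun_def by (rule integral_completion) measurable
    \<comment> \<open>Both factors are integrable, so the distributional transform agrees with the
      pointwise one.\<close>
    also have "\<dots> = (LINT y|lborel. (LINT x|lborel. cis (- (x \<bullet> y)) * ?g x) * \<psi> y)"
      unfolding F\<psi> by (rule fourier_swap[OF ig i\<psi>])
    also have "\<dots> = (LINT y|lborel. ft (\<lambda>x. \<eta> x * H x) y * \<psi> y)" by (simp add: ft_def)
    also have "\<dots> = distr_of_fun (ft (\<lambda>x. \<eta> x * H x)) \<psi>"
      unfolding distr_of_fun_def by (rule integral_completion[symmetric]) measurable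
    finally show "fourier_distr (distr_of_fun ?g) \<psi> = distr_of_fun (ft (\<lambda>x. \<eta> x * H x)) \<psi>" .
  next
    have "(\<integral>\<^sup>+\<xi>. ennreal (norm (complex_of_real ((1 + (norm \<xi>)\<^sup>2) powr (\<beta> / 2)) * ft (\<lambda>x. \<eta> x * H x) \<xi>) powr enn2real 2) \<partial>lborel)
      = (\<integral>\<^sup>+\<sigma>. ennreal ((1 + \<sigma>\<^sup>2) powr \<beta> * (norm (ft (\<lambda>x. \<eta> x * H x) \<sigma>))\<^sup>2) \<partial>lborel)"
    proof (intro nn_integral_cong arg_cong[where f=ennreal])
      fix \<xi> :: real
      have p: "1 + \<xi>\<^sup>2 > 0" by (rule add_pos_nonneg) auto
      have "((1 + \<xi>\<^sup>2) powr (\<beta> / 2))\<^sup>2 = (1 + \<xi>\<^sup>2) powr \<beta>" by (simp add: power2_eq_square powr_add[symmetric])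
      then show "norm (complex_of_real ((1 + (norm \<xi>)\<^sup>2) powr (\<beta> / 2)) * ft (\<lambda>x. \<eta> x * H x) \<xi>) powr enn2real 2 =
          (1 + \<xi>\<^sup>2) powr \<beta> * (norm (ft (\<lambda>x. \<eta> x * H x) \<xi>))\<^sup>2"
        by (simp add: powr_numeral norm_mult power_mult_distrib)
    qed
    then show "finite_Lp 2 (\<lambda>\<xi>. complex_of_real ((1 + (norm \<xi>)\<^sup>2) powr (\<beta> / 2)) * ft (\<lambda>x. \<eta> x * H x) \<xi>)"
      unfolding finite_Lp_def nn_integral_completion using fin by simp
  qed
  then show ?thesis
    unfolding fun_H_locally_near_def H_locally_near_def
    using li distribution_distr_of_fun[OF iH] \<eta>t \<eta>(3) Teq by (intro conjI bexI[OF _ \<eta>t]) auto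
qed

section \<open>The non-linear transform near a transversal line\<close>

lemma weighted_add:
  fixes u v :: "real \<Rightarrow> complex"
  assumes [measurable]: "u \<in> borel_measurable borel" "v \<in> borel_measurable borel" "W \<in> borel_measurable borel"
    and W: "\<And>\<sigma>. W \<sigma> \<ge> 0"
    and fin: "(\<integral>\<^sup>+\<sigma>. ennreal (W \<sigma> * (norm (u \<sigma>))\<^sup>2) \<partial>lborel) < \<infinity>" "(\<integral>\<^sup>+\<sigma>. ennreal (W \<sigma> * (norm (v \<sigma>))\<^sup>2) \<partial>lborel) < \<infinity>"
  shows "(\<integral>\<^sup>+\<sigma>. ennreal (W \<sigma> * (norm (u \<sigma> + v \<sigma>))\<^sup>2) \<partial>lborel) < \<infinity>"
proof -
  have "(\<integral>\<^sup>+\<sigma>. ennreal (W \<sigma> * (norm (u \<sigma> + v \<sigma>))\<^sup>2) \<partial>lborel) \<le>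
      (\<integral>\<^sup>+\<sigma>. ennreal 2 * ennreal (W \<sigma> * (norm (u \<sigma>))\<^sup>2) + ennreal 2 * ennreal (W \<sigma> * (norm (v \<sigma>))\<^sup>2) \<partial>lborel)"
  proof (intro nn_integral_mono)
    fix \<sigma>
    have "(norm (u \<sigma> + v \<sigma>))\<^sup>2 \<le> (norm (u \<sigma>) + norm (v \<sigma>))\<^sup>2" by (intro power_mono norm_triangle_ineq) auto
    also have "\<dots> \<le> 2 * (norm (u \<sigma>))\<^sup>2 + 2 * (norm (v \<sigma>))\<^sup>2"
      using zero_le_power2[of "norm (u \<sigma>) - norm (v \<sigma>)"] by (simp add: power2_sum power2_diff)
    finally have "W \<sigma> * (norm (u \<sigma> + v \<sigma>))\<^sup>2 \<le> W \<sigma> * (2 * (norm (u \<sigma>))\<^sup>2 + 2 * (norm (v \<sigma>))\<^sup>2)"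
      by (intro mult_left_mono W)
    also have "\<dots> = 2 * (W \<sigma> * (norm (u \<sigma>))\<^sup>2) + 2 * (W \<sigma> * (norm (v \<sigma>))\<^sup>2)" by (simp add: algebra_simps)
    finally have "ennreal (W \<sigma> * (norm (u \<sigma> + v \<sigma>))\<^sup>2) \<le> ennreal (2 * (W \<sigma> * (norm (u \<sigma>))\<^sup>2) + 2 * (W \<sigma> * (norm (v \<sigma>))\<^sup>2))"
      by (rule ennreal_leI)
    also have "\<dots> = ennreal (2 * (W \<sigma> * (norm (u \<sigma>))\<^sup>2)) + ennreal (2 * (W \<sigma> * (norm (v \<sigma>))\<^sup>2))"
      using W by (intro ennreal_plus) auto
    also have "\<dots> = ennreal 2 * ennreal (W \<sigma> * (norm (u \<sigma>))\<^sup>2) + ennreal 2 * ennreal (W \<sigma> * (norm (v \<sigma>))\<^sup>2)"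
      using W by (intro arg_cong2[where f="(+)"] ennreal_mult) auto
    finally show "ennreal (W \<sigma> * (norm (u \<sigma> + v \<sigma>))\<^sup>2) \<le> \<dots>" .
  qed
  also have "\<dots> = ennreal 2 * (\<integral>\<^sup>+\<sigma>. ennreal (W \<sigma> * (norm (u \<sigma>))\<^sup>2) \<partial>lborel) + ennreal 2 * (\<integral>\<^sup>+\<sigma>. ennreal (W \<sigma> * (norm (v \<sigma>))\<^sup>2) \<partial>lborel)"
    by (subst nn_integral_add) (auto simp: nn_integral_cmult)
  also have "\<dots> < \<infinity>" using fin by (simp add: ennreal_mult_less_top)
  finally show ?thesis .
qed

text \<open>One minus the product of the complements is smooth and equals 1 wherever some plateau
  does, without division by a sum. The induction peels off one ball and multiplies the amplitude by
  the complement of its plateau, hence A is free.\<close>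

lemma weighted_partition:
  fixes k g A :: "real^2 \<Rightarrow> real"
  assumes F: "finite F" "\<And>p. p \<in> F \<Longrightarrow> r p > 0 \<and> adapted \<Omega> (unit_vec \<theta>) (line_dir \<theta>) (q p) (cball p (r p))"
    and \<Omega>: "\<Omega> \<in> sets borel" and A: "smooth_on UNIV A" "\<And>x. norm x > R \<Longrightarrow> A x = 0"
    and k: "integrable lborel k" "\<And>x. norm x > T \<Longrightarrow> k x = 0" and g: "bbs g"
    and decay: "\<And>\<xi>. norm (ft k \<xi>) \<le> D * (1 + (norm \<xi>)\<^sup>2) powr (- lam / 2)"
    and \<beta>: "0 \<le> \<beta>" "\<beta> < lam"
  shows "(\<integral>\<^sup>+\<sigma>. ennreal ((1 + \<sigma>\<^sup>2) powr \<beta> *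
    (norm (ft (\<lambda>x. indicator \<Omega> x * (((1 - (\<Prod>p\<in>F. 1 - plateau p (r p) x)) * A x) * exp (- conv k g x))) (\<sigma> *\<^sub>R unit_vec \<theta>)))\<^sup>2) \<partial>lborel) < \<infinity>"
  using F A
proof (induction F arbitrary: A rule: finite_induct)
  case empty
  show ?case by (simp add: ft_def)
next
  case (insert p F)
  let ?P = "plateau p (r p)"
  note A = insert.prems(2,3)
  have r: "r p > 0" and ad: "adapted \<Omega> (unit_vec \<theta>) (line_dir \<theta>) (q p) (cball p (r p))"
    using insert.prems(1)[of p] by auto
  have bC: "bbs (conv k g)" by (rule bbs_conv[OF k g])
  have s1: "smooth_on UNIV (\<lambda>x. ?P x * A x)" "smooth_on UNIV (\<lambda>x. (1 - ?P x) * A x)"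
    by (intro smooth_on_mult smooth_on_minus_const smooth_on_plateau A open_UNIV)+
  have s2: "smooth_on UNIV (\<lambda>x. (\<Prod>p\<in>F. 1 - plateau p (r p) x))"
    using insert.hyps(1)
    by (induction F rule: finite_induct)
      (auto intro!: smooth_on_const smooth_on_mult smooth_on_minus_const smooth_on_plateau)
  let ?u = "\<lambda>x. indicator \<Omega> x * ((?P x * A x) * exp (- conv k g x))"
  let ?v = "\<lambda>x. indicator \<Omega> x * (((1 - (\<Prod>p\<in>F. 1 - plateau p (r p) x)) * ((1 - ?P x) * A x)) * exp (- conv k g x))"
  have b: "bbs ?u" "bbs ?v"
    by (intro bbs_indicator \<Omega> bbs_mult_exp bC bbs_smooth[of _ R] s1 smooth_on_mult smooth_on_minus_const s2 open_UNIV; simp add: A)+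
  note m = ft_line_measurable[OF bbs_integrable]
  \<comment> \<open>With P the new plateau and Q the product over F this is 1 - (1-P)Q = P +
    (1-P)(1-Q).\<close>
  have eq: "indicator \<Omega> x * (((1 - (\<Prod>p\<in>insert p F. 1 - plateau p (r p) x)) * A x) * exp (- conv k g x)) = ?u x + ?v x" for x
    using insert.hyps by (simp add: algebra_simps)
  have "(\<integral>\<^sup>+\<sigma>. ennreal ((1 + \<sigma>\<^sup>2) powr \<beta> * (norm (ft ?u (\<sigma> *\<^sub>R unit_vec \<theta>) + ft ?v (\<sigma> *\<^sub>R unit_vec \<theta>)))\<^sup>2) \<partial>lborel) < \<infinity>"
  proof (rule weighted_add[OF m[OF b(1)] m[OF b(2)]])
    show "(\<integral>\<^sup>+\<sigma>. ennreal ((1 + \<sigma>\<^sup>2) powr \<beta> * (norm (ft ?u (\<sigma> *\<^sub>R unit_vec \<theta>)))\<^sup>2) \<partial>lborel) < \<infinity>"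
    proof (rule weighted_nonlinear[OF ad \<Omega> _ _ s1(1) _ k g decay \<beta>])
      show "cball p (r p) \<subseteq> cball 0 (norm p + r p)"
      proof
        fix x assume "x \<in> cball p (r p)"
        then show "x \<in> cball 0 (norm p + r p)"
          using norm_triangle_ineq2[of x p] by (simp add: dist_norm norm_minus_commute)
      qed
      show "?P x * A x = 0" if "x \<notin> cball p (r p)" for x
        using plateau_0[OF r, of p x] that by simp
    qed (use r in auto)
    show "(\<integral>\<^sup>+\<sigma>. ennreal ((1 + \<sigma>\<^sup>2) powr \<beta> * (norm (ft ?v (\<sigma> *\<^sub>R unit_vec \<theta>)))\<^sup>2) \<partial>lborel) < \<infinity>"
      by (rule insert.IH) (use insert.prems(1) s1(2) A in auto)
  qed auto
  then show ?case unfolding eq ft_add[OF bbs_integrable[OF b(1)] bbs_integrable[OF b(2)]] .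
qed

section \<open>Rays and the V-line transform on a ball\<close>

definition ray :: "('a::euclidean_space \<Rightarrow> real) \<Rightarrow> 'a \<Rightarrow> 'a \<Rightarrow> real" where
  "ray f d x = (LINT t|lborel. indicator {0..} t * f (x + t *\<^sub>R d))"

lemma ray_measurable [measurable]:
  assumes [measurable]: "f \<in> borel_measurable borel" shows "ray f d \<in> borel_measurable borel"
  unfolding ray_def[abs_def] by measurable

lemma set_integral_ray:
  assumes [measurable]: "f \<in> borel_measurable borel"
  shows "(LINT t:{0..}|lebesgue. f (x + t *\<^sub>R d)) = ray f d x"
  unfolding set_lebesgue_integral_def ray_def by (subst integral_completion) auto

text \<open>A ray from a point of norm at most R has left the ball of radius T once t exceeds R +
  T.\<close>

lemma ray_bound:
  fixes f :: "'a::euclidean_space \<Rightarrow> real"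
  assumes f: "f \<in> borel_measurable borel" "\<And>x. \<bar>f x\<bar> \<le> C" "\<And>x. norm x > T \<Longrightarrow> f x = 0"
    and d: "norm d = 1" and x: "norm x \<le> R" and RT: "R + T \<ge> 0"
  shows "\<bar>ray f d x\<bar> \<le> C * (2 * (R + T))"
proof -
  have [measurable]: "f \<in> borel_measurable borel" by (rule f)
  have C0: "C \<ge> 0" using f(2)[of 0] by linarith
  have le: "\<bar>indicator {0..} t * f (x + t *\<^sub>R d)\<bar> \<le> C * indicator (cball (0::real) (R + T)) t" for t :: real
  proof (cases "\<bar>t\<bar> > R + T")
    case True
    have "norm (x + t *\<^sub>R d) \<ge> \<bar>t\<bar> - norm x"
      using norm_diff_ineq[of "t *\<^sub>R d" x] d by (simp add: add.commute)
    then show ?thesis using True x f(3)[of "x + t *\<^sub>R d"] C0 by simp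
  qed (use f(2) C0 in \<open>auto simp: indicator_def\<close>)
  have i: "integrable lborel (\<lambda>t. C * indicator (cball (0::real) (R + T)) t)" by (rule integrable_indicator_cball)
  have "\<bar>ray f d x\<bar> \<le> (LINT t|lborel. \<bar>indicator {0..} t * f (x + t *\<^sub>R d)\<bar>)"
    unfolding ray_def by (rule integral_abs_bound)
  also have "\<dots> \<le> (LINT t|lborel. C * indicator (cball (0::real) (R + T)) t)"
  proof (rule integral_mono[OF _ i le])
    show "integrable lborel (\<lambda>t. \<bar>indicator {0..} t * f (x + t *\<^sub>R d)\<bar>)"
      by (rule Bochner_Integration.integrable_bound[OF i]) (auto intro!: AE_I2 order_trans[OF le] mult_right_mono)
  qed
  also have "\<dots> = C * (2 * (R + T))" using RT by (simp add: cball_eq_atLeastAtMost)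
  finally show ?thesis .
qed

lemma norm_unit_vec: "norm (unit_vec \<theta>) = 1"
  by (simp add: norm_eq_sqrt_inner inner_unit_vec_line_dir)

lemma vline_eq_ray:
  "f \<in> borel_measurable borel \<Longrightarrow>
    vline a b \<psi> f x \<phi> = a * ray f (unit_vec (\<phi> + 2 * \<psi> - pi / 2)) x + b * ray f (unit_vec (\<phi> - pi / 2)) x"
  unfolding vline_def by (simp only: set_integral_ray)

text \<open>The cutoff is essential: rays may reach the support of f from arbitrarily far away, so
  the transform itself need not have bounded support.\<close>

lemma bbs_vline_ball:
  assumes f: "bbs f" shows "bbs (\<lambda>x. indicator (cball 0 R) x * vline a b \<psi> f x \<phi>)"
proof -
  obtain C T where "C \<ge> 0 \<and> T > 0 \<and> (\<forall>x. \<bar>f x\<bar> \<le> C) \<and> (\<forall>x. norm x > T \<longrightarrow> f x = 0)"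
    using bbsD[OF f] by blast
  then have C: "C \<ge> 0" "T > 0" "\<And>x. \<bar>f x\<bar> \<le> C" "\<And>x. norm x > T \<Longrightarrow> f x = 0" by auto
  have fm [measurable]: "f \<in> borel_measurable borel" by (rule bbs_measurable[OF f])
  define M where "M = C * (2 * (\<bar>R\<bar> + T))"
  have M0: "M \<ge> 0" unfolding M_def using C by simp
  have rb: "\<bar>ray f (unit_vec \<alpha>) x\<bar> \<le> M" if "norm x \<le> R" for \<alpha> x
    unfolding M_def by (rule ray_bound[OF fm C(3,4) norm_unit_vec]) (use that C in auto)
  show ?thesis
  proof (rule bbsI[of _ "(\<bar>a\<bar> + \<bar>b\<bar>) * M" R])
    show "(\<lambda>x. indicator (cball 0 R) x * vline a b \<psi> f x \<phi>) \<in> borel_measurable borel"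
      unfolding vline_eq_ray[OF fm]
      by (intro borel_measurable_times borel_measurable_indicator borel_measurable_add borel_measurable_const ray_measurable fm) auto
    fix x :: "real^2"
    show "\<bar>indicator (cball 0 R) x * vline a b \<psi> f x \<phi>\<bar> \<le> (\<bar>a\<bar> + \<bar>b\<bar>) * M"
    proof (cases "norm x \<le> R")
      case True
      have "\<bar>vline a b \<psi> f x \<phi>\<bar> \<le> \<bar>a\<bar> * \<bar>ray f (unit_vec (\<phi> + 2 * \<psi> - pi / 2)) x\<bar> + \<bar>b\<bar> * \<bar>ray f (unit_vec (\<phi> - pi / 2)) x\<bar>"
        unfolding vline_eq_ray[OF fm] abs_mult[symmetric] by (rule abs_triangle_ineq)
      also have "\<dots> \<le> \<bar>a\<bar> * M + \<bar>b\<bar> * M" by (intro add_mono mult_left_mono rb True) auto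
      finally show ?thesis using True by (simp add: distrib_right)
    qed (use M0 in auto)
  qed auto
qed

text \<open>The kernel is merely Lebesgue measurable. The change on a null set is followed by a
  cutoff, so that the support bound holds at every point and not only almost everywhere.\<close>

lemma borel_representative:
  fixes k :: "'a::euclidean_space \<Rightarrow> real"
  assumes k: "integrable lebesgue k" and T: "\<And>x. norm x > T \<Longrightarrow> k x = 0"
  shows "\<exists>k'. integrable lborel k' \<and> (\<forall>x. norm x > T \<longrightarrow> k' x = 0) \<and> (AE x in lborel. k x = k' x)"
proof -
  have "k \<in> borel_measurable lebesgue" using k by auto
  then obtain k0 where k0: "k0 \<in> borel_measurable lborel" "AE x in lborel. k x = k0 x"
    using completion_ex_borel_measurable_real by blast
  define k' where "k' x = indicator (cball 0 T) x * k0 x" for x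
  have m: "k' \<in> borel_measurable borel"
    unfolding k'_def[abs_def] using k0(1) by (auto intro!: borel_measurable_times borel_measurable_indicator)
  have ae: "AE x in lborel. k x = k' x"
    using k0(2)
  proof eventually_elim
    case (elim x)
    then show ?case using T[of x] by (cases "norm x > T") (auto simp: k'_def)
  qed
  have "integrable lebesgue k'"
  proof (rule integrable_cong_AE_imp[OF k])
    show "k' \<in> borel_measurable lebesgue" by (rule measurable_completion) (use m in simp)
    show "AE x in lebesgue. k x = k' x" by (rule AE_completion[OF ae])
  qed
  then have "integrable lborel k'" using m by (subst (asm) integrable_completion) auto
  then show ?thesis using ae by (intro exI[of _ k']) (auto simp: k'_def)
qed

theorem theorem4p13:
  fixes a b \<psi> c\<^sub>0 lam \<beta> s\<^sub>0 \<theta>\<^sub>0 :: real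
    and w u f k :: "real^2 \<Rightarrow> real"
    and \<Omega> :: "(real^2) set"
  assumes "a > 0" and "b > 0" and "0 < 2 * \<psi>" and "2 * \<psi> < pi" and "c\<^sub>0 > 0"
    and w_smooth: "smooth_on UNIV w" and w_pos: "\<And>x. x \<in> ball 0 1 \<Longrightarrow> w x > 0"
    and k_nonneg: "\<And>x. k x \<ge> 0" and k_supp: "bounded {x. k x \<noteq> 0}"
    and k_int: "integrable lebesgue k" and k_mass: "(LINT x|lebesgue. k x) = 1"
    and \<Omega>: "compact_smooth_domain \<Omega>" "\<Omega> \<subseteq> ball 0 1"
    and u: "smooth_on UNIV u" and f: "f = (\<lambda>x. u x * indicator \<Omega> x)"
    and \<theta>\<^sub>0: "\<theta>\<^sub>0 \<in> {-pi..pi}"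
    and not_tangent: "\<not> line_tangent_to_boundary s\<^sub>0 \<theta>\<^sub>0 \<Omega>"
    and k_reg: "distr_of_fun (\<lambda>x. complex_of_real (k x)) \<in> H_space lam \<infinity>" and "lam > 1 / 2"
    and "\<beta> < lam"
  shows "fun_H_locally_near \<beta> 2 s\<^sub>0
    (\<lambda>s. complex_of_real (nonlinear_transform c\<^sub>0 w k a b \<psi> f s \<theta>\<^sub>0))"
proof -
  have lam: "lam > 0" using \<open>lam > 1 / 2\<close> by simp
  obtain T where T0: "\<forall>x\<in>{x. k x \<noteq> 0}. norm x \<le> T" using k_supp unfolding bounded_iff by blast
  have T: "k x = 0" if "norm x > T" for x using T0 that by force
  obtain k' where k': "integrable lborel k'" "\<And>x. norm x > T \<Longrightarrow> k' x = 0" and ae: "AE x in lborel. k x = k' x"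
    using borel_representative[OF k_int T] by blast
  have km: "k \<in> borel_measurable lebesgue" using k_int by auto
  obtain D where decay: "\<And>\<xi>. norm (ft k' \<xi>) \<le> D * (1 + (norm \<xi>)\<^sup>2) powr (- lam / 2)"
    using decay_from_H_space[OF k'(1) km ae k_reg lam] by blast
  have c\<Omega>: "compact \<Omega>" using \<Omega>(1) unfolding compact_smooth_domain_def by blast
  then have b\<Omega> [measurable]: "\<Omega> \<in> sets borel" by (simp add: borel_compact)
  \<comment> \<open>A cutoff that is 1 on the unit ball, and so on \<Omega>, gives the smooth
    factors bounded support without changing them where they count.\<close>
  have pl1: "plateau 0 2 x = 1" if "x \<in> \<Omega>" for x :: "real^2"
    using plateau_1[of 2 0 x] \<Omega>(2) that by (auto simp: subset_iff)
  have pl0: "plateau 0 2 x = 0" if "norm x > 2" for x :: "real^2"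
    using plateau_0[of 2 0 x] that by simp
  have f_eq: "f = (\<lambda>x. indicator \<Omega> x * (plateau 0 2 x * u x))"
    unfolding f using pl1 by (auto simp: indicator_def fun_eq_iff)
  have "bbs (\<lambda>x. plateau 0 2 x * u x)"
    by (rule bbs_smooth[of _ 2]) (auto intro: smooth_on_mult smooth_on_plateau u simp: pl0)
  then have bf: "bbs f" unfolding f_eq by (rule bbs_indicator) (rule b\<Omega>)
  \<comment> \<open>For x in \<Omega> and y in the support of the kernel, x - y has norm at most T +
    1, so the cutoff is invisible in the convolution on \<Omega>.\<close>
  define g where "g x = indicator (cball 0 (T + 1)) x * vline a b \<psi> f x \<theta>\<^sub>0" for x
  have bg: "bbs g" unfolding g_def[abs_def] by (rule bbs_vline_ball[OF bf])
  have G: "smoothed_vline k a b \<psi> f x \<theta>\<^sub>0 = conv k' g x" if x: "x \<in> \<Omega>" for x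
  proof -
    have [measurable]: "k' \<in> borel_measurable borel" "f \<in> borel_measurable borel" "g \<in> borel_measurable borel"
      using k'(1) bf bg by (auto intro: bbs_measurable)
    have vm [measurable]: "(\<lambda>y. vline a b \<psi> f y \<theta>\<^sub>0) \<in> borel_measurable borel"
      unfolding vline_eq_ray[OF bbs_measurable[OF bf]]
      by (intro borel_measurable_times borel_measurable_add borel_measurable_const ray_measurable bbs_measurable bf)
    have "smoothed_vline k a b \<psi> f x \<theta>\<^sub>0 = (LINT y|lebesgue. k y * vline a b \<psi> f (x - y) \<theta>\<^sub>0)"
      by (simp add: smoothed_vline_def Defs.convolution_def)
    also have "\<dots> = (LINT y|lebesgue. k' y * vline a b \<psi> f (x - y) \<theta>\<^sub>0)"
    proof (rule integral_cong_AE)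
      show "AE y in lebesgue. k y * vline a b \<psi> f (x - y) \<theta>\<^sub>0 = k' y * vline a b \<psi> f (x - y) \<theta>\<^sub>0"
        using AE_completion[OF ae] by eventually_elim simp
      have "(\<lambda>y. vline a b \<psi> f (x - y) \<theta>\<^sub>0) \<in> borel_measurable borel" by measurable
      then have m: "(\<lambda>y. vline a b \<psi> f (x - y) \<theta>\<^sub>0) \<in> borel_measurable lebesgue" "k' \<in> borel_measurable lebesgue"
        by (auto intro: measurable_completion)
      show "(\<lambda>y. k y * vline a b \<psi> f (x - y) \<theta>\<^sub>0) \<in> borel_measurable lebesgue"
        "(\<lambda>y. k' y * vline a b \<psi> f (x - y) \<theta>\<^sub>0) \<in> borel_measurable lebesgue"
        using km m by measurable
    qed
    also have "\<dots> = (LINT y|lborel. k' y * vline a b \<psi> f (x - y) \<theta>\<^sub>0)"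
      by (rule integral_completion) measurable
    also have "\<dots> = conv k' g x"
      unfolding conv_def
    proof (intro Bochner_Integration.integral_cong refl)
      fix y
      show "k' y * vline a b \<psi> f (x - y) \<theta>\<^sub>0 = k' y * g (x - y)"
      proof (cases "norm y > T")
        case False
        have "norm x < 1" using x \<Omega>(2) by (auto simp: subset_iff)
        then have "norm (x - y) \<le> T + 1" using norm_triangle_ineq4[of x y] False by linarith
        then show ?thesis by (simp add: g_def)
      qed (simp add: k')
    qed
    finally show ?thesis .
  qed
  define A1 where "A1 x = plateau 0 2 x * (c\<^sub>0 * (w x * u x))" for x
  have A1: "smooth_on UNIV A1" "\<And>x. norm x > 2 \<Longrightarrow> A1 x = 0"
    unfolding A1_def[abs_def] using pl0
    by (auto intro!: smooth_on_mult smooth_on_cmult smooth_on_const smooth_on_plateau w_smooth u)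
  define F1 where "F1 x = indicator \<Omega> x * (A1 x * exp (- conv k' g x))" for x
  have bC: "bbs (conv k' g)" by (rule bbs_conv[OF k' bg])
  have bF1: "bbs F1" unfolding F1_def[abs_def] by (intro bbs_indicator bbs_mult_exp bbs_smooth[OF A1] bC b\<Omega>)
  have F1_0: "F1 x = 0" if "norm x > 2" for x using A1(2)[OF that] by (simp add: F1_def)
  \<comment> \<open>On \<Omega> the cutoff is 1 and the smoothed transform is the convolution with
    g; off \<Omega> both integrands vanish, so the identity holds at every point.\<close>
  have nl: "nonlinear_transform c\<^sub>0 w k a b \<psi> f s \<theta>\<^sub>0 = slice \<theta>\<^sub>0 F1 s" for s
  proof -
    have [measurable]: "F1 \<in> borel_measurable borel" by (rule bbs_measurable[OF bF1])
    have "c\<^sub>0 * (w x * f x * exp (- smoothed_vline k a b \<psi> f x \<theta>\<^sub>0)) = F1 x" for x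
      using G[of x] pl1[of x] by (cases "x \<in> \<Omega>") (auto simp: F1_def A1_def f)
    then have "nonlinear_transform c\<^sub>0 w k a b \<psi> f s \<theta>\<^sub>0 = (LINT t|lebesgue. F1 (line_point \<theta>\<^sub>0 s t))"
      unfolding nonlinear_transform_def line_integral_def by (simp flip: integral_mult_right_zero)
    also have "\<dots> = slice \<theta>\<^sub>0 F1 s"
      unfolding slice_def by (rule integral_completion) measurable
    finally show ?thesis .
  qed
  obtain F r q \<epsilon> where F: "finite F" "\<epsilon> > 0"
      "\<forall>p\<in>F. r p > 0 \<and> adapted \<Omega> (unit_vec \<theta>\<^sub>0) (line_dir \<theta>\<^sub>0) (q p) (cball p (r p))"
      "\<forall>x\<in>\<Omega>. \<bar>x \<bullet> unit_vec \<theta>\<^sub>0 - s\<^sub>0\<bar> < \<epsilon> \<longrightarrow> (\<exists>p\<in>F. dist p x < r p / 2)"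
    using finite_adapted_cover[OF \<Omega>(1) not_tangent, of "unit_vec \<theta>\<^sub>0"] by blast
  \<comment> \<open>The support of \<eta> is matched to the strip that the adapted balls cover; as a
    function of x . \<Theta> it passes through the line integrals.\<close>
  define \<eta> where "\<eta> = plateau s\<^sub>0 \<epsilon>"
  define A2 where "A2 x = \<eta> (x \<bullet> unit_vec \<theta>\<^sub>0) * A1 x" for x
  have "smooth_on UNIV (\<lambda>x::real^2. \<eta> (x \<bullet> unit_vec \<theta>\<^sub>0))"
  proof -
    have "smooth_on UNIV (\<lambda>x. x \<bullet> unit_vec \<theta>\<^sub>0 + (- s\<^sub>0))"
      by (intro smooth_on_add smooth_on_inner smooth_on_const open_UNIV)
    then have "smooth_on UNIV (\<lambda>x. (x \<bullet> unit_vec \<theta>\<^sub>0 - s\<^sub>0) * (x \<bullet> unit_vec \<theta>\<^sub>0 - s\<^sub>0))"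
      by (intro smooth_on_mult open_UNIV) simp_all
    then show ?thesis
      unfolding \<eta>_def plateau_def inner_real_def
      by (intro smooth_on_step smooth_on_cmult smooth_on_minus_const open_UNIV)
  qed
  then have A2: "smooth_on UNIV A2" "\<And>x. norm x > 2 \<Longrightarrow> A2 x = 0"
    unfolding A2_def[abs_def] using A1 by (auto intro: smooth_on_mult)
  let ?E = "\<lambda>x. (1 - (\<Prod>p\<in>F. 1 - plateau p (r p) x)) * A2 x"
  \<comment> \<open>Inside the strip some plateau equals 1 and the product vanishes; outside it
    \<eta> vanishes. So the partition may be inserted on \<Omega> for free.\<close>
  have E: "indicator \<Omega> x * (A2 x * exp (- conv k' g x)) = indicator \<Omega> x * (?E x * exp (- conv k' g x))" for x
  proof (cases "x \<in> \<Omega> \<and> \<bar>x \<bullet> unit_vec \<theta>\<^sub>0 - s\<^sub>0\<bar> < \<epsilon>")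
    case True
    then obtain p where p: "p \<in> F" "dist p x < r p / 2" using F(4) by blast
    then have "plateau p (r p) x = 1" using F(3) by (intro plateau_1) auto
    then have "(\<Prod>p\<in>F. 1 - plateau p (r p) x) = 0" using p(1) F(1) by (intro prod_zero) auto
    then show ?thesis by simp
  next
    case False
    then consider "x \<notin> \<Omega>" | "\<bar>x \<bullet> unit_vec \<theta>\<^sub>0 - s\<^sub>0\<bar> \<ge> \<epsilon>" by linarith
    then show ?thesis
    proof cases
      case 2
      then have "\<eta> (x \<bullet> unit_vec \<theta>\<^sub>0) = 0"
        unfolding \<eta>_def by (intro plateau_0 F(2)) (simp add: dist_real_def abs_minus_commute)
      then show ?thesis by (simp add: A2_def)
    qed simp
  qed
  have "fun_H_locally_near \<beta> 2 s\<^sub>0 (\<lambda>s. complex_of_real (slice \<theta>\<^sub>0 F1 s))"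
  proof (rule H_locally_near_real[where \<eta>=\<eta> and R="norm s\<^sub>0 + \<epsilon>"])
    show "bbs (slice \<theta>\<^sub>0 F1)" by (rule bbs_slice(1)[where R=2, OF bF1 _ F1_0]) simp_all
    show "smooth_on UNIV \<eta>" unfolding \<eta>_def by (rule smooth_on_plateau)
    show "\<eta> x = 0" if "norm x > norm s\<^sub>0 + \<epsilon>" for x
      unfolding \<eta>_def by (rule plateau_support[OF F(2) that])
    show "\<eta> s\<^sub>0 \<noteq> 0" unfolding \<eta>_def using plateau_1[OF F(2), of s\<^sub>0 s\<^sub>0] F(2) by simp
    let ?F2 = "\<lambda>x. indicator \<Omega> x * (?E x * exp (- conv k' g x))"
    have F2: "?F2 x = \<eta> (x \<bullet> unit_vec \<theta>\<^sub>0) * F1 x" for x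
      unfolding E[symmetric] by (simp add: A2_def F1_def)
    have bF2: "bbs ?F2"
      unfolding E[symmetric] by (intro bbs_indicator bbs_mult_exp bbs_smooth[OF A2] bC b\<Omega>)
    have "slice \<theta>\<^sub>0 ?F2 = (\<lambda>s. \<eta> s * slice \<theta>\<^sub>0 F1 s)"
      unfolding F2 slice_def inner_line_point by simp
    then have ft_eq: "ft (\<lambda>s. \<eta> s * slice \<theta>\<^sub>0 F1 s) \<sigma> = ft ?F2 (\<sigma> *\<^sub>R unit_vec \<theta>\<^sub>0)" for \<sigma>
      using ft_slice[OF bF2, of \<theta>\<^sub>0 \<sigma>] by simp
    \<comment> \<open>The base 1 + \<sigma>^2 is at least 1, so a negative \<beta> may be raised to
      0, which is still below lam.\<close>
    have "(\<integral>\<^sup>+\<sigma>. ennreal ((1 + \<sigma>\<^sup>2) powr \<beta> * (norm (ft ?F2 (\<sigma> *\<^sub>R unit_vec \<theta>\<^sub>0)))\<^sup>2) \<partial>lborel) \<le>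
        (\<integral>\<^sup>+\<sigma>. ennreal ((1 + \<sigma>\<^sup>2) powr (max \<beta> 0) * (norm (ft ?F2 (\<sigma> *\<^sub>R unit_vec \<theta>\<^sub>0)))\<^sup>2) \<partial>lborel)"
      by (intro nn_integral_mono ennreal_leI mult_right_mono powr_mono) auto
    also have "\<dots> < \<infinity>"
      by (rule weighted_partition[OF F(1) _ b\<Omega> A2 k' bg decay]) (use F(3) \<open>\<beta> < lam\<close> lam in auto)
    finally show "(\<integral>\<^sup>+\<sigma>. ennreal ((1 + \<sigma>\<^sup>2) powr \<beta> * (norm (ft (\<lambda>s. \<eta> s * slice \<theta>\<^sub>0 F1 s) \<sigma>))\<^sup>2) \<partial>lborel) < \<infinity>"
      unfolding ft_eq .
  qed
  then show ?thesis unfolding nl .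
qed

end
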